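(* Let $\Sigma$ be an oriented, metrically complete, finite-volume hyperbolic surface, and let $\Gamma$ be a closed geodesic on $\Sigma$ of length $L$. Then the self-intersection number of $\Gamma$ satisfies $$|\Gamma\cap\Gamma|<9L^2e^{L/2}.$$
   Context: A closed geodesic $\Gamma$ of length $L$ on $\Sigma$ is represented by a local isometry $f:S^1\to\Sigma$, where $S^1$ is a circle of length $L$. Its set of self-intersection points is $\mathcal D=\{x\in\Sigma : \exists\, s,t\in S^1,\ s\neq t,\ f(s)=f(t)=x\}$, and its self-intersection number is $$|\Gamma\cap\Gamma|:=\sum_{x\in\mathcal D}\binom{\# f^{-1}(x)}{2}.$$
   Formalization: The closed geodesic is assumed primitive (traversed once, L its least period); for a geodesic running several times around a shorter one, every image point is a self-intersection point, the defining sum is infinite and the stated bound fails. *)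

theory Defs
  imports "HOL-Analysis.Analysis"
begin

section \<open>The hyperbolic plane (upper half-plane model)\<close>

definition upper_half_plane :: "complex set" where
  "upper_half_plane = {z. 0 < Im z}"

definition hyp_dist :: "complex \<Rightarrow> complex \<Rightarrow> real" where
  "hyp_dist z w = arcosh (1 + (cmod (z - w))\<^sup>2 / (2 * Im z * Im w))"

text \<open>The Riemannian area \<open>dx dy / y\<^sup>2\<close>; only ever evaluated on subsets of the upper half-plane.\<close>

definition hyp_area :: "complex measure" where
  "hyp_area = density lborel (\<lambda>z. ennreal (1 / (Im z)\<^sup>2))"

text \<open>The action of \<open>PSL(2,\<real>)\<close>, that is, the orientation-preserving isometries.\<close>

definition PSL2R_maps :: "(complex \<Rightarrow> complex) set" where
  "PSL2R_maps = {\<lambda>z. (of_real a * z + of_real b) / (of_real c * z + of_real d) | a b c d :: real.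
     a * d - b * c = 1}"

section \<open>Hyperbolic surfaces\<close>

definition curve_length :: "(real \<Rightarrow> 'a::metric_space) \<Rightarrow> ennreal" where
  "curve_length g = (SUP ts \<in> {ts. sorted ts \<and> set ts \<subseteq> {0..1}}.
     \<Sum>i < length ts - 1. ennreal (dist (g (ts ! i)) (g (ts ! Suc i))))"

text \<open>The distance is the infimum of the lengths of connecting curves, as it is for the distance
  of a connected Riemannian manifold. The infimum over the empty set is \<open>\<infinity>\<close>, so the space
  is in particular path-connected.\<close>

definition intrinsic_metric :: "'a::metric_space itself \<Rightarrow> bool" where
  "intrinsic_metric _ \<longleftrightarrow> (\<forall>x y :: 'a. ennreal (dist x y) =
     (INF g \<in> {g. path g \<and> pathstart g = x \<and> pathfinish g = y}. curve_length g))"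

text \<open>The surface is the whole type \<open>'a\<close> with its metric. The hyperbolic structure and the
  orientation are given by an atlas of pairs \<open>(U, \<phi>)\<close>: each \<open>\<phi>\<close> is an isometry from the open
  set \<open>U\<close> onto an open subset of the hyperbolic plane, and the coordinate changes are
  locally restrictions of orientation-preserving isometries.
  On a Riemannian surface of curvature \<open>-1\<close> without boundary, small balls provide such charts.\<close>

definition oriented_hyperbolic_atlas :: "('a::metric_space set \<times> ('a \<Rightarrow> complex)) set \<Rightarrow> bool" where
  "oriented_hyperbolic_atlas A \<longleftrightarrow>
     (\<forall>x. \<exists>(U, \<phi>) \<in> A. x \<in> U) \<and>
     (\<forall>(U, \<phi>) \<in> A. open U \<and> open (\<phi> ` U) \<and> \<phi> ` U \<subseteq> upper_half_plane \<and>
        (\<forall>x\<in>U. \<forall>y\<in>U. hyp_dist (\<phi> x) (\<phi> y) = dist x y)) \<and>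
     (\<forall>(U, \<phi>) \<in> A. \<forall>(V, \<psi>) \<in> A. \<forall>x \<in> U \<inter> V.
        \<exists>W g. open W \<and> x \<in> W \<and> W \<subseteq> U \<inter> V \<and> g \<in> PSL2R_maps \<and> (\<forall>y\<in>W. \<psi> y = g (\<phi> y)))"

definition oriented_hyperbolic_surface :: "('a::metric_space set \<times> ('a \<Rightarrow> complex)) set \<Rightarrow> bool" where
  "oriented_hyperbolic_surface A \<longleftrightarrow> intrinsic_metric TYPE('a) \<and> oriented_hyperbolic_atlas A"

text \<open>The area of the surface is the Borel measure that is the hyperbolic area in every chart.
  It exists, and it is unique because the surface is second countable.\<close>

definition is_area_measure ::
    "('a::metric_space set \<times> ('a \<Rightarrow> complex)) set \<Rightarrow> 'a measure \<Rightarrow> bool" where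
  "is_area_measure A \<mu> \<longleftrightarrow> sets \<mu> = sets borel \<and>
     (\<forall>(U, \<phi>) \<in> A. \<forall>B \<in> sets borel. B \<subseteq> U \<longrightarrow> emeasure \<mu> B = emeasure hyp_area (\<phi> ` B))"

definition finite_volume :: "('a::metric_space set \<times> ('a \<Rightarrow> complex)) set \<Rightarrow> bool" where
  "finite_volume A \<longleftrightarrow> (\<exists>\<mu>. is_area_measure A \<mu> \<and> emeasure \<mu> UNIV < \<infinity>)"

section \<open>Closed geodesics and self-intersections\<close>

text \<open>The circle of length \<open>L\<close> is \<open>\<real>/L\<int>\<close>: a map on it is an \<open>L\<close>-periodic function on the reals, and
  its points are represented by \<open>{0..<L}\<close>.\<close>

definition closed_geodesic :: "(real \<Rightarrow> 'a::metric_space) \<Rightarrow> real \<Rightarrow> bool" where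
  "closed_geodesic f L \<longleftrightarrow> 0 < L \<and> (\<forall>t. f (t + L) = f t) \<and>
     (\<forall>t. \<exists>e>0. \<forall>r s. \<bar>r - t\<bar> < e \<longrightarrow> \<bar>s - t\<bar> < e \<longrightarrow> dist (f r) (f s) = \<bar>r - s\<bar>)"

text \<open>The curve is traversed once. For a closed geodesic running several times around a shorter
  one, every point of the image has several preimages, and the self-intersection number
  below is \<open>\<infinity>\<close>.\<close>

definition primitive_period :: "(real \<Rightarrow> 'a) \<Rightarrow> real \<Rightarrow> bool" where
  "primitive_period f L \<longleftrightarrow> (\<forall>p. 0 < p \<and> p < L \<longrightarrow> (\<exists>t. f (t + p) \<noteq> f t))"

definition self_intersection_points :: "(real \<Rightarrow> 'a) \<Rightarrow> real \<Rightarrow> 'a set" where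
  "self_intersection_points f L =
     {x. \<exists>s\<in>{0..<L}. \<exists>t\<in>{0..<L}. s \<noteq> t \<and> f s = x \<and> f t = x}"

text \<open>The sum is taken in \<open>[0, \<infinity>]\<close>, so that a finite value means that there are only finitely many
  self-intersection points. The fibres of a closed geodesic are always finite.\<close>

definition self_intersection_number :: "(real \<Rightarrow> 'a) \<Rightarrow> real \<Rightarrow> ennreal" where
  "self_intersection_number f L =
     (\<Sum>\<^sub>\<infinity>x \<in> self_intersection_points f L. of_nat (card {t \<in> {0..<L}. f t = x} choose 2))"

end

theory Submission
  imports Defs
begin

text \<open>Lift the geodesic to the imaginary axis of the hyperbolic plane, so that it becomes the axis of
  a deck transformation \<open>T\<close> of translation length \<open>L\<close>. A self-intersection is a deck transformation
  moving one point of the axis to another, and no two of them give the same transformation.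
  For non-commuting deck transformations \<open>g\<close>, \<open>h\<close> and every point \<open>x\<close>,
  \<open>sinh (d(x, g x) / 2) * sinh (d(x, h x) / 2) \<ge> 1\<close>. With \<open>h = T\<close> this shows that near the
  axis every nontrivial deck transformation satisfies \<open>sinh (d(x, g x) / 2) \<ge> 1 / sinh (L / 2)\<close>; and
  transformations of small displacement commute, hence lie in a one-parameter group. So two arcs of length
  at most \<open>1/2\<close> intersect at most \<open>1 + 2 * sinh (L / 2)\<close> times. A self-intersection forces \<open>L \<ge> 1\<close>, and
  the geodesic consists of at most \<open>3 * L\<close> such arcs.\<close>

section \<open>Torsion-free discrete groups of real matrices\<close>

text \<open>The group is kept in SL(2,R) rather than PSL(2,R), since traces there obey polynomial
  identities. The price is that each isometry occurs as \<open>A\<close> and \<open>- A\<close>, so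
  signs are repeatedly normalised to trace at least 2. Freeness of the action says that no trace
  lies strictly between -2 and 2. This gap yields the inequality for noncommuting elements;
  discreteness only serves to exclude noncommuting pairs with a common fixed point at infinity. No
  covering space is presupposed. An inverse chart is continued from a small disc to the whole
  half-plane, completeness carrying it across the boundary of each ball, and a deck transformation
  is a matrix leaving the resulting map invariant. The arc length 1/2 is chosen because sinh (1/2) <
  1, so that elements moving a point by at most 1 commute. At most 3 L arcs give at most 9 L^2
  ordered pairs of arcs, each carrying at most 1 + 2 sinh (L/2) < 2 exp (L/2) ordered pairs of
  parameters. The resulting 18 L^2 exp (L/2) is halved because each intersection is met in both
  orders.\<close>

datatype mat2 = Mat2 real real real real

instantiation mat2 :: monoid_mult
begin

definition one_mat2 :: mat2 where "1 = Mat2 1 0 0 1"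

fun times_mat2 :: "mat2 \<Rightarrow> mat2 \<Rightarrow> mat2" where
  "Mat2 a b c d * Mat2 a' b' c' d' =
     Mat2 (a * a' + b * c') (a * b' + b * d') (c * a' + d * c') (c * b' + d * d')"

instance
proof
  fix A B C :: mat2
  show "A * B * C = A * (B * C)"
    by (cases A; cases B; cases C) (simp add: algebra_simps)
  show "1 * A = A" by (cases A) (simp add: one_mat2_def)
  show "A * 1 = A" by (cases A) (simp add: one_mat2_def)
qed

end

instantiation mat2 :: uminus
begin
fun uminus_mat2 :: "mat2 \<Rightarrow> mat2" where "- Mat2 a b c d = Mat2 (-a) (-b) (-c) (-d)"
instance ..
end

fun mdet :: "mat2 \<Rightarrow> real" where "mdet (Mat2 a b c d) = a * d - b * c"
fun mtr :: "mat2 \<Rightarrow> real" where "mtr (Mat2 a b c d) = a + d"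
fun madj :: "mat2 \<Rightarrow> mat2" where "madj (Mat2 a b c d) = Mat2 d (-b) (-c) a"

text \<open>For a matrix of determinant 1 this is \<open>sinh\<^sup>2 (d/2)\<close>, where \<open>d\<close> is the distance by which
  the Moebius transformation moves the point \<open>\<i>\<close>.\<close>

fun mdisp :: "mat2 \<Rightarrow> real" where "mdisp (Mat2 a b c d) = ((a - d)\<^sup>2 + (b + c)\<^sup>2) / 4"

text \<open>A quarter of the discriminant of the characteristic polynomial. For a hyperbolic matrix
  of determinant 1 it is sinh^2 (l/2) with l the translation length, and for a parabolic one it is
  0.\<close>

definition mdisc :: "mat2 \<Rightarrow> real" where "mdisc A = (mtr A)\<^sup>2 / 4 - mdet A"

text \<open>The Gram determinant of the traceless parts of \<open>A\<close> and \<open>B\<close> for the quadratic form \<open>-det\<close>.\<close>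

definition mgram :: "mat2 \<Rightarrow> mat2 \<Rightarrow> real" where
  "mgram A B = (mtr (A * B) / 2 - mtr A * mtr B / 4)\<^sup>2 - mdisc A * mdisc B"

section \<open>Trace identities for 2x2 matrices\<close>

lemma mdet_mult [simp]: "mdet (A * B) = mdet A * mdet B"
  by (cases A; cases B) (simp add: algebra_simps)

lemma mdet_one [simp]: "mdet 1 = 1" and mtr_one [simp]: "mtr 1 = 2" and mdisp_one [simp]: "mdisp 1 = 0"
  by (simp_all add: one_mat2_def)

lemma mdet_uminus [simp]: "mdet (- A) = mdet A"
  and mtr_uminus [simp]: "mtr (- A) = - mtr A"
  and mdisp_uminus [simp]: "mdisp (- A) = mdisp A"
  and mult_uminus_left: "(- A) * B = - (A * B)"
  and mult_uminus_right: "A * (- B) = - (A * B)"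
  and uminus_uminus_mat2 [simp]: "- (- A) = A"
  by (cases A; cases B; simp add: power2_eq_square algebra_simps)+

lemma uminus_mat2_inject: "- A = - (B :: mat2) \<longleftrightarrow> A = B"
  by (metis uminus_uminus_mat2)

lemma mdet_madj [simp]: "mdet (madj A) = mdet A"
  and mtr_madj [simp]: "mtr (madj A) = mtr A"
  and mdisp_madj [simp]: "mdisp (madj A) = mdisp A"
  and madj_madj [simp]: "madj (madj A) = A"
  by (cases A; simp add: power2_eq_square algebra_simps)+

lemma madj_right: "mdet A = 1 \<Longrightarrow> A * madj A = 1"
  and madj_left: "mdet A = 1 \<Longrightarrow> madj A * A = 1"
  by (cases A; simp add: one_mat2_def algebra_simps)+

lemma mtr_mult_commute: "mtr (A * B) = mtr (B * A)"
  by (cases A; cases B) (simp add: algebra_simps)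

lemma mtr_madj_mult: "mtr (madj A * B) = mtr A * mtr B - mtr (A * B)"
  by (cases A; cases B) (simp add: algebra_simps)

lemma mtr_recurrence: "mtr (A * (A * C)) = mtr A * mtr (A * C) - mdet A * mtr C"
  by (cases A; cases C) (simp add: algebra_simps)

text \<open>Fricke's identity: with determinants 1 and x, y, z the traces of \<open>A\<close>,
  \<open>B\<close>, \<open>A * B\<close>, the commutator has trace x^2 + y^2 + z^2 - xyz - 2.
  Writing it through \<open>mgram\<close> turns the trace gap into a gap for the Gram
  determinant.\<close>

lemma mtr_commutator: "mtr (A * B * madj A * madj B) = 4 * mgram A B + 2 * mdet A * mdet B"
  unfolding mgram_def mdisc_def
  by (cases A; cases B) (simp add: power2_eq_square field_simps)

lemma mgram_commute: "mgram A B = mgram B A"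
  unfolding mgram_def by (simp add: mtr_mult_commute mult.commute)

lemma mgram_madj_left: "mgram (madj A) B = mgram A B"
  unfolding mgram_def mdisc_def
  by (simp add: mtr_madj_mult) (simp add: power2_eq_square field_simps)

lemma mtr_conj: "mdet B = 1 \<Longrightarrow> mtr (B * A * madj B) = mtr A"
  by (metis madj_left monoid_mult_class.mult_1_left mtr_mult_commute mult.assoc)

text \<open>Replacing the conjugate of \<open>A\<close> by its inverse turns the product into the
  commutator of \<open>A\<close> and \<open>B\<close>, so the identity for
  \<open>mtr (madj A * B)\<close> reduces this to \<open>mtr_commutator\<close>.\<close>

lemma mtr_mult_conj:
  assumes "mdet B = 1"
  shows "mtr (A * (B * A * madj B)) = (mtr A)\<^sup>2 - (4 * mgram A B + 2 * mdet A)"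
proof -
  have 2: "madj (B * A * madj B) = B * madj A * madj B"
    by (cases A; cases B) (simp add: algebra_simps)
  have "mtr (A * madj (B * A * madj B)) = mtr A * mtr A - mtr (A * (B * A * madj B))"
    by (metis assms mtr_conj mtr_madj_mult mtr_mult_commute)
  then show ?thesis
    using mtr_commutator[of A B] assms unfolding 2 by (simp add: mult.assoc power2_eq_square)
qed

text \<open>For \<open>mgram A B\<close> strictly between 0 and \<open>mdisc A\<close> the right
  side is negative: the axis of \<open>A\<close> and its image under \<open>B\<close> then cross.
  Equality with \<open>mdisc A\<close> is the borderline case treated separately below.\<close>

lemma mgram_conj:
  assumes "mdet B = 1"
  shows "mgram A (B * A * madj B) = - 4 * mgram A B * (mdisc A - mgram A B)"
proof -
  have "mdisc (B * A * madj B) = mdisc A"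
    unfolding mdisc_def mtr_conj[OF assms] using assms by simp
  then show ?thesis
    unfolding mgram_def[of A "B * A * madj B"] mtr_mult_conj[OF assms] mtr_conj[OF assms] mdisc_def
    by (simp add: assms power2_eq_square field_simps)
qed

text \<open>For hyperbolic elements of determinant 1: no point moves by less than the translation
  length. The defect is the square of the rotational coordinate (b - c)/2.\<close>

lemma mdisc_le_mdisp: "mdisc A \<le> mdisp A"
proof (cases A)
  case (Mat2 a b c d)
  have "mdisp A - mdisc A = ((b - c) / 2)\<^sup>2"
    unfolding mdisc_def Mat2 by (simp add: power2_eq_square field_simps)
  then show ?thesis using zero_le_power2[of "(b - c) / 2"] by linarith
qed

text \<open>The coordinates (p, q, r) diagonalise the form \<open>-det\<close> on traceless matrices
  with signature (2,1). Cauchy-Schwarz in Lagrange form handles the positive part, and the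
  assumptions say that neither vector is timelike.\<close>

lemma gram_bound_aux:
  fixes p q r p' q' r' :: real
  assumes "r\<^sup>2 \<le> p\<^sup>2 + q\<^sup>2" "r'\<^sup>2 \<le> p'\<^sup>2 + q'\<^sup>2"
  shows "(p * p' + q * q' - r * r')\<^sup>2 - (p\<^sup>2 + q\<^sup>2 - r\<^sup>2) * (p'\<^sup>2 + q'\<^sup>2 - r'\<^sup>2)
    \<le> 4 * ((p\<^sup>2 + q\<^sup>2) * (p'\<^sup>2 + q'\<^sup>2))"
proof -
  define v w where "v = p\<^sup>2 + q\<^sup>2" and "w = p'\<^sup>2 + q'\<^sup>2"
  have vw: "0 \<le> v" "0 \<le> w" unfolding v_def w_def by auto
  have 1: "r\<^sup>2 * r'\<^sup>2 \<le> v * w" "v * r'\<^sup>2 \<le> v * w" "r\<^sup>2 * w \<le> v * w"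
    using assms vw unfolding v_def[symmetric] w_def[symmetric] by (auto intro!: mult_mono)
  have 2: "(p * p' + q * q')\<^sup>2 + (p * q' - q * p')\<^sup>2 = v * w"
    unfolding v_def w_def by (simp add: power2_eq_square algebra_simps)
  have 3: "- 2 * (p * p' + q * q') * (r * r') \<le> (p * p' + q * q')\<^sup>2 + r\<^sup>2 * r'\<^sup>2"
    using zero_le_power2[of "p * p' + q * q' + r * r'"] by (simp add: power2_eq_square algebra_simps)
  have "(p * p' + q * q' - r * r')\<^sup>2 - (v - r\<^sup>2) * (w - r'\<^sup>2) =
     v * r'\<^sup>2 + r\<^sup>2 * w - 2 * (p * p' + q * q') * (r * r') - (v * w - (p * p' + q * q')\<^sup>2)"
    by (simp add: power2_eq_square algebra_simps)
  also have "\<dots> \<le> 4 * (v * w)" using 1 2 3 zero_le_power2[of "p * q' - q * p'"] by linarith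
  finally show ?thesis unfolding v_def w_def .
qed

lemma mgram_le:
  assumes "0 \<le> mdisc A" "0 \<le> mdisc B"
  shows "mgram A B \<le> 4 * (mdisp A * mdisp B)"
proof (cases A; cases B)
  fix a b c d a' b' c' d' assume A: "A = Mat2 a b c d" and B: "B = Mat2 a' b' c' d'"
  let ?p = "(a - d) / 2" and ?q = "(b + c) / 2" and ?r = "(b - c) / 2"
  let ?p' = "(a' - d') / 2" and ?q' = "(b' + c') / 2" and ?r' = "(b' - c') / 2"
  have 1: "mdisp A = ?p\<^sup>2 + ?q\<^sup>2" "mdisp B = ?p'\<^sup>2 + ?q'\<^sup>2"
    "mdisc A = ?p\<^sup>2 + ?q\<^sup>2 - ?r\<^sup>2" "mdisc B = ?p'\<^sup>2 + ?q'\<^sup>2 - ?r'\<^sup>2"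
    "mtr (A * B) / 2 - mtr A * mtr B / 4 = ?p * ?p' + ?q * ?q' - ?r * ?r'"
    unfolding A B mdisc_def by (simp_all add: power2_eq_square field_simps)
  show ?thesis unfolding mgram_def 1 using gram_bound_aux[of ?r ?p ?q ?r' ?p' ?q'] assms 1 by simp
qed

text \<open>Applied to half the traces of A^n B. The quadratic expression \<open>Q\<close> is
  constant along the recurrence. The sequence is forced to descend below 1, and by the gap it must
  jump to at most -1; evaluating \<open>Q\<close> on the two terms around the jump gives the
  bound.\<close>

lemma sign_change_recurrence:
  fixes f :: "nat \<Rightarrow> real"
  assumes rec: "\<And>n. f (Suc (Suc n)) = 2 * \<alpha> * f (Suc n) - f n"
    and \<alpha>: "1 \<le> \<alpha>" and f0: "1 \<le> f 0" and f1: "f 1 < f 0" and gap: "\<And>n. 1 \<le> \<bar>f n\<bar>"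
    and Q: "(f 0)\<^sup>2 + (f 1)\<^sup>2 - 2 * \<alpha> * f 0 * f 1 = Q" "0 < Q"
  shows "2 + 2 * \<alpha> \<le> Q"
proof -
  have inv: "(f n)\<^sup>2 + (f (Suc n))\<^sup>2 - 2 * \<alpha> * f n * f (Suc n) = Q" for n
  proof (induction n)
    case 0
    then show ?case using Q(1) by simp
  next
    case (Suc n)
    then show ?case unfolding rec by (simp add: power2_eq_square algebra_simps)
  qed
  \<comment> \<open>The invariant with one factor rewritten by the recurrence; positivity of
    \<open>Q\<close> makes every descent propagate to the next term.\<close>
  have log_concave: "(f (Suc n))\<^sup>2 - f n * f (Suc (Suc n)) = Q" for n
    using inv[of n] unfolding rec by (simp add: power2_eq_square algebra_simps)
  have "\<exists>n. f n < 1"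
  proof (rule ccontr)
    assume "\<not> (\<exists>n. f n < 1)"
    then have ge: "1 \<le> f n" for n by (meson not_le)
    have dec: "f (Suc n) < f n" for n
    proof (induction n)
      case 0
      then show ?case using f1 by simp
    next
      case (Suc n)
      have "f n * f (Suc (Suc n)) < f (Suc n) * f (Suc n)"
        using log_concave[of n] Q(2) by (simp add: power2_eq_square)
      also have "\<dots> \<le> f n * f (Suc n)"
        using Suc ge[of "Suc n"] by (intro mult_right_mono) auto
      finally show ?case using ge[of n] by (simp add: mult_less_cancel_left)
    qed
    \<comment> \<open>As long as the terms stay positive each drop has size at least sqrt Q, so
      infinitely many drops are impossible.\<close>
    have step: "sqrt Q \<le> f n - f (Suc n)" for n
    proof -
      have "(f n - f (Suc n))\<^sup>2 = Q + 2 * (\<alpha> - 1) * (f n * f (Suc n))"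
        using inv[of n] by (simp add: power2_eq_square algebra_simps)
      moreover have "0 \<le> 2 * (\<alpha> - 1) * (f n * f (Suc n))"
        using \<alpha> ge[of n] ge[of "Suc n"] by simp
      ultimately have "Q \<le> (f n - f (Suc n))\<^sup>2" by linarith
      then show ?thesis using dec[of n] by (simp add: real_le_lsqrt)
    qed
    have "f n \<le> f 0 - n * sqrt Q" for n
    proof (induction n)
      case (Suc n)
      then show ?case using step[of n] by (simp add: algebra_simps)
    qed simp
    moreover obtain n :: nat where "f 0 < n * sqrt Q"
      using reals_Archimedean3[of "sqrt Q"] Q(2) by auto
    ultimately have "f n < 0" by (meson diff_less_0_iff_less order_le_less_trans)
    then show False using ge[of n] by simp
  qed
  then obtain n where n: "f n < 1" "\<And>m. m < n \<Longrightarrow> \<not> f m < 1"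
    using exists_least_iff[of "\<lambda>n. f n < 1"] by auto
  then obtain m where m: "n = Suc m" using f0 by (cases n) auto
  have a: "1 \<le> f m" "1 \<le> - f (Suc m)" using n(1) n(2)[of m] gap[of n] unfolding m by auto
  have "1 * 1 \<le> f m * (- f (Suc m))" using a by (intro mult_mono) auto
  then have "\<alpha> * 1 \<le> \<alpha> * (f m * (- f (Suc m)))" using \<alpha> by (intro mult_left_mono) auto
  moreover have "1 \<le> (f m)\<^sup>2" "1 \<le> (f (Suc m))\<^sup>2" using a
    using abs_le_square_iff[of 1 "f m"] abs_le_square_iff[of 1 "f (Suc m)"] by auto
  ultimately show ?thesis using inv[of m] by (simp add: algebra_simps)
qed

text \<open>With a = cosh u, b = cosh v and s, t the corresponding sinh values divided by sqrt
  \<kappa>, this is sinh (v - u) \<le> sinh v - sinh u for 0 \<le> u \<le> v. The algebraic form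
  also covers the parabolic case \<kappa> = 0.\<close>

lemma separation_aux_pos:
  fixes a b \<kappa> s t :: real
  assumes "1 \<le> a" "1 \<le> b" "a\<^sup>2 = 1 + \<kappa> * s\<^sup>2" "b\<^sup>2 = 1 + \<kappa> * t\<^sup>2" "0 \<le> \<kappa>" "0 \<le> s" "s \<le> t"
  shows "\<bar>a * t - b * s\<bar> \<le> t - s"
proof -
  have "(a * t)\<^sup>2 - (b * s)\<^sup>2 = t\<^sup>2 - s\<^sup>2"
    using assms(3,4) by (simp add: power_mult_distrib algebra_simps)
  moreover have "s\<^sup>2 \<le> t\<^sup>2" using assms by (intro power_mono) auto
  ultimately have "(b * s)\<^sup>2 \<le> (a * t)\<^sup>2" by linarith
  moreover have "0 \<le> a * t" by (rule mult_nonneg_nonneg) (use assms(1,6,7) in linarith)+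
  ultimately have le: "b * s \<le> a * t" by (rule power2_le_imp_le)
  have "(b - 1) * s * ((a + 1) * (b + 1)) - (a - 1) * t * ((a + 1) * (b + 1)) =
     (b\<^sup>2 - 1) * s * (a + 1) - (a\<^sup>2 - 1) * t * (b + 1)" by (simp add: power2_eq_square algebra_simps)
  also have "\<dots> = \<kappa> * s * t * ((a * t - b * s) + (t - s))"
  proof -
    have "b\<^sup>2 - 1 = \<kappa> * t\<^sup>2" "a\<^sup>2 - 1 = \<kappa> * s\<^sup>2" using assms(3,4) by auto
    then show ?thesis by (simp only:) (simp add: power2_eq_square algebra_simps)
  qed
  also have "\<dots> \<ge> 0" using assms(5-7) le by (intro mult_nonneg_nonneg add_nonneg_nonneg) auto
  finally have "0 \<le> ((b - 1) * s - (a - 1) * t) * ((a + 1) * (b + 1))" by (simp add: algebra_simps)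
  moreover have "0 < (a + 1) * (b + 1)" using assms(1,2) by simp
  ultimately have "0 \<le> (b - 1) * s - (a - 1) * t" by (simp only: zero_le_mult_iff) linarith
  then show ?thesis using le by (simp add: algebra_simps)
qed

lemma separation_aux:
  fixes a b \<kappa> s t :: real
  assumes "1 \<le> a" "1 \<le> b" "a\<^sup>2 = 1 + \<kappa> * s\<^sup>2" "b\<^sup>2 = 1 + \<kappa> * t\<^sup>2" "0 \<le> \<kappa>" "0 \<le> s * t"
  shows "\<bar>a * t - b * s\<bar> \<le> \<bar>t - s\<bar>"
proof -
  have *: "\<bar>a * t - b * s\<bar> \<le> \<bar>t - s\<bar>" if "0 \<le> s" "0 \<le> t" "a\<^sup>2 = 1 + \<kappa> * s\<^sup>2" "b\<^sup>2 = 1 + \<kappa> * t\<^sup>2" for s t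
  proof (cases "s \<le> t")
    case True
    then show ?thesis using separation_aux_pos[of a b \<kappa> s t] assms(1,2,5) that by linarith
  next
    case False
    then show ?thesis using separation_aux_pos[of b a \<kappa> t s] assms(1,2,5) that by (simp add: abs_minus_commute)
  qed
  show ?thesis
  proof (cases "0 \<le> s \<and> 0 \<le> t")
    case True
    then show ?thesis using * assms by blast
  next
    case False
    then have "0 \<le> - s" "0 \<le> - t" using assms(6) by (auto simp: zero_le_mult_iff)
    then show ?thesis using *[of "- s" "- t"] assms(3,4) by (simp add: abs_minus_commute)
  qed
qed

text \<open>Models the preimage in SL(2,R) of a discrete group acting freely on the half-plane:
  \<open>neg\<close> keeps both lifts of an isometry, \<open>trace\<close> forbids rotations, and
  \<open>discrete\<close> is expressed through the displacement of the point \<i>.\<close>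

locale torsion_free_group =
  fixes S :: "mat2 set"
  assumes det: "A \<in> S \<Longrightarrow> mdet A = 1"
    and one: "1 \<in> S"
    and mult: "A \<in> S \<Longrightarrow> B \<in> S \<Longrightarrow> A * B \<in> S"
    and inv: "A \<in> S \<Longrightarrow> madj A \<in> S"
    and neg: "A \<in> S \<Longrightarrow> - A \<in> S"
    and trace: "A \<in> S \<Longrightarrow> 2 \<le> \<bar>mtr A\<bar>"
    and discrete: "\<exists>r>0. \<forall>A\<in>S. mdisp A < r \<longrightarrow> A = 1 \<or> A = - 1"
begin

lemma mdisc_nonneg: "A \<in> S \<Longrightarrow> 0 \<le> mdisc A"
  using trace[of A] det[of A] abs_le_square_iff[of 2 "mtr A"] unfolding mdisc_def by (auto simp: field_simps)

lemma power_mem: "A \<in> S \<Longrightarrow> A ^ n \<in> S"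
  by (induction n) (auto simp: one mult)

text \<open>The commutator has trace 4 \<open>mgram A B\<close> + 2 < 2, so the trace gap pushes it
  down to at most -2.\<close>

lemma mgram_neg_le:
  assumes "A \<in> S" "B \<in> S" "mgram A B < 0"
  shows "mgram A B \<le> - 1"
  using trace[of "A * B * madj A * madj B"] mtr_commutator[of A B] assms
  by (auto simp: det mult inv abs_if split: if_splits)

text \<open>Writing the given element as 1 + P, conjugation by \<open>A\<close> multiplies P by
  \<mu>. Iterating it produces group elements 1 + \<mu>^n P converging to the identity, which
  discreteness permits only for P = 0.\<close>

lemma contracting_conjugation:
  assumes A: "A \<in> S" and \<mu>: "0 < \<mu>" "\<mu> < 1"
    and conj: "\<And>t. A * Mat2 (1 + t * p) (t * q) (t * q') (1 - t * p) * madj A =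
      Mat2 (1 + (\<mu> * t) * p) ((\<mu> * t) * q) ((\<mu> * t) * q') (1 - (\<mu> * t) * p)"
    and P: "Mat2 (1 + p) q q' (1 - p) \<in> S"
  shows "p = 0 \<and> q = 0 \<and> q' = 0"
proof -
  define U where "U t = Mat2 (1 + t * p) (t * q) (t * q') (1 - t * p)" for t
  have U: "U (\<mu> ^ n) \<in> S" for n
  proof (induction n)
    case 0
    then show ?case using P by (simp add: U_def)
  next
    case (Suc n)
    then have "A * U (\<mu> ^ n) * madj A \<in> S" using A by (intro mult inv) auto
    then show ?case using conj unfolding U_def by simp
  qed
  obtain r where r: "0 < r" "\<And>A. A \<in> S \<Longrightarrow> mdisp A < r \<Longrightarrow> A = 1 \<or> A = - 1"
    using discrete by auto
  have "(\<lambda>n. (\<mu> ^ n)\<^sup>2 * (((2 * p)\<^sup>2 + (q + q')\<^sup>2) / 4)) \<longlonglongrightarrow> 0\<^sup>2 * (((2 * p)\<^sup>2 + (q + q')\<^sup>2) / 4)"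
    using \<mu> by (intro tendsto_intros LIMSEQ_power_zero) auto
  then have "\<forall>\<^sub>F n in sequentially. (\<mu> ^ n)\<^sup>2 * (((2 * p)\<^sup>2 + (q + q')\<^sup>2) / 4) < r"
    using r(1) by (intro order_tendstoD(2)) auto
  then obtain n where n: "(\<mu> ^ n)\<^sup>2 * (((2 * p)\<^sup>2 + (q + q')\<^sup>2) / 4) < r"
    unfolding eventually_sequentially by blast
  have "mdisp (U t) = t\<^sup>2 * (((2 * p)\<^sup>2 + (q + q')\<^sup>2) / 4)" for t
    unfolding U_def by (simp add: power2_eq_square field_simps)
  then have "U (\<mu> ^ n) = 1 \<or> U (\<mu> ^ n) = - 1" using n by (intro r(2) U) (simp only:)
  then show ?thesis using \<mu> by (auto simp: U_def one_mat2_def)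
qed


text \<open>A vanishing Gram determinant makes Z = AB - BA nilpotent, so if Z is nonzero its kernel
  is a common eigenvector, a shared fixed point at infinity. If one element is hyperbolic, it or its
  inverse contracts the unipotent commutator to the identity; two parabolic elements with a common
  fixed point commute anyway.\<close>

lemma mgram_eq_0_imp_commute:
  assumes A: "A \<in> S" and B: "B \<in> S" and J: "mgram A B = 0"
  shows "A * B = B * A"
proof -
  have main: "A * B = B * A" if A: "A \<in> S" and B: "B \<in> S" and J: "mgram A B = 0"
    and k: "0 < mdisc A" for A B
  proof (rule ccontr)
    assume neq: "A * B \<noteq> B * A"
    obtain a b c d where Ad: "A = Mat2 a b c d" by (cases A)
    obtain a' b' c' d' where Bd: "B = Mat2 a' b' c' d'" by (cases B)
    \<comment> \<open>The entries of Z = AB - BA, which has rows (p, q) and (q', -p).\<close>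
    define p q q' where "p = b * c' - b' * c" and "q = a * b' + b * d' - (a' * b + b' * d)"
      and "q' = c * a' + d * c' - (c' * a + d' * c)"
    have dets: "a * d - b * c = 1" "a' * d' - b' * c' = 1"
      using det[OF A] det[OF B] unfolding Ad Bd by auto
    have Z0: "\<not> (p = 0 \<and> q = 0 \<and> q' = 0)"
      using neq unfolding Ad Bd p_def q_def q'_def by (auto simp: algebra_simps)
    have nil: "p\<^sup>2 + q * q' = 0"
    proof -
      have "p\<^sup>2 + q * q' = 4 * mgram A B"
        unfolding p_def q_def q'_def mgram_def mdisc_def Ad Bd
        by (simp add: power2_eq_square field_simps)
      then show ?thesis using J by simp
    qed
    \<comment> \<open>In matrix terms: if Z is nilpotent of rank one and tr (M Z) = 0, then M Z = e
      Z with e an eigenvalue of M. Indeed M maps the image of Z into the kernel of Z, which is the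
      same line.\<close>
    have eigen: "\<exists>e. e\<^sup>2 - (x + w) * e + 1 = 0 \<and> x * p + y * q' = e * p \<and> x * q - y * p = e * q
        \<and> z * p + w * q' = e * q' \<and> z * q - w * p = - e * p"
      if tr: "(x - w) * p + y * q' + z * q = 0" and dt: "x * w - y * z = 1" for x y z w
    proof (cases "q = 0")
      case False
      define l where "l = (x * q - y * p) / q"
      have lq: "l * q = x * q - y * p" using False by (simp add: l_def)
      have 1: "(x * p + y * q' - l * p) * q = 0"
        using lq nil by algebra
      have 2: "(z * q - w * p + l * p) * q = 0" using lq nil tr by algebra
      have 3: "x * p + y * q' = l * p" "z * q - w * p = - l * p" using 1 2 False by auto
      have 4: "(z * p + w * q' - l * q') * q = 0" using lq nil tr 3 by algebra
      have 5: "(l\<^sup>2 - (x + w) * l + 1) * q = 0" using lq 3 dt by algebra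
      show ?thesis using lq 3 4 5 False by (intro exI[of _ l]) auto
    next
      case True
      then have p: "p = 0" and q': "q' \<noteq> 0" using nil Z0 by auto
      have y: "y = 0" using tr True p q' by auto
      show ?thesis using True p q' y dt
        by (intro exI[of _ w]) (simp add: power2_eq_square algebra_simps)
    qed
    have trA: "(a - d) * p + b * q' + c * q = 0" and trB: "(a' - d') * p + b' * q' + c' * q = 0"
      unfolding p_def q_def q'_def by algebra+
    obtain l where l: "l\<^sup>2 - (a + d) * l + 1 = 0" "a * p + b * q' = l * p" "a * q - b * p = l * q"
        "c * p + d * q' = l * q'" "c * q - d * p = - l * p"
      using eigen[OF trA dets(1)] by blast
    obtain m where m: "m\<^sup>2 - (a' + d') * m + 1 = 0" "a' * p + b' * q' = m * p" "a' * q - b' * p = m * q"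
        "c' * p + d' * q' = m * q'" "c' * q - d' * p = - m * p"
      using eigen[OF trB dets(2)] by blast
    have nz: "l \<noteq> 0" "m \<noteq> 0" using l(1) m(1) by auto
    have l1: "l\<^sup>2 \<noteq> 1"
    proof
      assume "l\<^sup>2 = 1"
      then have "(a + d) = 2 * l" using l(1) nz by (auto simp: power2_eq_1_iff)
      then have "mdisc A = l\<^sup>2 - 1" unfolding mdisc_def Ad using dets by simp
      then show False using \<open>l\<^sup>2 = 1\<close> k by simp
    qed
    \<comment> \<open>From A Z = l Z one gets Z A^{-1} = l Z by taking adjugates, since the adjugate
      of Z is -Z. Hence conjugation by \<open>A\<close> multiplies Z by l^2.\<close>
    have conj: "A * Mat2 (1 + t * p) (t * q) (t * q') (1 - t * p) * madj A =
      Mat2 (1 + (l\<^sup>2 * t) * p) ((l\<^sup>2 * t) * q) ((l\<^sup>2 * t) * q') (1 - (l\<^sup>2 * t) * p)" for t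
      unfolding Ad apply simp apply (intro conjI)
      using l dets by algebra+
    \<comment> \<open>Since AB = BA + Z, the commutator is 1 + Z A^{-1} B^{-1}, and both inverses
      act on Z as the scalars l and m.\<close>
    have P: "A * B * madj A * madj B = Mat2 (1 + (l * m) * p) ((l * m) * q) ((l * m) * q') (1 - (l * m) * p)"
    proof -
      obtain w x y z where W: "madj A * madj B = Mat2 w x y z" by (cases "madj A * madj B")
      then have w: "w = d * d' + b * c'" "x = - (d * b') - b * a'" "y = - (c * d') - a * c'" "z = c * b' + a * a'"
        unfolding Ad Bd by auto
      obtain e f g h where BA: "B * A = Mat2 e f g h" by (cases "B * A")
      have AB: "A * B = Mat2 (e + p) (f + q) (g + q') (h - p)"
        using BA unfolding Ad Bd p_def q_def q'_def by (auto simp: algebra_simps)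
      have "B * A * (madj A * madj B) = B * (A * madj A) * madj B" by (simp only: mult.assoc)
      then have "B * A * (madj A * madj B) = 1" using madj_right det A B by simp
      then have 1: "e * w + f * y = 1" "e * x + f * z = 0" "g * w + h * y = 0" "g * x + h * z = 1"
        unfolding BA W by (auto simp: one_mat2_def)
      have 2: "p * w + q * y = l * m * p" unfolding w using l m by algebra
      have 3: "p * x + q * z = l * m * q" unfolding w using l m by algebra
      have 4: "q' * w - p * y = l * m * q'" unfolding w using l m by algebra
      have 5: "q' * x - p * z = - l * m * p" unfolding w using l m by algebra
      have "A * B * madj A * madj B = A * B * (madj A * madj B)" by (simp only: mult.assoc)
      also have "\<dots> = Mat2 (1 + (l * m) * p) ((l * m) * q) ((l * m) * q') (1 - (l * m) * p)"
        unfolding AB W using 1 2 3 4 5 by (simp add: algebra_simps)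
      finally show ?thesis .
    qed
    have PS: "A * B * madj A * madj B \<in> S" using A B by (intro mult inv)
    show False
    proof (cases "l\<^sup>2 < 1")
      case True
      have "(l * m) * p = 0 \<and> (l * m) * q = 0 \<and> (l * m) * q' = 0"
      proof (rule contracting_conjugation[OF A _ True])
        show "Mat2 (1 + (l * m) * p) ((l * m) * q) ((l * m) * q') (1 - (l * m) * p) \<in> S"
          using PS unfolding P .
        show "A * Mat2 (1 + t * (l * m * p)) (t * (l * m * q)) (t * (l * m * q')) (1 - t * (l * m * p)) * madj A =
         Mat2 (1 + l\<^sup>2 * t * (l * m * p)) (l\<^sup>2 * t * (l * m * q)) (l\<^sup>2 * t * (l * m * q'))
          (1 - l\<^sup>2 * t * (l * m * p))" for t
          using conj[of "t * (l * m)"] by (simp only: mult.assoc)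
      qed (use nz in auto)
      then show False using nz Z0 by auto
    next
      case False
      then have l2: "1 < l\<^sup>2" using l1 by linarith
      have "(l * m) * p = 0 \<and> (l * m) * q = 0 \<and> (l * m) * q' = 0"
      proof (rule contracting_conjugation[OF inv[OF A], of "1 / l\<^sup>2"])
        show "Mat2 (1 + (l * m) * p) ((l * m) * q) ((l * m) * q') (1 - (l * m) * p) \<in> S"
          using PS unfolding P .
        fix t
        let ?U = "\<lambda>t. Mat2 (1 + t * p) (t * q) (t * q') (1 - t * p)"
        have "madj A * ?U t * madj (madj A) = ?U (1 / l\<^sup>2 * t)" for t
        proof -
          have "madj A * ?U t * madj (madj A) = madj A * (A * ?U (1 / l\<^sup>2 * t) * madj A) * A"
            using conj[of "1 / l\<^sup>2 * t"] nz by simp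
          also have "\<dots> = (madj A * A) * ?U (1 / l\<^sup>2 * t) * (madj A * A)"
            by (simp only: mult.assoc)
          finally show ?thesis using madj_left[OF det[OF A]] by (simp only: mult_1_left mult_1_right)
        qed
        from this[of "t * (l * m)"]
        show "madj A * Mat2 (1 + t * (l * m * p)) (t * (l * m * q)) (t * (l * m * q')) (1 - t * (l * m * p)) * madj (madj A) =
         Mat2 (1 + 1 / l\<^sup>2 * t * (l * m * p)) (1 / l\<^sup>2 * t * (l * m * q)) (1 / l\<^sup>2 * t * (l * m * q'))
          (1 - 1 / l\<^sup>2 * t * (l * m * p))"
          by (simp only: mult.assoc)
      qed (use l2 nz in \<open>auto simp: divide_less_eq\<close>)
      then show False using nz Z0 by auto
    qed
  qed
  show ?thesis
  proof (cases "0 < mdisc A \<or> 0 < mdisc B")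
    case True
    then show ?thesis using main[OF A B J] main[OF B A] J mgram_commute by metis
  next
    case False
    then have k: "mdisc A = 0" "mdisc B = 0" using mdisc_nonneg A B by (meson order.antisym not_less)+
    show ?thesis
    proof (cases A; cases B)
      fix a b c d a' b' c' d' assume Ad: "A = Mat2 a b c d" and Bd: "B = Mat2 a' b' c' d'"
      define x x' where "x = (a - d) / 2" and "x' = (a' - d') / 2"
      have ad: "a - d = 2 * x" "a' - d' = 2 * x'" unfolding x_def x'_def by auto
      have 1: "x\<^sup>2 + b * c = 0" "x'\<^sup>2 + b' * c' = 0"
        using k unfolding Ad Bd mdisc_def x_def x'_def by (auto simp: power2_eq_square field_simps)
      have "mtr (A * B) / 2 - mtr A * mtr B / 4 = 0" using J k unfolding mgram_def by simp
      then have 2: "2 * x * x' + b * c' + c * b' = 0"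
        unfolding Ad Bd x_def x'_def by (auto simp: field_simps)
      \<comment> \<open>The traceless parts are null and mutually orthogonal for a form of signature
        (2,1), hence parallel; the three squares are their 2x2 minors.\<close>
      have "(b * c' - b' * c)\<^sup>2 = 0" "(x * b' - x' * b)\<^sup>2 = 0" "(x * c' - x' * c)\<^sup>2 = 0"
        using 1 2 by algebra+
      then have "b * c' = b' * c" "x * b' = x' * b" "x * c' = x' * c" by auto
      then show "A * B = B * A"
        unfolding Ad Bd using ad by simp algebra
    qed
  qed
qed

text \<open>A sharp form of the Margulis lemma. The sign of the Gram determinant decides how the axes of
  \<open>A\<close> and \<open>B\<close> lie: if they cross, the commutator has trace at most \<open>-2\<close>; if \<open>A\<close> moves its axis
  to a disjoint one, the traces of \<open>A ^ n * B\<close> change sign without entering \<open>{-2<..<2}\<close>; and if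
  \<open>B\<close> moves the axis of \<open>A\<close> to a crossing one, the first case applies to \<open>A\<close> and its conjugate.\<close>

theorem mdisp_mult_ge_1:
  assumes "A \<in> S" "B \<in> S" "A * B \<noteq> B * A"
  shows "1 \<le> mdisp A * mdisp B"
proof -
  have big: "1 \<le> mdisp A * mdisp B" if S: "A \<in> S" "B \<in> S" and J: "mgram A B \<le> -1 \<or> 4 \<le> mgram A B" for A B
    using J
  proof
    assume "mgram A B \<le> -1"
    moreover have "- (mdisc A * mdisc B) \<le> mgram A B" unfolding mgram_def by simp
    moreover have "mdisc A * mdisc B \<le> mdisp A * mdisp B"
      using mdisc_nonneg S mdisc_le_mdisp by (intro mult_mono) (auto intro: order.trans)
    ultimately show ?thesis by linarith
  next
    assume "4 \<le> mgram A B"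
    then show ?thesis using mgram_le[of A B] mdisc_nonneg S by auto
  qed
  have main: "1 \<le> mdisp A * mdisp B" if S: "A \<in> S" "B \<in> S" and nc: "A * B \<noteq> B * A"
    and le: "mdisp A \<le> mdisp B" and tr: "2 \<le> mtr A" "2 \<le> mtr B" for A B
  proof (rule ccontr)
    assume not: "\<not> 1 \<le> mdisp A * mdisp B"
    define k J where "k = mdisc A" and "J = mgram A B"
    have k0: "0 \<le> k" using mdisc_nonneg S unfolding k_def by auto
    have d0: "0 \<le> mdisp A" using k0 mdisc_le_mdisp[of A] unfolding k_def by linarith
    have d1: "mdisp A < 1"
    proof (rule ccontr)
      assume "\<not> mdisp A < 1"
      then have "1 * 1 \<le> mdisp A * mdisp B" using le by (intro mult_mono) auto
      then show False using not by simp
    qed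
    then have k1: "k < 1" using mdisc_le_mdisp[of A] unfolding k_def by linarith
    have J0: "J \<noteq> 0" using mgram_eq_0_imp_commute S nc unfolding J_def by auto
    have Jpos: "0 < J" using mgram_neg_le[OF S] big[OF S] J0 not unfolding J_def by linarith
    \<comment> \<open>Geometrically: \<open>B\<close> moves the axis of \<open>A\<close> (when
      \<open>A\<close> is hyperbolic) to one disjoint from it.\<close>
    have "k < J"
    proof (rule ccontr)
      assume "\<not> k < J"
      then have Jk: "J \<le> k" by simp
      let ?C = "B * A * madj B"
      have C: "?C \<in> S" using S by (intro mult inv)
      have g: "mgram A ?C = - 4 * J * (k - J)" unfolding J_def k_def using mgram_conj det S by auto
      show False
      proof (cases "J = k")
        case False
        then have "0 < J * (k - J)" using Jpos Jk by simp
        then have "mgram A ?C \<le> - 1" using g by (intro mgram_neg_le S C) auto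
        \<comment> \<open>The maximum of J (k - J) is k^2/4, so the Gram determinant with the
          conjugate stays above -1 because k < 1. This contradicts the gap for negative
          values.\<close>
        moreover have "4 * (J * (k - J)) \<le> k\<^sup>2"
          using zero_le_power2[of "k - 2 * J"] by (simp add: power2_eq_square algebra_simps)
        moreover have "k\<^sup>2 < 1" using k0 k1 by (simp add: power_less_one_iff)
        ultimately show False using g by (simp add: mult.assoc)
      next
        case True
        \<comment> \<open>Borderline case: the conjugate commutes with \<open>A\<close>, and the
          traces will identify it with the inverse of \<open>A\<close>. So \<open>B\<close> reverses
          the axis of \<open>A\<close>, which forces trace 0.\<close>
        then have "mgram A ?C = 0" using g by simp
        then have comm: "A * ?C = ?C * A" using S C by (intro mgram_eq_0_imp_commute)
        show False
        proof (cases A; cases B; cases ?C)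
          fix a b c d a' b' c' d' x y z w
          assume Ad: "A = Mat2 a b c d" and Bd: "B = Mat2 a' b' c' d'" and Cd: "?C = Mat2 x y z w"
          have CB: "?C * B = B * A" using madj_left[OF det[OF S(2)]] by (simp add: mult.assoc)
          have "mtr ?C = mtr (madj B * (B * A))" by (simp add: mtr_mult_commute)
          then have trC: "x + w = a + d"
            using madj_left[OF det[OF S(2)]] Ad Cd by (simp add: mult.assoc[symmetric])
          have dt: "a * d - b * c = 1" "x * w - y * z = 1"
            using det[OF S(1)] det[OF C, unfolded Cd] unfolding Ad by auto
          have kk: "((a - d) / 2)\<^sup>2 + b * c = k"
            unfolding k_def mdisc_def Ad by (simp add: power2_eq_square field_simps)
          have AC: "mtr (A * ?C) = 2 * (mtr A / 2)\<^sup>2 + 2 * (k - 2 * J)"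
            using mtr_mult_conj[OF det[OF S(2)], of A] unfolding k_def J_def mdisc_def
            by (simp add: power2_eq_square)
          have k': "((x - w) / 2)\<^sup>2 + y * z = k"
            using kk trC dt by (simp add: power2_eq_square field_simps) algebra
          \<comment> \<open>The sum of the traceless parts of \<open>A\<close> and
            \<open>?C\<close>. It is parallel to the traceless part of \<open>A\<close> and also
            null; as that part has norm k > 0, the sum vanishes and \<open>?C\<close> is
            \<open>madj A\<close>.\<close>
          define u v t where "u = (a - d + (x - w)) / 2" and "v = b + y" and "t = c + z"
          have par: "u * b = v * ((a - d) / 2)" "u * c = t * ((a - d) / 2)" "v * c = t * b"
          proof -
            have 1: "b * z = y * c" "a * y + b * w = x * b + y * d" "c * x + d * z = z * a + w * c"
              using comm[unfolded Cd, unfolded Ad] by simp_all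
            show "v * c = t * b" unfolding v_def t_def using 1(1) by algebra
            have "(a - d + (x - w)) * b = (b + y) * (a - d)" "(a - d + (x - w)) * c = (c + z) * (a - d)"
              using 1(2,3) by algebra+
            moreover have "a - d + (x - w) = 2 * u" unfolding u_def by simp
            ultimately show "u * b = v * ((a - d) / 2)" "u * c = t * ((a - d) / 2)"
              unfolding v_def t_def by simp_all
          qed
          have nul: "u\<^sup>2 + v * t = 0"
          proof -
            have e1: "(a - d)\<^sup>2 + 4 * (b * c) = 4 * k" "(x - w)\<^sup>2 + 4 * (y * z) = 4 * k"
              using kk k' by (simp_all add: power_divide)
            have e2: "2 * (a * x + b * z + (c * y + d * w)) = (a + d)\<^sup>2 - 4 * k"
              using AC[unfolded Cd, unfolded Ad] True by (simp add: power_divide)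
            have "(a - d + (x - w))\<^sup>2 + 4 * ((b + y) * (c + z)) = 0"
              using e1 e2 trC by algebra
            moreover have "a - d + (x - w) = 2 * u" unfolding u_def by simp
            ultimately show ?thesis unfolding v_def t_def by (simp add: power_mult_distrib)
          qed
          define h where "h = (a - d) / 2"
          have "u\<^sup>2 * k = 0" "v\<^sup>2 * k = 0" "t\<^sup>2 * k = 0"
            using par nul kk unfolding h_def[symmetric] by algebra+
          then have "u = 0" "v = 0" "t = 0" using Jpos True by auto
          then have "x = d" "y = - b" "z = - c" "w = a"
            using trC unfolding u_def v_def t_def by (auto simp: field_simps)
          then have "b * (a' + d') = 0" "c * (a' + d') = 0" "(a - d) * (a' + d') = 0"
            using CB[unfolded Cd, unfolded Ad Bd] by (auto simp: algebra_simps)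
          moreover have "a' + d' \<noteq> 0" using tr(2) unfolding Bd by simp
          ultimately show False using kk Jpos True by auto
        qed
      qed
    qed
    define \<alpha> where "\<alpha> = mtr A / 2"
    have kal: "k = \<alpha>\<^sup>2 - 1" unfolding k_def mdisc_def \<alpha>_def using det S by (simp add: power2_eq_square)
    have al: "1 \<le> \<alpha>" unfolding \<alpha>_def using tr by simp
    \<comment> \<open>J - k is the invariant of the sequence of half traces of A^n B, as required by
      \<open>sign_change_recurrence\<close>.\<close>
    have Q: "(mtr B / 2)\<^sup>2 + (mtr (A * B) / 2)\<^sup>2 - 2 * \<alpha> * (mtr B / 2) * (mtr (A * B) / 2) = J - k"
      unfolding J_def mgram_def k_def mdisc_def \<alpha>_def using det S by (simp add: power2_eq_square field_simps)
    have bound: "2 + 2 * \<alpha> \<le> J - k" if A': "A' \<in> S" "mtr A' = mtr A" "mgram A' B = J"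
      and less: "mtr (A' * B) < mtr B" for A'
    proof (rule sign_change_recurrence[of "\<lambda>n. mtr (A' ^ n * B) / 2"])
      show "(mtr (A' ^ 0 * B) / 2)\<^sup>2 + (mtr (A' ^ 1 * B) / 2)\<^sup>2 - 2 * \<alpha> * (mtr (A' ^ 0 * B) / 2) * (mtr (A' ^ 1 * B) / 2) = J - k"
        unfolding A'(3)[symmetric] mgram_def k_def mdisc_def \<alpha>_def A'(2)
        using det S A' by (simp add: power2_eq_square field_simps)
      show "mtr (A' ^ Suc (Suc n) * B) / 2 = 2 * \<alpha> * (mtr (A' ^ Suc n * B) / 2) - mtr (A' ^ n * B) / 2" for n
        using mtr_recurrence[of A' "A' ^ n * B"] A' det
        by (simp add: mult.assoc \<alpha>_def field_simps)
      show "1 \<le> \<bar>mtr (A' ^ n * B) / 2\<bar>" for n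
        using trace[OF mult[OF power_mem[OF A'(1), of n] S(2)]] by simp
    qed (use \<open>k < J\<close> al tr less in auto)
    have "2 + 2 * \<alpha> \<le> J - k"
    proof (cases "mtr (A * B) < mtr B")
      case True
      then show ?thesis using bound[of A] S J_def by simp
    next
      case False
      then have ge: "mtr B / 2 \<le> mtr (A * B) / 2" by simp
      have eq: "mtr (madj A * B) / 2 = 2 * \<alpha> * (mtr B / 2) - mtr (A * B) / 2"
        unfolding mtr_madj_mult \<alpha>_def by simp
      \<comment> \<open>The product of the two neighbours of the term \<open>mtr B / 2\<close> is
        smaller than its square, so the sequence decreases in at least one direction;
        \<open>A\<close> may be replaced by its inverse.\<close>
      have "(mtr B / 2)\<^sup>2 - (mtr (madj A * B) / 2) * (mtr (A * B) / 2) = J - k"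
        unfolding eq Q[symmetric] by (simp add: power2_eq_square algebra_simps)
      then have lt: "(mtr (madj A * B) / 2) * (mtr (A * B) / 2) < (mtr B / 2) * (mtr B / 2)"
        using \<open>k < J\<close> by (simp add: power2_eq_square)
      have "mtr (madj A * B) < mtr B"
      proof (rule ccontr)
        assume "\<not> mtr (madj A * B) < mtr B"
        then have "(mtr B / 2) * (mtr B / 2) \<le> (mtr (madj A * B) / 2) * (mtr (A * B) / 2)"
          using ge tr by (intro mult_mono) auto
        then show False using lt by linarith
      qed
      then show ?thesis using bound[of "madj A"] S J_def inv mgram_madj_left by simp
    qed
    \<comment> \<open>Since k = \<alpha>^2 - 1, the bound J \<ge> k + 2 + 2 \<alpha> is a perfect
      square, at least 4: exactly the threshold needed in \<open>big\<close>.\<close>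
    then have "(\<alpha> + 1)\<^sup>2 \<le> J" using kal by (simp add: power2_eq_square algebra_simps)
    moreover have "2\<^sup>2 \<le> (\<alpha> + 1)\<^sup>2" using al by (intro power_mono) auto
    ultimately show False using big[OF S] not unfolding J_def by auto
  qed
  have sym: "1 \<le> mdisp A * mdisp B" if S: "A \<in> S" "B \<in> S" and nc: "A * B \<noteq> B * A"
    and tr: "2 \<le> mtr A" "2 \<le> mtr B" for A B
    using main[of A B] main[of B A] that by (metis linear mult.commute)
  let ?n = "\<lambda>A. if 0 \<le> mtr A then A else - A"
  have n: "?n A \<in> S" "2 \<le> mtr (?n A)" "mdisp (?n A) = mdisp A" if "A \<in> S" for A
    using that neg trace[OF that] by auto
  have "?n A * ?n B \<noteq> ?n B * ?n A"
    using assms(3) by (auto simp: mult_uminus_left mult_uminus_right uminus_mat2_inject)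
  then show ?thesis using sym[of "?n A" "?n B"] n assms by metis
qed

section \<open>Counting commuting elements of bounded displacement\<close>

lemma finite_card_bounded_ints:
  fixes F :: "'b \<Rightarrow> int"
  assumes "inj_on F X" "\<And>x. x \<in> X \<Longrightarrow> \<bar>F x\<bar> \<le> N" "0 \<le> N"
  shows "finite X \<and> real (card X) \<le> 1 + 2 * real_of_int N"
proof -
  have sub: "F ` X \<subseteq> {- N..N}" using assms(2) by (auto simp: abs_le_iff) (metis minus_le_iff)
  then have fin: "finite X" using assms(1) finite_subset finite_imageD by blast
  have "card X \<le> card {- N..N}" using assms(1) sub by (intro card_inj_on_le) auto
  then have "real (card X) \<le> real (card {- N..N})" by simp
  also have "\<dots> = 1 + 2 * real_of_int N" using assms(3) by simp
  finally show ?thesis using fin by simp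
qed

text \<open>Commuting matrices are \<open>\<alpha> + \<sigma> X\<close> for a common \<open>X\<close>, with \<open>\<bar>\<sigma>\<bar>\<close> determined by the
  displacement; the numbers \<open>\<sigma>\<close> of the same sign are \<open>\<rho>\<close>-separated.\<close>

lemma card_commuting_le:
  assumes X: "X \<subseteq> S" "\<And>A. A \<in> X \<Longrightarrow> 2 \<le> mtr A" "\<And>A B. A \<in> X \<Longrightarrow> B \<in> X \<Longrightarrow> A * B = B * A"
    and \<rho>: "0 < \<rho>" "\<And>A. A \<in> S \<Longrightarrow> A \<noteq> 1 \<Longrightarrow> A \<noteq> - 1 \<Longrightarrow> \<rho>\<^sup>2 \<le> mdisp A"
    and R: "0 \<le> R" "\<And>A. A \<in> X \<Longrightarrow> mdisp A \<le> R\<^sup>2"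
  shows "finite X \<and> real (card X) \<le> 1 + 2 * (R / \<rho>)"
proof (cases "X \<subseteq> {1}")
  case True
  then have "finite X" "card X \<le> 1"
    using finite_subset card_mono[of "{1}" X] by auto
  then show ?thesis using R(1) \<rho>(1) by (simp add: add_increasing2)
next
  case False
  then obtain A0 where A0: "A0 \<in> X" "A0 \<noteq> 1" by auto
  have m1: "A \<noteq> - 1" if "A \<in> X" for A using X(2)[OF that] by auto
  obtain a0 b0 c0 d0 where A0d: "A0 = Mat2 a0 b0 c0 d0" by (cases A0)
  define n0 where "n0 = sqrt (mdisp A0)"
  have "0 < \<rho>\<^sup>2" using \<rho>(1) by simp
  also have "\<dots> \<le> mdisp A0" using A0 X(1) m1 \<rho>(2) by auto
  finally have n0: "0 < n0" "n0\<^sup>2 = mdisp A0" unfolding n0_def by auto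
  \<comment> \<open>The common X is the traceless part of \<open>A0\<close>, scaled so that the
    coefficient \<sigma> has square equal to the displacement. Then \<kappa> = -det X, nonnegative
    because there are no rotations.\<close>
  define x y z where "x = (a0 - d0) / 2 / n0" and "y = b0 / n0" and "z = c0 / n0"
  define \<kappa> where "\<kappa> = x\<^sup>2 + y * z"
  have xyz: "a0 - d0 = 2 * x * n0" "b0 = y * n0" "c0 = z * n0" unfolding x_def y_def z_def using n0 by auto
  have unit: "x\<^sup>2 + ((y + z) / 2)\<^sup>2 = 1"
  proof -
    have "mdisp A0 = n0\<^sup>2 * (x\<^sup>2 + ((y + z) / 2)\<^sup>2)"
      unfolding A0d mdisp.simps xyz by (simp add: power2_eq_square field_simps)
    then have "n0\<^sup>2 * (x\<^sup>2 + ((y + z) / 2)\<^sup>2) = n0\<^sup>2 * 1" using n0(2) by simp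
    then show ?thesis using n0(1) by simp
  qed
  have \<kappa>: "0 \<le> \<kappa>"
  proof -
    have "n0\<^sup>2 * \<kappa> = mdisc A0" 
      using det[of A0] A0 X(1) unfolding \<kappa>_def mdisc_def A0d x_def y_def z_def using n0(1)
      by (simp add: power2_eq_square field_simps subset_iff)
    moreover have "0 \<le> mdisc A0" using mdisc_nonneg A0 X(1) by auto
    ultimately have "0 \<le> n0\<^sup>2 * \<kappa>" by (simp only:)
    moreover have "0 < n0\<^sup>2" using n0(1) by simp
    ultimately show ?thesis by (simp only: zero_le_mult_iff) linarith
  qed
  have "\<exists>\<alpha> \<sigma>. A = Mat2 (\<alpha> + \<sigma> * x) (\<sigma> * y) (\<sigma> * z) (\<alpha> - \<sigma> * x)" if A: "A \<in> X" for A
  proof (cases A)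
    case (Mat2 a b c d)
    have par: "b * z = c * y" "(a - d) * y = 2 * x * b" "(a - d) * z = 2 * x * c"
    proof -
      have 1: "b * c0 = b0 * c" "a * b0 + b * d0 = a0 * b + b0 * d" "c * a0 + d * c0 = c0 * a + d0 * c"
        using X(3)[OF A A0(1), unfolded Mat2 A0d] by simp_all
      show "b * z = c * y" unfolding y_def z_def using 1(1) by (simp add: mult.commute)
      have "(a - d) * b0 = (a0 - d0) * b" "(a - d) * c0 = (a0 - d0) * c" using 1(2,3) by algebra+
      then have "n0 * ((a - d) * y) = n0 * (2 * x * b)" "n0 * ((a - d) * z) = n0 * (2 * x * c)"
        using xyz by algebra+
      then show "(a - d) * y = 2 * x * b" "(a - d) * z = 2 * x * c" using n0(1) by simp_all
    qed
    define \<tau> where "\<tau> = 2 * (a - d) * x + (b + c) * (y + z)"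
    define \<sigma> where "\<sigma> = \<tau> / 4"
    have unit4: "4 * x\<^sup>2 + (y + z)\<^sup>2 = 4" using unit by (simp add: power_divide)
    have "\<tau> * y = 4 * b" "\<tau> * z = 4 * c" "\<tau> * (2 * x) = 4 * (a - d)"
      using par unit4 unfolding \<tau>_def by algebra+
    then have "\<sigma> * y = b" "\<sigma> * z = c" "\<sigma> * x = (a - d) / 2"
      unfolding \<sigma>_def by (simp_all add: field_simps)
    then have "A = Mat2 ((a + d) / 2 + \<sigma> * x) (\<sigma> * y) (\<sigma> * z) ((a + d) / 2 - \<sigma> * x)"
      unfolding Mat2 by (simp add: field_simps)
    then show ?thesis by blast
  qed
  then obtain \<alpha> \<sigma> where rep: "\<And>A. A \<in> X \<Longrightarrow> A = Mat2 (\<alpha> A + \<sigma> A * x) (\<sigma> A * y) (\<sigma> A * z) (\<alpha> A - \<sigma> A * x)"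
    by metis
  have al1: "1 \<le> \<alpha> A" if "A \<in> X" for A using X(2)[OF that] by (subst (asm) rep[OF that]) simp
  have al2: "(\<alpha> A)\<^sup>2 = 1 + \<kappa> * (\<sigma> A)\<^sup>2" if "A \<in> X" for A
  proof -
    have "mdet A = 1" using that X(1) det by auto
    then show ?thesis unfolding \<kappa>_def by (subst (asm) rep[OF that]) (simp add: power2_eq_square algebra_simps)
  qed
  have disp: "mdisp (Mat2 (u + s * x) (s * y) (s * z) (u - s * x)) = s\<^sup>2" for s u
  proof -
    have "mdisp (Mat2 (u + s * x) (s * y) (s * z) (u - s * x)) = s\<^sup>2 * (x\<^sup>2 + ((y + z) / 2)\<^sup>2)"
      by (simp add: power2_eq_square field_simps)
    then show ?thesis using unit by simp
  qed
  have sig: "mdisp A = (\<sigma> A)\<^sup>2" if "A \<in> X" for A by (subst rep[OF that]) (rule disp)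
  have eqI: "A = B" if AB: "A \<in> X" "B \<in> X" "\<sigma> A = \<sigma> B" for A B
  proof -
    have "(\<alpha> A)\<^sup>2 = (\<alpha> B)\<^sup>2" using al2 AB by simp
    then have "\<alpha> A = \<alpha> B" using al1 AB by (smt (verit) power2_eq_iff)
    then show ?thesis using rep AB by metis
  qed
  \<comment> \<open>The quotient \<open>madj A * B\<close> has the same shape, and its coefficient
    follows the subtraction formula for sinh, so the displacement bound for a nontrivial element
    applies to it.\<close>
  have sep: "\<rho> \<le> \<bar>\<alpha> A * \<sigma> B - \<alpha> B * \<sigma> A\<bar>" if AB: "A \<in> X" "B \<in> X" "A \<noteq> B" for A B
  proof -
    have "madj A * B = Mat2 ((\<alpha> A * \<alpha> B - \<kappa> * \<sigma> A * \<sigma> B) + (\<alpha> A * \<sigma> B - \<alpha> B * \<sigma> A) * x) ((\<alpha> A * \<sigma> B - \<alpha> B * \<sigma> A) * y)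
       ((\<alpha> A * \<sigma> B - \<alpha> B * \<sigma> A) * z) ((\<alpha> A * \<alpha> B - \<kappa> * \<sigma> A * \<sigma> B) - (\<alpha> A * \<sigma> B - \<alpha> B * \<sigma> A) * x)"
      unfolding \<kappa>_def by (subst rep[OF AB(1)], subst rep[OF AB(2)]) (simp add: power2_eq_square algebra_simps)
    then have d: "mdisp (madj A * B) = (\<alpha> A * \<sigma> B - \<alpha> B * \<sigma> A)\<^sup>2" by (simp only: disp)
    have S: "A \<in> S" "B \<in> S" using AB X(1) by auto
    have B: "B = A * (madj A * B)" using madj_right[OF det[OF S(1)]] by (simp add: mult.assoc[symmetric])
    have "madj A * B \<noteq> 1" using B AB(3) by (metis mult_1_right)
    moreover have "madj A * B \<noteq> - 1"
    proof
      assume "madj A * B = - 1"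
      then have "B = - A" using B by (metis mult_uminus_right mult_1_right)
      then show False using X(2)[OF AB(1)] X(2)[OF AB(2)] by simp
    qed
    ultimately have "\<rho>\<^sup>2 \<le> mdisp (madj A * B)" using S by (intro \<rho>(2) mult inv)
    then show ?thesis unfolding d using \<rho>(1) abs_le_square_iff[of \<rho>] by simp
  qed
  have gap: "\<rho> \<le> \<bar>\<sigma> B - \<sigma> A\<bar>" if AB: "A \<in> X" "B \<in> X" "A \<noteq> B" "0 \<le> \<sigma> A * \<sigma> B" for A B
  proof -
    have le: "\<bar>\<alpha> A * \<sigma> B - \<alpha> B * \<sigma> A\<bar> \<le> \<bar>\<sigma> B - \<sigma> A\<bar>"
      using separation_aux[of "\<alpha> A" "\<alpha> B" \<kappa> "\<sigma> A" "\<sigma> B"] al1 al2 AB \<kappa> by auto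
    show ?thesis using sep[OF AB(1-3)] le by linarith
  qed
  have big: "\<rho> \<le> \<bar>\<sigma> A\<bar>" if "A \<in> X" "A \<noteq> 1" for A
    using \<rho>(2)[of A] X(1) that m1 sig[of A] abs_le_square_iff[of \<rho> "\<sigma> A"] \<rho>(1) by auto
  \<comment> \<open>Rounding towards zero: the bucket 0 can contain only the identity, because every
    other coefficient has absolute value at least \<rho>. Hence both signs share one middle value
    and the count is 1 + 2N.\<close>
  define F where "F A = (if 0 \<le> \<sigma> A then \<lfloor>\<sigma> A / \<rho>\<rfloor> else - \<lfloor>- \<sigma> A / \<rho>\<rfloor>)" for A
  have floor_pos: "1 \<le> \<lfloor>- \<sigma> A / \<rho>\<rfloor>" if "A \<in> X" "\<sigma> A < 0" for A
  proof -
    have "A \<noteq> 1" using sig[OF that(1)] that(2) by auto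
    then have "\<rho> \<le> - \<sigma> A" using big[OF that(1)] that(2) by auto
    then have "1 \<le> - \<sigma> A / \<rho>" using \<rho>(1) by (simp only: pos_le_divide_eq mult_1_left)
    then show ?thesis by (simp only: one_le_floor)
  qed
  have floor_close: "\<bar>u - v\<bar> < \<rho>" if "\<lfloor>u / \<rho>\<rfloor> = \<lfloor>v / \<rho>\<rfloor>" for u v :: real
  proof -
    have "\<bar>u / \<rho> - v / \<rho>\<bar> < 1" using that by linarith
    then show ?thesis using \<rho>(1) by (simp add: diff_divide_distrib[symmetric] abs_divide)
  qed
  have "inj_on F X"
  proof (rule inj_onI, rule ccontr)
    fix A B assume AB: "A \<in> X" "B \<in> X" "F A = F B" "A \<noteq> B"
    have sgnF: "F A < 0 \<longleftrightarrow> \<sigma> A < 0" if "A \<in> X" for A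
    proof (cases "0 \<le> \<sigma> A")
      case True
      then have "0 \<le> \<lfloor>\<sigma> A / \<rho>\<rfloor>" using \<rho>(1) by simp
      then show ?thesis using True unfolding F_def by simp
    next
      case False
      then have "1 \<le> \<lfloor>- \<sigma> A / \<rho>\<rfloor>" using floor_pos[OF that] by simp
      moreover have "F A = - \<lfloor>- \<sigma> A / \<rho>\<rfloor>" using False unfolding F_def by (simp only: if_False)
      ultimately show ?thesis using False by linarith
    qed
    have "\<sigma> A < 0 \<longleftrightarrow> \<sigma> B < 0" using sgnF[OF AB(1)] sgnF[OF AB(2)] AB(3) by simp
    then consider "0 \<le> \<sigma> A" "0 \<le> \<sigma> B" | "\<sigma> A < 0" "\<sigma> B < 0" by linarith
    then show False
    proof cases
      case 1
      then show False using gap[OF AB(1,2,4)] floor_close[of "\<sigma> B" "\<sigma> A"] AB(3) unfolding F_def by simp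
    next
      case 2
      then show False using gap[OF AB(1,2,4)] floor_close[of "- \<sigma> B" "- \<sigma> A"] AB(3) unfolding F_def
        by (simp add: mult_nonpos_nonpos)
    qed
  qed
  moreover have "\<bar>F A\<bar> \<le> \<lfloor>R / \<rho>\<rfloor>" if "A \<in> X" for A
  proof -
    have "\<bar>\<sigma> A\<bar> \<le> R" using R(2)[OF that] sig[OF that] R(1) abs_le_square_iff[of "\<sigma> A" R] by simp
    then have 1: "\<bar>\<sigma> A\<bar> / \<rho> \<le> R / \<rho>" using \<rho>(1) by (simp add: divide_right_mono)
    show ?thesis
    proof (cases "0 \<le> \<sigma> A")
      case True
      then have "\<bar>F A\<bar> = \<lfloor>\<bar>\<sigma> A\<bar> / \<rho>\<rfloor>" using \<rho>(1) unfolding F_def by simp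
      then show ?thesis using floor_mono[OF 1] by simp
    next
      case False
      then have "\<bar>F A\<bar> = \<lfloor>\<bar>\<sigma> A\<bar> / \<rho>\<rfloor>" using floor_pos[OF that] unfolding F_def by simp
      then show ?thesis using floor_mono[OF 1] by simp
    qed
  qed
  moreover have "0 \<le> \<lfloor>R / \<rho>\<rfloor>" using R(1) \<rho>(1) by simp
  ultimately have "finite X \<and> real (card X) \<le> 1 + 2 * real_of_int \<lfloor>R / \<rho>\<rfloor>"
    by (rule finite_card_bounded_ints)
  moreover have "real_of_int \<lfloor>R / \<rho>\<rfloor> \<le> R / \<rho>" by simp
  ultimately show ?thesis by linarith
qed

end

section \<open>The hyperbolic plane\<close>

fun moebius :: "mat2 \<Rightarrow> complex \<Rightarrow> complex" where
  "moebius (Mat2 a b c d) z = (of_real a * z + of_real b) / (of_real c * z + of_real d)"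

fun mden :: "mat2 \<Rightarrow> complex \<Rightarrow> complex" where
  "mden (Mat2 a b c d) z = of_real c * z + of_real d"

lemma PSL2R_maps_eq: "PSL2R_maps = moebius ` {A. mdet A = 1}"
proof (intro equalityI subsetI)
  fix g assume "g \<in> PSL2R_maps"
  then obtain a b c d where "g = (\<lambda>z. (of_real a * z + of_real b) / (of_real c * z + of_real d))" "a * d - b * c = 1"
    unfolding PSL2R_maps_def by blast
  then show "g \<in> moebius ` {A. mdet A = 1}" by (intro image_eqI[of _ _ "Mat2 a b c d"]) (auto simp: fun_eq_iff)
next
  fix g assume "g \<in> moebius ` {A. mdet A = 1}"
  then obtain A where "mdet A = 1" "g = moebius A" by auto
  then show "g \<in> PSL2R_maps" unfolding PSL2R_maps_def
    by (cases A) (auto simp: fun_eq_iff)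
qed

lemma open_upper_half_plane: "open upper_half_plane"
  unfolding upper_half_plane_def by (rule open_halfspace_Im_gt)

lemma convex_upper_half_plane: "convex upper_half_plane"
  unfolding upper_half_plane_def by (rule convex_halfspace_Im_gt)

lemma mden_nonzero:
  assumes "mdet A = 1" "0 < Im z"
  shows "mden A z \<noteq> 0"
proof (cases A)
  case (Mat2 a b c d)
  show ?thesis
  proof
    assume "mden A z = 0"
    then have "c * Im z = 0" "c * Re z + d = 0" unfolding Mat2 by (auto simp: complex_eq_iff)
    then show False using assms unfolding Mat2 by auto
  qed
qed

lemma Im_moebius:
  assumes "mdet A = 1"
  shows "Im (moebius A z) = Im z / (cmod (mden A z))\<^sup>2"
proof (cases A)
  case (Mat2 a b c d)
  have "(a * Im z) * (c * Re z + d) - (a * Re z + b) * (c * Im z) = Im z * mdet A"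
    unfolding Mat2 by (simp add: algebra_simps)
  then have 1: "(a * Im z) * (c * Re z + d) - (a * Re z + b) * (c * Im z) = Im z" using assms by simp
  have "(cmod (mden A z))\<^sup>2 = (c * Re z + d)\<^sup>2 + (c * Im z)\<^sup>2"
    unfolding Mat2 cmod_power2 by simp
  then show ?thesis unfolding Mat2 moebius.simps using 1 by (simp add: Im_divide)
qed

lemma Im_moebius_pos:
  assumes "mdet A = 1" "0 < Im z"
  shows "0 < Im (moebius A z)"
  unfolding Im_moebius[OF assms(1)] using mden_nonzero[OF assms] assms(2) by simp

lemma moebius_diff:
  assumes "mdet A = 1" "0 < Im z" "0 < Im w"
  shows "moebius A z - moebius A w = (z - w) / (mden A z * mden A w)"
proof (cases A)
  case (Mat2 a b c d)
  have nz: "complex_of_real c * z + of_real d \<noteq> 0" "complex_of_real c * w + of_real d \<noteq> 0"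
    using mden_nonzero[OF assms(1)] assms unfolding Mat2 by auto
  have "complex_of_real (a * d - b * c) = 1" using assms unfolding Mat2 by simp
  then have "complex_of_real a * of_real d - of_real b * of_real c = 1" by simp
  then have "(of_real a * z + of_real b) * (of_real c * w + of_real d) - (of_real a * w + of_real b) * (of_real c * z + of_real d) = z - w"
    by algebra
  then show ?thesis unfolding Mat2 using nz by (simp add: diff_frac_eq)
qed

lemma moebius_mult:
  assumes "mdet A = 1" "mdet B = 1" "0 < Im z"
  shows "moebius (A * B) z = moebius A (moebius B z)"
proof (cases A; cases B)
  fix a b c d a' b' c' d' assume A: "A = Mat2 a b c d" and B: "B = Mat2 a' b' c' d'"
  have nz: "complex_of_real c' * z + of_real d' \<noteq> 0" using mden_nonzero[OF assms(2,3)] B by simp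
  let ?w = "(complex_of_real a' * z + of_real b') / (of_real c' * z + of_real d')"
  have "moebius A ?w = (of_real a * ?w + of_real b) * (of_real c' * z + of_real d') / ((of_real c * ?w + of_real d) * (of_real c' * z + of_real d'))"
    using nz unfolding A by simp
  also have "(of_real a * ?w + of_real b) * (of_real c' * z + of_real d') = of_real a * (of_real a' * z + of_real b') + of_real b * (of_real c' * z + of_real d')"
    using nz by (simp add: field_simps)
  also have "(of_real c * ?w + of_real d) * (of_real c' * z + of_real d') = of_real c * (of_real a' * z + of_real b') + of_real d * (of_real c' * z + of_real d')"
    using nz by (simp add: field_simps)
  finally show ?thesis unfolding A B by (simp add: algebra_simps)
qed

lemma moebius_one [simp]: "moebius 1 z = z"
  by (simp add: one_mat2_def)

lemma moebius_uminus [simp]: "moebius (- A) z = moebius A z"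
proof (cases A)
  case (Mat2 a b c d)
  have "moebius (- A) z = (- (of_real a * z + of_real b)) / (- (of_real c * z + of_real d))"
    unfolding Mat2 by simp
  then show ?thesis unfolding Mat2 by (simp only: minus_divide_divide moebius.simps)
qed

lemma moebius_madj:
  assumes "mdet A = 1" "0 < Im z"
  shows "moebius A (moebius (madj A) z) = z" "moebius (madj A) (moebius A z) = z"
  using moebius_mult[of A "madj A" z] moebius_mult[of "madj A" A z] assms madj_left madj_right by simp_all

lemma moebius_inj:
  assumes "mdet A = 1" "0 < Im z" "0 < Im w" "moebius A z = moebius A w"
  shows "z = w"
  using moebius_madj assms by metis

lemma continuous_on_moebius:
  assumes "mdet A = 1" shows "continuous_on upper_half_plane (moebius A)"
proof (cases A)
  case (Mat2 a b c d)
  have "moebius A = (\<lambda>z. (of_real a * z + of_real b) / (of_real c * z + of_real d))"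
    unfolding Mat2 by auto
  then show ?thesis using mden_nonzero[OF assms] unfolding upper_half_plane_def Mat2
    by (auto intro!: continuous_intros)
qed

text \<open>Fixed points are roots of the real quadratic c z^2 + (d - a) z - b, whose nonreal roots
  are conjugate. Two of them in the half-plane make the quadratic vanish identically.\<close>

lemma moebius_fixed_two:
  assumes A: "mdet A = 1" and z: "0 < Im z" "moebius A z = z" and w: "0 < Im w" "moebius A w = w" and "z \<noteq> w"
  shows "A = 1 \<or> A = - 1"
proof (cases A)
  case (Mat2 a b c d)
  have fixp: "a - d = 2 * c * Re z \<and> b = - c * ((Re z)\<^sup>2 + (Im z)\<^sup>2)" if z: "0 < Im z" "moebius A z = z" for z
  proof -
    have "of_real a * z + of_real b = z * (of_real c * z + of_real d)"
      using z mden_nonzero[OF A z(1)] unfolding Mat2 by (simp add: divide_eq_eq)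
    then have 1: "a * Re z + b = Re z * (c * Re z + d) - Im z * (c * Im z)"
      and 2: "a * Im z = Re z * (c * Im z) + Im z * (c * Re z + d)"
      by (auto simp: complex_eq_iff)
    have "Im z * (a - d) = Im z * (2 * c * Re z)" using 2 by (simp add: algebra_simps)
    then have 3: "a - d = 2 * c * Re z" using z by simp
    have "b = - c * ((Re z)\<^sup>2 + (Im z)\<^sup>2)" using 1 3 by (simp add: power2_eq_square) algebra
    then show ?thesis using 3 by blast
  qed
  have "c = 0"
  proof (rule ccontr)
    assume "c \<noteq> 0"
    then have "Re z = Re w" "(Im z)\<^sup>2 = (Im w)\<^sup>2" using fixp[OF z] fixp[OF w] by auto
    then show False using z(1) w(1) \<open>z \<noteq> w\<close> by (auto simp: complex_eq_iff)
  qed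
  then have "b = 0" "a = d" using fixp[OF z] by auto
  then have "a\<^sup>2 = 1" using A \<open>c = 0\<close> unfolding Mat2 by (simp add: power2_eq_square)
  then show ?thesis using \<open>b = 0\<close> \<open>a = d\<close> \<open>c = 0\<close> unfolding Mat2 by (auto simp: one_mat2_def power2_eq_1_iff)
qed

text \<open>The fixed-point quadratic has discriminant tr^2 - 4 < 0; the fixed point is its root
  with positive imaginary part.\<close>

lemma moebius_elliptic_fixpoint:
  assumes A: "mdet A = 1" and tr: "\<bar>mtr A\<bar> < 2"
  shows "\<exists>z. 0 < Im z \<and> moebius A z = z"
proof (cases A)
  case (Mat2 a b c d)
  have dt: "a * d - b * c = 1" using A Mat2 by simp
  have "(a + d)\<^sup>2 < 4" using tr unfolding Mat2 by (simp add: abs_square_less_1[of "(a + d) / 2", simplified power_divide, simplified])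
  then have neg: "(a - d)\<^sup>2 + 4 * b * c < 0" using dt by (simp add: power2_eq_square algebra_simps)
  have c: "c \<noteq> 0" using neg by auto
  define y where "y = sqrt (- ((a - d)\<^sup>2 + 4 * b * c)) / (2 * \<bar>c\<bar>)"
  define z where "z = Complex ((a - d) / (2 * c)) y"
  have y: "0 < y" using neg c unfolding y_def by simp
  have y2: "4 * c\<^sup>2 * y\<^sup>2 = - ((a - d)\<^sup>2 + 4 * b * c)"
    using neg c unfolding y_def by (simp add: power_divide power_mult_distrib)
  have x: "2 * c * Re z = a - d" using c unfolding z_def by simp
  have "(4 * c) * (c * ((Re z)\<^sup>2 + (Im z)\<^sup>2)) = (4 * c) * (- b)"
    using y2 x unfolding z_def complex.sel by algebra
  then have n: "c * ((Re z)\<^sup>2 + (Im z)\<^sup>2) = - b" using c by (simp only: mult_cancel_left) simp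
  have "of_real a * z + of_real b = z * (of_real c * z + of_real d)"
  proof -
    have "a * Re z + b = Re z * (c * Re z + d) - Im z * (c * Im z)"
      "a * Im z = Re z * (c * Im z) + Im z * (c * Re z + d)"
      using x n by algebra+
    then show ?thesis by (simp add: complex_eq_iff)
  qed
  moreover have "0 < Im z" using y z_def by simp
  ultimately show ?thesis using mden_nonzero[OF A, of z] unfolding Mat2 by (auto simp: divide_eq_eq)
qed

section \<open>The hyperbolic distance and its invariance\<close>

lemma hyp_dist_arg_ge_1: "0 < Im z \<Longrightarrow> 0 < Im w \<Longrightarrow> 1 \<le> 1 + (cmod (z - w))\<^sup>2 / (2 * Im z * Im w)"
  by simp

lemma cosh_hyp_dist:
  "0 < Im z \<Longrightarrow> 0 < Im w \<Longrightarrow> cosh (hyp_dist z w) = 1 + (cmod (z - w))\<^sup>2 / (2 * Im z * Im w)"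
  unfolding hyp_dist_def by (rule cosh_arcosh_real[OF hyp_dist_arg_ge_1])

lemma hyp_dist_nonneg: "0 < Im z \<Longrightarrow> 0 < Im w \<Longrightarrow> 0 \<le> hyp_dist z w"
  unfolding hyp_dist_def by (rule arcosh_nonneg_real[OF hyp_dist_arg_ge_1])

lemma hyp_dist_commute: "hyp_dist z w = hyp_dist w z"
  unfolding hyp_dist_def by (simp add: norm_minus_commute mult.commute mult.left_commute)

lemma hyp_dist_self [simp]: "hyp_dist z z = 0"
  unfolding hyp_dist_def by simp

lemma hyp_dist_eq_iff:
  assumes "0 < Im z" "0 < Im w" "0 \<le> t"
  shows "hyp_dist z w = t \<longleftrightarrow> (cmod (z - w))\<^sup>2 = 2 * Im z * Im w * (cosh t - 1)"
proof -
  have "hyp_dist z w = t \<longleftrightarrow> cosh (hyp_dist z w) = cosh t"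
    using hyp_dist_nonneg[OF assms(1,2)] assms(3) by (metis arcosh_cosh_real)
  also have "\<dots> \<longleftrightarrow> (cmod (z - w))\<^sup>2 = 2 * Im z * Im w * (cosh t - 1)"
    unfolding cosh_hyp_dist[OF assms(1,2)] using assms by (auto simp: field_simps)
  finally show ?thesis .
qed

lemma hyp_dist_eq_0_iff: "0 < Im z \<Longrightarrow> 0 < Im w \<Longrightarrow> hyp_dist z w = 0 \<longleftrightarrow> z = w"
  using hyp_dist_eq_iff[of z w 0] by simp

lemma hyp_dist_moebius:
  assumes "mdet A = 1" "0 < Im z" "0 < Im w"
  shows "hyp_dist (moebius A z) (moebius A w) = hyp_dist z w"
proof -
  have "(cmod (moebius A z - moebius A w))\<^sup>2 / (2 * Im (moebius A z) * Im (moebius A w)) =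
     (cmod (z - w))\<^sup>2 / (2 * Im z * Im w)"
    unfolding moebius_diff[OF assms] Im_moebius[OF assms(1)]
    using mden_nonzero[OF assms(1)] assms by (simp add: norm_divide norm_mult power_divide power_mult_distrib field_simps)
  then show ?thesis unfolding hyp_dist_def by simp
qed

lemma sinh_half_hyp_dist_sq:
  assumes "0 < Im z" "0 < Im w"
  shows "(sinh (hyp_dist z w / 2))\<^sup>2 = (cmod (z - w))\<^sup>2 / (4 * Im z * Im w)"
proof -
  have "1 + 2 * (sinh (hyp_dist z w / 2))\<^sup>2 = 1 + (cmod (z - w))\<^sup>2 / (2 * Im z * Im w)"
    using cosh_double_cosh[of "hyp_dist z w / 2"] cosh_square_eq[of "hyp_dist z w / 2"] cosh_hyp_dist[OF assms] by simp
  then show ?thesis by (simp add: field_simps)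
qed

lemma sinh_half_hyp_dist:
  assumes "0 < Im z" "0 < Im w"
  shows "sinh (hyp_dist z w / 2) = cmod (z - w) / (2 * sqrt (Im z * Im w))"
proof (rule power2_eq_imp_eq)
  show "(sinh (hyp_dist z w / 2))\<^sup>2 = (cmod (z - w) / (2 * sqrt (Im z * Im w)))\<^sup>2"
    unfolding sinh_half_hyp_dist_sq[OF assms] using assms by (simp add: power_divide power_mult_distrib)
qed (use assms hyp_dist_nonneg in auto)

text \<open>Reflecting one point in the real line turns sinh into cosh. With
  \<open>sinh_half_hyp_dist\<close> this converts Ptolemy's inequality into the addition formula for
  sinh.\<close>

lemma cosh_half_hyp_dist:
  assumes "0 < Im z" "0 < Im w"
  shows "cosh (hyp_dist z w / 2) = cmod (z - cnj w) / (2 * sqrt (Im z * Im w))"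
proof (rule power2_eq_imp_eq)
  have "(cmod (z - w))\<^sup>2 + 4 * Im z * Im w = (cmod (z - cnj w))\<^sup>2"
    unfolding cmod_power2 by (simp add: power2_eq_square algebra_simps)
  then show "(cosh (hyp_dist z w / 2))\<^sup>2 = (cmod (z - cnj w) / (2 * sqrt (Im z * Im w)))\<^sup>2"
    unfolding cosh_square_eq sinh_half_hyp_dist_sq[OF assms] using assms
    by (simp add: power_divide power_mult_distrib field_simps)
qed (use assms in auto)

text \<open>Ptolemy's inequality for the points \<open>z\<close>, \<open>w\<close>, \<open>u\<close> and \<open>cnj u\<close>.\<close>

lemma hyp_dist_triangle:
  assumes "0 < Im z" "0 < Im u" "0 < Im w"
  shows "hyp_dist z w \<le> hyp_dist z u + hyp_dist u w"
proof -
  have "cmod ((z - w) * (u - cnj u)) = cmod ((z - u) * (w - cnj u) - (z - cnj u) * (w - u))"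
    by (simp add: algebra_simps norm_minus_commute)
  also have "\<dots> \<le> cmod (z - u) * cmod (w - cnj u) + cmod (z - cnj u) * cmod (w - u)"
    using norm_triangle_ineq4[of "(z - u) * (w - cnj u)" "(z - cnj u) * (w - u)"] by (simp add: norm_mult)
  finally have "cmod (z - w) * cmod (u - cnj u) \<le> cmod (z - u) * cmod (w - cnj u) + cmod (z - cnj u) * cmod (w - u)"
    by (simp add: norm_mult)
  moreover have "cmod (u - cnj u) = 2 * Im u" using assms by (simp add: complex_diff_cnj norm_mult)
  moreover have "cmod (w - cnj u) = cmod (u - cnj w)"
    by (metis complex_cnj_cnj complex_cnj_diff complex_mod_cnj norm_minus_commute)
  ultimately have pt: "cmod (z - w) * (2 * Im u) \<le> cmod (z - u) * cmod (u - cnj w) + cmod (z - cnj u) * cmod (u - w)"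
    by (simp add: norm_minus_commute)
  have "sinh ((hyp_dist z u + hyp_dist u w) / 2) = sinh (hyp_dist z u / 2) * cosh (hyp_dist u w / 2) + cosh (hyp_dist z u / 2) * sinh (hyp_dist u w / 2)"
    by (simp add: add_divide_distrib sinh_add)
  also have "\<dots> = (cmod (z - u) * cmod (u - cnj w) + cmod (z - cnj u) * cmod (u - w)) / (4 * (sqrt (Im z * Im u) * sqrt (Im u * Im w)))"
    using assms by (simp add: sinh_half_hyp_dist cosh_half_hyp_dist add_divide_distrib)
  also have "sqrt (Im z * Im u) * sqrt (Im u * Im w) = Im u * sqrt (Im z * Im w)"
    using assms by (simp add: real_sqrt_mult)
  also have "(cmod (z - u) * cmod (u - cnj w) + cmod (z - cnj u) * cmod (u - w)) / (4 * (Im u * sqrt (Im z * Im w)))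
      \<ge> cmod (z - w) * (2 * Im u) / (4 * (Im u * sqrt (Im z * Im w)))"
    using pt assms by (intro divide_right_mono) auto
  also have "cmod (z - w) * (2 * Im u) / (4 * (Im u * sqrt (Im z * Im w))) = sinh (hyp_dist z w / 2)"
    using assms by (simp add: sinh_half_hyp_dist field_simps)
  finally show ?thesis by simp
qed

lemma mdisp_eq_sinh:
  assumes "mdet A = 1"
  shows "mdisp A = (sinh (hyp_dist \<i> (moebius A \<i>) / 2))\<^sup>2"
proof (cases A)
  case (Mat2 a b c d)
  have nz: "mden A \<i> \<noteq> 0" using mden_nonzero[OF assms] by simp
  have n: "(cmod (mden A \<i>))\<^sup>2 = c\<^sup>2 + d\<^sup>2" unfolding Mat2 cmod_power2 by simp
  define N where "N = \<i> * mden A \<i> - (of_real a * \<i> + of_real b)"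
  have "\<i> - moebius A \<i> = N / mden A \<i>"
    using nz unfolding Mat2 N_def by (simp add: diff_divide_distrib)
  moreover have "(cmod N)\<^sup>2 = (c + b)\<^sup>2 + (d - a)\<^sup>2"
    unfolding N_def Mat2 cmod_power2 by (simp add: power2_eq_square algebra_simps)
  ultimately have "(cmod (\<i> - moebius A \<i>))\<^sup>2 = ((c + b)\<^sup>2 + (d - a)\<^sup>2) / (c\<^sup>2 + d\<^sup>2)"
    using n by (simp add: norm_divide power_divide)
  moreover have im: "Im (moebius A \<i>) = 1 / (c\<^sup>2 + d\<^sup>2)" using Im_moebius[OF assms, of \<i>] n by simp
  moreover have "c\<^sup>2 + d\<^sup>2 \<noteq> 0" using nz n by auto
  ultimately have "(cmod (\<i> - moebius A \<i>))\<^sup>2 / (4 * Im \<i> * Im (moebius A \<i>)) = ((c + b)\<^sup>2 + (d - a)\<^sup>2) / 4"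
    by simp
  then have "(sinh (hyp_dist \<i> (moebius A \<i>) / 2))\<^sup>2 = ((c + b)\<^sup>2 + (d - a)\<^sup>2) / 4"
    by (subst sinh_half_hyp_dist_sq) (use Im_moebius_pos[OF assms, of \<i>] in simp_all)
  moreover have "mdisp A = ((c + b)\<^sup>2 + (d - a)\<^sup>2) / 4"
    unfolding Mat2 by (simp add: power2_eq_square algebra_simps)
  ultimately show ?thesis by simp
qed

section \<open>Moving geodesics to the imaginary axis\<close>

lemma hyp_dist_imag_axis: "hyp_dist (\<i> * of_real (exp s)) (\<i> * of_real (exp t)) = \<bar>s - t\<bar>"
proof -
  have "2 * exp s * exp t * cosh \<bar>s - t\<bar> = exp s * exp s + exp t * exp t"
    by (simp add: cosh_def exp_diff exp_minus abs_if field_simps)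
  then have "(exp s - exp t)\<^sup>2 = 2 * exp s * exp t * (cosh \<bar>s - t\<bar> - 1)"
    by (simp add: power2_eq_square algebra_simps)
  moreover have "(cmod (\<i> * of_real (exp s) - \<i> * of_real (exp t)))\<^sup>2 = (exp s - exp t)\<^sup>2"
    unfolding cmod_power2 by simp
  ultimately show ?thesis by (subst hyp_dist_eq_iff) auto
qed

text \<open>The two radii have sum or difference equal to the distance of the centres, so the
  circles are tangent and meet only on the axis.\<close>

lemma imag_axis_rigid:
  assumes z: "0 < Im z" and t: "t \<noteq> 0"
    and d: "hyp_dist z \<i> = \<bar>s\<bar>" "hyp_dist z (\<i> * of_real (exp t)) = \<bar>s - t\<bar>"
  shows "z = \<i> * of_real (exp s)"
proof -
  define x y where "x = Re z" and "y = Im z"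
  have y: "0 < y" using z y_def by simp
  have 1: "x\<^sup>2 + (y - 1)\<^sup>2 = 2 * y * (cosh s - 1)"
    using d(1) z by (subst (asm) hyp_dist_eq_iff) (auto simp: cmod_power2 x_def y_def)
  have 2: "x\<^sup>2 + (y - exp t)\<^sup>2 = 2 * y * exp t * (cosh (s - t) - 1)"
    using d(2) z by (subst (asm) hyp_dist_eq_iff) (auto simp: cmod_power2 x_def y_def)
  have ch: "2 * exp s * cosh s = (exp s)\<^sup>2 + 1" "2 * exp s * (exp t * cosh (s - t)) = (exp s)\<^sup>2 + (exp t)\<^sup>2"
    by (simp_all add: cosh_def exp_diff exp_minus field_simps power2_eq_square)
  have "exp s * (1 - (exp t)\<^sup>2) = y * (1 - (exp t)\<^sup>2)"
  proof -
    \<comment> \<open>Subtracting the two circle equations eliminates x and determines y; then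
      either equation gives x = 0.\<close>
    have "1 - (exp t)\<^sup>2 = 2 * y * (cosh s - exp t * cosh (s - t))"
      using 1 2 by (simp add: power2_eq_square algebra_simps)
    then have "exp s * (1 - (exp t)\<^sup>2) = exp s * (2 * y * (cosh s - exp t * cosh (s - t)))" by (simp only:)
    then have "exp s * (1 - (exp t)\<^sup>2) = y * (2 * exp s * cosh s - 2 * exp s * (exp t * cosh (s - t)))"
      by (simp add: algebra_simps)
    also have "\<dots> = y * (1 - (exp t)\<^sup>2)" unfolding ch by simp
    finally show ?thesis .
  qed
  moreover have "1 - (exp t)\<^sup>2 \<noteq> 0" using t exp_gt_zero[of t] by (auto simp: power2_eq_1_iff simp del: exp_gt_zero)
  ultimately have ys: "y = exp s" by simp
  have "x\<^sup>2 = 0" using 1 ch(1) unfolding ys by (simp add: power2_eq_square algebra_simps)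
  then show ?thesis using ys unfolding x_def y_def by (simp add: complex_eq_iff)
qed

lemma moebius_rotation_to_imag_axis:
  assumes w: "0 < Im w"
  shows "\<exists>A. mdet A = 1 \<and> moebius A \<i> = \<i> \<and> Re (moebius A w) = 0"
proof -
  \<comment> \<open>The numerator of the real part of the image of \<open>w\<close> under the
    rotation about \<i>. The value \<theta> = pi/2 is the half turn z -> -1/z, which changes the
    sign, so the intermediate value theorem applies.\<close>
  define h where "h \<theta> = sin \<theta> * cos \<theta> * (1 - (cmod w)\<^sup>2) + ((cos \<theta>)\<^sup>2 - (sin \<theta>)\<^sup>2) * Re w" for \<theta>
  have "\<exists>\<theta>. h \<theta> = 0"
  proof -
    have cont: "continuous_on {0..pi / 2} h" unfolding h_def by (intro continuous_intros)
    have h0: "h 0 = Re w" "h (pi / 2) = - Re w" unfolding h_def by auto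
    show ?thesis
    proof (cases "0 \<le> Re w")
      case True
      then show ?thesis using IVT2'[of h "pi / 2" 0 0] h0 cont by auto
    next
      case False
      then show ?thesis using IVT'[of h 0 0 "pi / 2"] h0 cont by auto
    qed
  qed
  then obtain \<theta> where \<theta>: "h \<theta> = 0" by blast
  let ?A = "Mat2 (cos \<theta>) (sin \<theta>) (- sin \<theta>) (cos \<theta>)"
  have A: "mdet ?A = 1" by (simp add: power2_eq_square[symmetric])
  have "moebius ?A \<i> = \<i>"
  proof -
    have "complex_of_real (cos \<theta>) * \<i> + of_real (sin \<theta>) = \<i> * (of_real (- sin \<theta>) * \<i> + of_real (cos \<theta>))"
      by (simp add: complex_eq_iff)
    then show ?thesis using mden_nonzero[OF A, of \<i>] by (simp add: divide_eq_eq)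
  qed
  moreover have "Re (moebius ?A w) = 0"
  proof -
    have "(cos \<theta> * Re w + sin \<theta>) * (cos \<theta> - sin \<theta> * Re w) - cos \<theta> * Im w * (sin \<theta> * Im w) = h \<theta>"
      unfolding h_def cmod_power2 by (simp add: power2_eq_square algebra_simps)
    then show ?thesis using \<theta> by (simp add: Re_divide)
  qed
  ultimately show ?thesis using A by blast
qed

lemma moebius_to_imag_axis:
  assumes p: "0 < Im p" and q: "0 < Im q" and t: "0 < t" "hyp_dist p q = t"
  shows "\<exists>A. mdet A = 1 \<and> moebius A p = \<i> \<and> moebius A q = \<i> * of_real (exp t)"
proof -
  let ?s = "sqrt (Im p)"
  let ?B = "Mat2 (1 / ?s) (- Re p / ?s) 0 ?s"
  have B: "mdet ?B = 1" using p by simp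
  have Bp: "moebius ?B p = \<i>"
  proof -
    have "moebius ?B p = (p - of_real (Re p)) / (of_real ?s * of_real ?s)"
      by (simp add: diff_divide_distrib)
    also have "of_real ?s * of_real ?s = complex_of_real (Im p)" using p by (simp flip: of_real_mult)
    also have "p - of_real (Re p) = \<i> * of_real (Im p)" by (simp add: complex_eq_iff)
    finally show ?thesis using p by simp
  qed
  obtain R where R: "mdet R = 1" "moebius R \<i> = \<i>" "Re (moebius R (moebius ?B q)) = 0"
    using moebius_rotation_to_imag_axis[OF Im_moebius_pos[OF B q]] by blast
  define A where "A = R * ?B"
  have A: "mdet A = 1" "moebius A p = \<i>" "moebius A q = moebius R (moebius ?B q)"
    unfolding A_def using moebius_mult[OF R(1) B] Bp R B p q by auto
  define y where "y = ln (Im (moebius A q))"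
  have "0 < Im (moebius A q)" using Im_moebius_pos A q by blast
  then have y: "moebius A q = \<i> * of_real (exp y)"
    using R(3) unfolding A(3)[symmetric] y_def by (simp add: complex_eq_iff)
  have "t = \<bar>0 - y\<bar>" using hyp_dist_moebius[OF A(1) p q] t hyp_dist_imag_axis[of 0 y] A(2) y by simp
  then consider "y = t" | "y = - t" by linarith
  then show ?thesis
  proof cases
    case 1
    then show ?thesis using A y by blast
  next
    case 2
    \<comment> \<open>The half turn about \<i>, needed when the second point has landed below \<i>
      on the axis.\<close>
    let ?J = "Mat2 0 (- 1) 1 0"
    have "moebius (?J * A) p = moebius ?J \<i>" "moebius (?J * A) q = moebius ?J (\<i> * of_real (exp (- t)))"
      using moebius_mult[of ?J A p] moebius_mult[of ?J A q] A(1) p q unfolding A(2) y 2 by simp_all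
    then have "moebius (?J * A) p = \<i>" "moebius (?J * A) q = \<i> * of_real (exp t)"
      by (simp_all add: exp_minus field_simps)
    moreover have "mdet (?J * A) = 1" using A by simp
    ultimately show ?thesis by blast
  qed
qed

text \<open>Only two points need to be normalised: distances to them determine every other point of
  the segment by \<open>imag_axis_rigid\<close>.\<close>

lemma geodesic_segment_to_imag_axis:
  assumes \<gamma>: "\<And>t. \<bar>t\<bar> < e \<Longrightarrow> 0 < Im (\<gamma> t)" "\<And>s t. \<bar>s\<bar> < e \<Longrightarrow> \<bar>t\<bar> < e \<Longrightarrow> hyp_dist (\<gamma> s) (\<gamma> t) = \<bar>s - t\<bar>"
    and e: "0 < e"
  shows "\<exists>A. mdet A = 1 \<and> (\<forall>t. \<bar>t\<bar> < e \<longrightarrow> moebius A (\<gamma> t) = \<i> * of_real (exp t))"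
proof -
  have h: "0 < e / 2" "\<bar>e / 2\<bar> < e" "\<bar>0\<bar> < e" using e by auto
  obtain A where A: "mdet A = 1" "moebius A (\<gamma> 0) = \<i>" "moebius A (\<gamma> (e / 2)) = \<i> * of_real (exp (e / 2))"
    using moebius_to_imag_axis[of "\<gamma> 0" "\<gamma> (e / 2)" "e / 2"] \<gamma>(1)[of 0] \<gamma>(1)[of "e / 2"] \<gamma>(2)[of 0 "e / 2"] h by auto
  have "moebius A (\<gamma> t) = \<i> * of_real (exp t)" if t: "\<bar>t\<bar> < e" for t
  proof (rule imag_axis_rigid)
    show "0 < Im (moebius A (\<gamma> t))" using Im_moebius_pos A(1) \<gamma>(1)[OF t] by blast
    show "hyp_dist (moebius A (\<gamma> t)) \<i> = \<bar>t\<bar>"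
      using hyp_dist_moebius[OF A(1) \<gamma>(1)[OF t] \<gamma>(1)[OF h(3)]] \<gamma>(2)[OF t h(3)] A(2) by simp
    show "hyp_dist (moebius A (\<gamma> t)) (\<i> * of_real (exp (e / 2))) = \<bar>t - e / 2\<bar>"
      using hyp_dist_moebius[OF A(1) \<gamma>(1)[OF t] \<gamma>(1)[OF h(2)]] \<gamma>(2)[OF t h(2)] A(3) by simp
  qed (use e in auto)
  then show ?thesis using A(1) by blast
qed

section \<open>Comparison with the Euclidean metric\<close>

lemma sinh_ge_self:
  fixes x :: real assumes "0 \<le> x" shows "x \<le> sinh x"
proof -
  have "sinh 0 - 0 \<le> sinh x - x"
  proof (rule DERIV_nonneg_imp_nondecreasing[OF assms])
    fix t :: real
    have "((\<lambda>x. sinh x - x) has_real_derivative (cosh t - 1)) (at t)"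
      by (auto intro!: derivative_eq_intros)
    then show "\<exists>y. ((\<lambda>x. sinh x - x) has_real_derivative y) (at t) \<and> 0 \<le> y"
      using cosh_real_ge_1[of t] by (intro exI[of _ "cosh t - 1"]) simp
  qed
  then show ?thesis by simp
qed

lemma hyp_dist_le:
  assumes m: "0 < m" and z: "m \<le> Im z" "m \<le> Im w"
  shows "hyp_dist z w \<le> cmod (z - w) / m"
proof -
  have p: "0 < Im z" "0 < Im w" using m z by auto
  have "hyp_dist z w / 2 \<le> sinh (hyp_dist z w / 2)"
    using hyp_dist_nonneg[OF p] by (intro sinh_ge_self) auto
  also have "\<dots> = cmod (z - w) / (2 * sqrt (Im z * Im w))" using sinh_half_hyp_dist[OF p] .
  also have "\<dots> \<le> cmod (z - w) / (2 * m)"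
  proof (intro divide_left_mono mult_pos_pos mult_left_mono)
    have "m * m \<le> Im z * Im w" using z m by (intro mult_mono) auto
    then show "m \<le> sqrt (Im z * Im w)" by (intro real_le_rsqrt) (simp add: power2_eq_square)
  qed (use m p in auto)
  finally show ?thesis by (simp add: field_simps)
qed

lemma continuous_on_hyp_dist: "0 < Im z \<Longrightarrow> continuous_on upper_half_plane (hyp_dist z)"
  unfolding hyp_dist_def[abs_def] upper_half_plane_def
  by (rule continuous_on_compose2[OF continuous_on_arcosh[OF order.refl]]) (auto intro!: continuous_intros)

lemma Im_le_exp_hyp_dist:
  assumes "0 < Im z" "0 < Im w"
  shows "Im w \<le> exp (hyp_dist z w) * Im z"
proof -
  define d where "d = hyp_dist z w"
  have "(Im z - Im w)\<^sup>2 \<le> (cmod (z - w))\<^sup>2" unfolding cmod_power2 by simp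
  also have "\<dots> = 2 * Im z * Im w * (cosh d - 1)"
    using hyp_dist_eq_iff[OF assms hyp_dist_nonneg[OF assms]] d_def by blast
  finally have 1: "(Im z)\<^sup>2 + (Im w)\<^sup>2 \<le> 2 * Im z * Im w * cosh d"
    by (simp add: power2_eq_square algebra_simps)
  have "2 * cosh d = exp d + exp (- d)" by (simp add: cosh_def)
  then have "2 * Im z * Im w * cosh d = Im z * Im w * (exp d + exp (- d))" by simp
  then have "(Im w - exp d * Im z) * (Im w - exp (- d) * Im z) \<le> 0"
    using 1 by (simp add: power2_eq_square algebra_simps exp_minus)
  show ?thesis
  proof (rule ccontr)
    assume "\<not> Im w \<le> exp (hyp_dist z w) * Im z"
    then have a: "0 < Im w - exp d * Im z" unfolding d_def by simp
    have "0 \<le> d" unfolding d_def using hyp_dist_nonneg assms by auto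
    then have "exp (- d) * Im z \<le> exp d * Im z" using assms by (intro mult_right_mono) auto
    then have "0 < (Im w - exp d * Im z) * (Im w - exp (- d) * Im z)" using a by (intro mult_pos_pos) auto
    then show False using \<open>(Im w - exp d * Im z) * (Im w - exp (- d) * Im z) \<le> 0\<close> by linarith
  qed
qed

lemma hyp_dist_small:
  assumes z: "0 < Im z" and e: "0 < e"
  shows "\<exists>\<delta>>0. \<forall>w. 0 < Im w \<longrightarrow> hyp_dist z w < \<delta> \<longrightarrow> cmod (z - w) < e"
proof -
  have lim: "((\<lambda>d::real. 2 * Im z * (exp d * Im z) * (cosh d - 1)) \<longlongrightarrow> 2 * Im z * (exp 0 * Im z) * (cosh 0 - 1)) (at 0)"
    by (intro tendsto_intros)
  have "\<forall>\<^sub>F d in at 0. 2 * Im z * (exp d * Im z) * (cosh d - 1) < e\<^sup>2"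
    using order_tendstoD(2)[OF lim, of "e\<^sup>2"] e by simp
  then obtain \<delta> where \<delta>: "0 < \<delta>" "\<And>d. d \<noteq> 0 \<Longrightarrow> \<bar>d\<bar> < \<delta> \<Longrightarrow> 2 * Im z * (exp d * Im z) * (cosh d - 1) < e\<^sup>2"
    unfolding eventually_at by (auto simp: dist_real_def)
  have "cmod (z - w) < e" if w: "0 < Im w" "hyp_dist z w < \<delta>" for w
  proof (cases "hyp_dist z w = 0")
    case True
    then show ?thesis using hyp_dist_eq_0_iff[OF z w(1)] e by simp
  next
    case False
    let ?d = "hyp_dist z w"
    have d: "0 \<le> ?d" using hyp_dist_nonneg z w by auto
    have "(cmod (z - w))\<^sup>2 = 2 * Im z * Im w * (cosh ?d - 1)"
      using hyp_dist_eq_iff[OF z w(1) d] by blast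
    also have "\<dots> \<le> 2 * Im z * (exp ?d * Im z) * (cosh ?d - 1)"
      using Im_le_exp_hyp_dist[OF z w(1)] z by (intro mult_right_mono mult_left_mono) (auto simp: cosh_real_ge_1)
    also have "\<dots> < e\<^sup>2" using \<delta>(2)[of ?d] False w(2) d by simp
    finally show ?thesis using e by (meson less_eq_real_def power2_less_imp_less)
  qed
  then show ?thesis using \<delta>(1) by blast
qed

section \<open>Local isometries from the hyperbolic plane to the surface\<close>

lemma moebius_eq_two_points:
  assumes "mdet A = 1" "mdet B = 1" "0 < Im z" "0 < Im w" "z \<noteq> w"
    and "moebius A z = moebius B z" "moebius A w = moebius B w"
  shows "A = B \<or> A = - B"
proof -
  have "moebius (madj B * A) z = z" "moebius (madj B * A) w = w"
    using assms moebius_mult[of "madj B" A] moebius_madj(2)[of B] by simp_all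
  then have "madj B * A = 1 \<or> madj B * A = - 1"
    using assms by (intro moebius_fixed_two[of _ z w]) auto
  moreover have "B * (madj B * A) = A" using madj_right[OF assms(2)] by (simp add: mult.assoc[symmetric])
  ultimately show ?thesis by (metis mult_1_right mult_uminus_right)
qed

text \<open>The identity principle behind every continuation below: the germ of a Moebius map
  determines the map.\<close>

lemma moebius_eq_on_open:
  assumes "mdet A = 1" "mdet B = 1" "open N" "N \<noteq> {}" "N \<subseteq> upper_half_plane"
    and "\<And>w. w \<in> N \<Longrightarrow> moebius A w = moebius B w"
  shows "moebius A = moebius B"
proof -
  obtain z where z: "z \<in> N" using assms(4) by auto
  then have "infinite N" using assms(3) finite_imp_not_open[of N] by blast
  then obtain w where w: "w \<in> N" "w \<noteq> z" by (metis finite.emptyI finite_insert insert_iff rev_finite_subset subsetI)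
  have "A = B \<or> A = - B"
    using moebius_eq_two_points[of A B z w] assms z w unfolding upper_half_plane_def by auto
  then show ?thesis by auto
qed

lemma isCont_eventually_mem: "isCont f z \<Longrightarrow> open W \<Longrightarrow> f z \<in> W \<Longrightarrow> \<forall>\<^sub>F w in nhds z. f w \<in> W"
  unfolding continuous_at_open eventually_nhds by blast

locale hyperbolic_atlas =
  fixes \<A> :: "('a::metric_space set \<times> ('a \<Rightarrow> complex)) set"
  assumes atlas: "oriented_hyperbolic_atlas \<A>"
begin

section \<open>Charts, and maps that locally invert them\<close>

lemma chart_exists: "\<exists>U \<phi>. (U, \<phi>) \<in> \<A> \<and> x \<in> U"
proof -
  have "\<forall>x. \<exists>(U, \<phi>)\<in>\<A>. x \<in> U"
    using atlas unfolding oriented_hyperbolic_atlas_def by (elim conjE) assumption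
  then obtain p where "p \<in> \<A>" "case p of (U, \<phi>) \<Rightarrow> x \<in> U" by (elim allE[of _ x]) (elim bexE)
  then show ?thesis by (cases p) auto
qed

lemma chart:
  assumes "(U, \<phi>) \<in> \<A>"
  shows chart_open: "open U" and chart_image_open: "open (\<phi> ` U)"
    and chart_Im: "x \<in> U \<Longrightarrow> 0 < Im (\<phi> x)"
    and chart_dist: "x \<in> U \<Longrightarrow> y \<in> U \<Longrightarrow> hyp_dist (\<phi> x) (\<phi> y) = dist x y"
proof -
  have "\<forall>(U, \<phi>) \<in> \<A>. open U \<and> open (\<phi> ` U) \<and> \<phi> ` U \<subseteq> upper_half_plane \<and>
        (\<forall>x\<in>U. \<forall>y\<in>U. hyp_dist (\<phi> x) (\<phi> y) = dist x y)"
    using atlas unfolding oriented_hyperbolic_atlas_def by (elim conjE) assumption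
  from bspec[OF this assms]
  have *: "open U \<and> open (\<phi> ` U) \<and> \<phi> ` U \<subseteq> upper_half_plane \<and>
        (\<forall>x\<in>U. \<forall>y\<in>U. hyp_dist (\<phi> x) (\<phi> y) = dist x y)" by simp
  show "open U" "open (\<phi> ` U)" using * by auto
  show "x \<in> U \<Longrightarrow> 0 < Im (\<phi> x)" using * unfolding upper_half_plane_def by auto
  show "x \<in> U \<Longrightarrow> y \<in> U \<Longrightarrow> hyp_dist (\<phi> x) (\<phi> y) = dist x y" using * by blast
qed

lemma chart_inj: "(U, \<phi>) \<in> \<A> \<Longrightarrow> inj_on \<phi> U"
  by (rule inj_onI) (metis chart_dist dist_eq_0_iff hyp_dist_self)

lemma chart_change:
  assumes "(U, \<phi>) \<in> \<A>" "(V, \<psi>) \<in> \<A>" "x \<in> U" "x \<in> V"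
  shows "\<exists>W B. open W \<and> x \<in> W \<and> W \<subseteq> U \<inter> V \<and> mdet B = 1 \<and> (\<forall>y\<in>W. \<psi> y = moebius B (\<phi> y))"
proof -
  have "\<forall>(U, \<phi>) \<in> \<A>. \<forall>(V, \<psi>) \<in> \<A>. \<forall>x \<in> U \<inter> V.
        \<exists>W g. open W \<and> x \<in> W \<and> W \<subseteq> U \<inter> V \<and> g \<in> PSL2R_maps \<and> (\<forall>y\<in>W. \<psi> y = g (\<phi> y))"
    using atlas unfolding oriented_hyperbolic_atlas_def by (elim conjE) assumption
  from bspec[OF this assms(1)] have "\<forall>(V, \<psi>) \<in> \<A>. \<forall>x \<in> U \<inter> V.
        \<exists>W g. open W \<and> x \<in> W \<and> W \<subseteq> U \<inter> V \<and> g \<in> PSL2R_maps \<and> (\<forall>y\<in>W. \<psi> y = g (\<phi> y))" by (simp only: prod.case)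
  from bspec[OF this assms(2)] have "\<forall>x \<in> U \<inter> V.
        \<exists>W g. open W \<and> x \<in> W \<and> W \<subseteq> U \<inter> V \<and> g \<in> PSL2R_maps \<and> (\<forall>y\<in>W. \<psi> y = g (\<phi> y))" by (simp only: prod.case)
  from bspec[OF this IntI[OF assms(3,4)]] obtain W g where "open W" "x \<in> W" "W \<subseteq> U \<inter> V" "g \<in> PSL2R_maps" "\<forall>y\<in>W. \<psi> y = g (\<phi> y)"
    by (elim exE conjE) (rule that)
  then show ?thesis unfolding PSL2R_maps_eq by auto
qed

lemma chart_continuous:
  assumes "(U, \<phi>) \<in> \<A>"
  shows "continuous_on U \<phi>"
  unfolding continuous_on_iff
proof (intro ballI allI impI)
  fix x and e :: real assume x: "x \<in> U" and e: "0 < e"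
  obtain \<delta> where \<delta>: "0 < \<delta>" "\<And>w. 0 < Im w \<Longrightarrow> hyp_dist (\<phi> x) w < \<delta> \<Longrightarrow> cmod (\<phi> x - w) < e"
    using hyp_dist_small[OF chart_Im[OF assms x] e] by blast
  have "dist (\<phi> y) (\<phi> x) < e" if "y \<in> U" "dist y x < \<delta>" for y
    using \<delta>(2)[of "\<phi> y"] chart_Im[OF assms that(1)] chart_dist[OF assms x that(1)] that(2)
    by (simp add: dist_commute dist_norm norm_minus_commute)
  then show "\<exists>d>0. \<forall>x'\<in>U. dist x' x < d \<longrightarrow> dist (\<phi> x') (\<phi> x) < e" using \<delta>(1) by blast
qed

text \<open>Near \<open>z\<close> the map \<open>\<pi>\<close> is the inverse of a chart composed with an orientation-preserving
  isometry of the hyperbolic plane.\<close>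

definition dev_at :: "(complex \<Rightarrow> 'a) \<Rightarrow> complex \<Rightarrow> bool" where
  "dev_at \<pi> z \<longleftrightarrow> (\<exists>U \<phi> B N. (U, \<phi>) \<in> \<A> \<and> mdet B = 1 \<and> open N \<and> z \<in> N \<and> N \<subseteq> upper_half_plane \<and>
     (\<forall>w\<in>N. \<pi> w \<in> U \<and> \<phi> (\<pi> w) = moebius B w))"

lemma dev_at_dist:
  assumes "dev_at \<pi> z"
  shows "\<exists>N. open N \<and> z \<in> N \<and> N \<subseteq> upper_half_plane \<and> (\<forall>w\<in>N. \<forall>w'\<in>N. dist (\<pi> w) (\<pi> w') = hyp_dist w w')"
proof -
  obtain U \<phi> B N where *: "(U, \<phi>) \<in> \<A>" "mdet B = 1" "open N" "z \<in> N" "N \<subseteq> upper_half_plane"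
     "\<And>w. w \<in> N \<Longrightarrow> \<pi> w \<in> U \<and> \<phi> (\<pi> w) = moebius B w"
    using assms unfolding dev_at_def by blast
  have "dist (\<pi> w) (\<pi> w') = hyp_dist w w'" if "w \<in> N" "w' \<in> N" for w w'
    using chart_dist[OF *(1), of "\<pi> w" "\<pi> w'"] *(6)[OF that(1)] *(6)[OF that(2)] hyp_dist_moebius[OF *(2), of w w'] that *(5)
    unfolding upper_half_plane_def by auto
  then show ?thesis using * by blast
qed

lemma dev_at_upper: "dev_at \<pi> z \<Longrightarrow> 0 < Im z"
  unfolding dev_at_def upper_half_plane_def by blast

lemma dev_at_continuous:
  assumes "dev_at \<pi> z"
  shows "isCont \<pi> z"
proof -
  obtain N where N: "open N" "z \<in> N" "N \<subseteq> upper_half_plane" "\<And>w w'. w \<in> N \<Longrightarrow> w' \<in> N \<Longrightarrow> dist (\<pi> w) (\<pi> w') = hyp_dist w w'"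
    using dev_at_dist[OF assms] by blast
  have "continuous_on N (hyp_dist z)"
    using continuous_on_hyp_dist[of z] N continuous_on_subset unfolding upper_half_plane_def by blast
  then have "(hyp_dist z \<longlongrightarrow> hyp_dist z z) (at z)"
    using N(1,2) unfolding continuous_on_eq_continuous_at[OF N(1)] isCont_def by blast
  then have "(hyp_dist z \<longlongrightarrow> 0) (at z)" by simp
  moreover have "\<forall>\<^sub>F w in at z. hyp_dist z w = dist (\<pi> w) (\<pi> z)"
    unfolding eventually_at_topological
    by (intro exI[of _ N]) (use N in \<open>auto simp: hyp_dist_commute\<close>)
  ultimately have "((\<lambda>w. dist (\<pi> w) (\<pi> z)) \<longlongrightarrow> 0) (at z)"
    using Lim_transform_eventually by fastforce
  then show ?thesis unfolding isCont_def using tendsto_dist_iff by blast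
qed

text \<open>Makes the chart in \<open>dev_at\<close> arbitrary: a coordinate change is locally a
  Moebius map and can be absorbed into \<open>B\<close>. Two such maps with a common value can thus
  be compared in one chart.\<close>

lemma dev_at_chart:
  assumes "dev_at \<pi> z" "(V, \<psi>) \<in> \<A>" "\<pi> z \<in> V"
  shows "\<exists>B N. mdet B = 1 \<and> open N \<and> z \<in> N \<and> N \<subseteq> upper_half_plane \<and> (\<forall>w\<in>N. \<pi> w \<in> V \<and> \<psi> (\<pi> w) = moebius B w)"
proof -
  obtain U \<phi> B N where *: "(U, \<phi>) \<in> \<A>" "mdet B = 1" "open N" "z \<in> N" "N \<subseteq> upper_half_plane"
     "\<And>w. w \<in> N \<Longrightarrow> \<pi> w \<in> U \<and> \<phi> (\<pi> w) = moebius B w"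
    using assms(1) unfolding dev_at_def by blast
  obtain W C where W: "open W" "\<pi> z \<in> W" "W \<subseteq> U \<inter> V" "mdet C = 1" "\<And>y. y \<in> W \<Longrightarrow> \<psi> y = moebius C (\<phi> y)"
    using chart_change[OF *(1) assms(2), of "\<pi> z"] *(4,6) assms(3) by blast
  have "\<forall>\<^sub>F w in nhds z. \<pi> w \<in> W"
    by (rule isCont_eventually_mem[OF dev_at_continuous[OF assms(1)] W(1,2)])
  then obtain N' where N': "open N'" "z \<in> N'" "\<And>w. w \<in> N' \<Longrightarrow> \<pi> w \<in> W"
    unfolding eventually_nhds by blast
  show ?thesis
  proof (intro exI conjI ballI)
    show "mdet (C * B) = 1" using W *(2) by simp
    show "open (N \<inter> N')" "z \<in> N \<inter> N'" "N \<inter> N' \<subseteq> upper_half_plane" using * N' by auto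
    fix w assume w: "w \<in> N \<inter> N'"
    show "\<pi> w \<in> V" using N'(3)[of w] w W(3) by auto
    show "\<psi> (\<pi> w) = moebius (C * B) w"
      using W(5)[of "\<pi> w"] N'(3)[of w] w *(6)[of w] moebius_mult[OF W(4) *(2), of w] *(5)
      unfolding upper_half_plane_def by auto
  qed
qed

lemma dev_at_cong:
  assumes "dev_at \<pi> z" "open D" "z \<in> D" "\<And>w. w \<in> D \<Longrightarrow> \<pi>' w = \<pi> w"
  shows "dev_at \<pi>' z"
proof -
  obtain U \<phi> B N where *: "(U, \<phi>) \<in> \<A>" "mdet B = 1" "open N" "z \<in> N" "N \<subseteq> upper_half_plane"
     "\<forall>w\<in>N. \<pi> w \<in> U \<and> \<phi> (\<pi> w) = moebius B w"
    using assms(1) unfolding dev_at_def by blast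
  then show ?thesis unfolding dev_at_def
    by (intro exI[of _ U] exI[of _ \<phi>] exI[of _ B] exI[of _ "N \<inter> D"]) (use assms in auto)
qed

lemma dev_at_moebius:
  assumes "dev_at \<pi> (moebius C z)" "mdet C = 1" "0 < Im z"
  shows "dev_at (\<lambda>w. \<pi> (moebius C w)) z"
proof -
  obtain U \<phi> B N where *: "(U, \<phi>) \<in> \<A>" "mdet B = 1" "open N" "moebius C z \<in> N" "N \<subseteq> upper_half_plane"
     "\<And>w. w \<in> N \<Longrightarrow> \<pi> w \<in> U \<and> \<phi> (\<pi> w) = moebius B w"
    using assms(1) unfolding dev_at_def by blast
  let ?N = "moebius C -` N \<inter> upper_half_plane"
  have "open ?N" using continuous_on_moebius[OF assms(2)] *(3) open_upper_half_plane
    by (simp add: continuous_on_open_vimage)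
  moreover have "\<pi> (moebius C w) \<in> U \<and> \<phi> (\<pi> (moebius C w)) = moebius (B * C) w" if "w \<in> ?N" for w
    using *(6)[of "moebius C w"] that moebius_mult[OF *(2) assms(2), of w] by (auto simp: upper_half_plane_def)
  ultimately show ?thesis unfolding dev_at_def
    by (intro exI[of _ U] exI[of _ \<phi>] exI[of _ "B * C"] exI[of _ ?N])
      (use * assms in \<open>auto simp: upper_half_plane_def\<close>)
qed

lemma dev_at_inverse_chart:
  assumes "(U, \<phi>) \<in> \<A>" "mdet B = 1"
  shows "\<exists>N. open N \<and> N = {w \<in> upper_half_plane. moebius B w \<in> \<phi> ` U} \<and> 
    (\<forall>w\<in>N. dev_at (\<lambda>w. inv_into U \<phi> (moebius B w)) w)"
proof -
  let ?N = "moebius B -` (\<phi> ` U) \<inter> upper_half_plane"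
  have "open ?N" using continuous_on_moebius[OF assms(2)] chart_image_open[OF assms(1)] open_upper_half_plane
    by (simp add: continuous_on_open_vimage)
  moreover have "inv_into U \<phi> (moebius B w) \<in> U \<and> \<phi> (inv_into U \<phi> (moebius B w)) = moebius B w" if "w \<in> ?N" for w
    using that by (auto simp: inv_into_into f_inv_into_f)
  ultimately have "dev_at (\<lambda>w. inv_into U \<phi> (moebius B w)) w" if "w \<in> ?N" for w
    unfolding dev_at_def using assms that
    by (intro exI[of _ U] exI[of _ \<phi>] exI[of _ B] exI[of _ ?N]) auto
  then show ?thesis using \<open>open ?N\<close> by (intro exI[of _ ?N]) auto
qed

text \<open>The local Moebius maps agree on overlaps by the identity principle, so connectedness
  yields a single one. \<open>G\<close> is where the initial map is valid, and \<open>H\<close>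
  gathers the open sets missing it.\<close>

lemma dev_chart_moebius:
  assumes D: "open D" "connected D" "D \<noteq> {}" and dev: "\<And>z. z \<in> D \<Longrightarrow> dev_at \<pi> z"
    and V: "(V, \<psi>) \<in> \<A>" "\<And>z. z \<in> D \<Longrightarrow> \<pi> z \<in> V"
  shows "\<exists>B. mdet B = 1 \<and> (\<forall>w\<in>D. \<psi> (\<pi> w) = moebius B w)"
proof -
  have loc: "\<exists>B N. mdet B = 1 \<and> open N \<and> z \<in> N \<and> N \<subseteq> D \<and> (\<forall>w\<in>N. \<psi> (\<pi> w) = moebius B w)" if z: "z \<in> D" for z
  proof -
    obtain B N where "mdet B = 1" "open N" "z \<in> N" "\<forall>w\<in>N. \<psi> (\<pi> w) = moebius B w"
      using dev_at_chart[OF dev[OF z] V(1) V(2)[OF z]] by blast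
    then show ?thesis using D(1) z by (intro exI[of _ B] exI[of _ "N \<inter> D"]) auto
  qed
  obtain z0 where z0: "z0 \<in> D" using D(3) by blast
  obtain B N0 where B: "mdet B = 1" "open N0" "z0 \<in> N0" "N0 \<subseteq> D" "\<forall>w\<in>N0. \<psi> (\<pi> w) = moebius B w"
    using loc[OF z0] by blast
  define G where "G = \<Union>{N. open N \<and> N \<subseteq> D \<and> (\<forall>w\<in>N. \<psi> (\<pi> w) = moebius B w)}"
  define H where "H = \<Union>{N. open N \<and> N \<subseteq> D \<and> N \<inter> G = {}}"
  have "D \<subseteq> G \<union> H"
  proof
    fix z assume "z \<in> D"
    then obtain C N where C: "mdet C = 1" "open N" "z \<in> N" "N \<subseteq> D" "\<forall>w\<in>N. \<psi> (\<pi> w) = moebius C w"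
      using loc by blast
    show "z \<in> G \<union> H"
    proof (cases "N \<inter> G = {}")
      case True
      then show ?thesis unfolding H_def using C by blast
    next
      case False
      then obtain N' where N': "open N'" "N' \<subseteq> D" "\<forall>w\<in>N'. \<psi> (\<pi> w) = moebius B w" "N \<inter> N' \<noteq> {}"
        unfolding G_def by blast
      have "N \<inter> N' \<subseteq> upper_half_plane" using N'(2) dev dev_at_upper unfolding upper_half_plane_def by blast
      then have "moebius C = moebius B"
        by (rule moebius_eq_on_open[OF C(1) B(1) open_Int[OF C(2) N'(1)] N'(4)]) (use C(5) N'(3) in auto)
      then show ?thesis unfolding G_def using C by auto
    qed
  qed
  moreover have "open G" "open H" unfolding G_def H_def by auto
  moreover have "G \<inter> H \<inter> D = {}" unfolding H_def by blast
  moreover have "G \<inter> D \<noteq> {}" unfolding G_def using B z0 by blast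
  ultimately have "H \<inter> D = {}" using connectedD[OF D(2), of G H] by blast
  then have "D \<subseteq> G" using \<open>D \<subseteq> G \<union> H\<close> by blast
  then show ?thesis using B(1) unfolding G_def by blast
qed

text \<open>Uniqueness of continuation. The set of points near which both maps agree is open; it is
  also closed, because at a limit point both are Moebius maps in a common chart and coincide on an
  open set.\<close>

lemma dev_unique:
  assumes D: "open D" "connected D" and dev: "\<And>z. z \<in> D \<Longrightarrow> dev_at \<pi> z" "\<And>z. z \<in> D \<Longrightarrow> dev_at \<pi>' z"
    and M: "open M" "M \<noteq> {}" "M \<subseteq> D" "\<And>w. w \<in> M \<Longrightarrow> \<pi> w = \<pi>' w" and z: "z \<in> D"
  shows "\<pi> z = \<pi>' z"
proof -
  define G where "G = \<Union>{N. open N \<and> N \<subseteq> D \<and> (\<forall>w\<in>N. \<pi> w = \<pi>' w)}"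
  define H where "H = \<Union>{N. open N \<and> N \<subseteq> D \<and> N \<inter> G = {}}"
  have "D \<subseteq> G \<union> H"
  proof
    fix z assume zD: "z \<in> D"
    show "z \<in> G \<union> H"
    proof (cases "\<pi> z = \<pi>' z")
      case False
      have "((\<lambda>w. dist (\<pi> w) (\<pi>' w)) \<longlongrightarrow> dist (\<pi> z) (\<pi>' z)) (at z)"
        using dev_at_continuous[OF dev(1)[OF zD]] dev_at_continuous[OF dev(2)[OF zD]]
        unfolding isCont_def by (rule tendsto_dist)
      then have "\<forall>\<^sub>F w in at z. 0 < dist (\<pi> w) (\<pi>' w)"
        using False by (intro order_tendstoD(1)) auto
      then have "\<forall>\<^sub>F w in nhds z. \<pi> w \<noteq> \<pi>' w"
        unfolding eventually_at_filter using False by (auto elim!: eventually_mono)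
      then obtain N where "open N" "z \<in> N" "\<forall>w\<in>N. \<pi> w \<noteq> \<pi>' w" unfolding eventually_nhds by blast
      then have "open (N \<inter> D)" "z \<in> N \<inter> D" "(N \<inter> D) \<inter> G = {}" unfolding G_def using D(1) zD by auto
      then show ?thesis unfolding H_def by blast
    next
      case True
      obtain V \<psi> where V: "(V, \<psi>) \<in> \<A>" "\<pi> z \<in> V" using chart_exists by blast
      obtain B N where B: "mdet B = 1" "open N" "z \<in> N" "\<And>w. w \<in> N \<Longrightarrow> \<pi> w \<in> V \<and> \<psi> (\<pi> w) = moebius B w"
        using dev_at_chart[OF dev(1)[OF zD] V] by blast
      obtain B' N' where B': "mdet B' = 1" "open N'" "z \<in> N'" "\<And>w. w \<in> N' \<Longrightarrow> \<pi>' w \<in> V \<and> \<psi> (\<pi>' w) = moebius B' w"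
        using dev_at_chart[OF dev(2)[OF zD] V(1)] V(2) True by auto
      let ?N = "N \<inter> N' \<inter> D"
      have N: "open ?N" "z \<in> ?N" "?N \<subseteq> D" using B B' D(1) zD by auto
      show ?thesis
      proof (cases "?N \<inter> G = {}")
        case True
        then show ?thesis unfolding H_def using N by blast
      next
        case False
        then obtain N1 where N1: "open N1" "N1 \<subseteq> D" "\<forall>w\<in>N1. \<pi> w = \<pi>' w" "?N \<inter> N1 \<noteq> {}"
          unfolding G_def by blast
        have up: "?N \<inter> N1 \<subseteq> upper_half_plane" using dev(1) dev_at_upper unfolding upper_half_plane_def by blast
        have "moebius B w = moebius B' w" if w: "w \<in> ?N \<inter> N1" for w
          using B(4)[of w] B'(4)[of w] N1(3) w by auto
        then have "moebius B = moebius B'"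
          using moebius_eq_on_open[OF B(1) B'(1) _ N1(4) up] N(1) N1(1) by blast
        then have "\<psi> (\<pi> w) = \<psi> (\<pi>' w)" if "w \<in> ?N" for w using B(4)[of w] B'(4)[of w] that by auto
        then have "\<pi> w = \<pi>' w" if "w \<in> ?N" for w
          using inj_onD[OF chart_inj[OF V(1)]] B(4)[of w] B'(4)[of w] that by blast
        then show ?thesis unfolding G_def using N by blast
      qed
    qed
  qed
  moreover have "open G" "open H" unfolding G_def H_def by auto
  moreover have "G \<inter> H \<inter> D = {}" unfolding H_def by blast
  moreover have "G \<inter> D \<noteq> {}" unfolding G_def using M by blast
  ultimately have "H \<inter> D = {}" using connectedD[OF D(2), of G H] by blast
  then have "D \<subseteq> G" using \<open>D \<subseteq> G \<union> H\<close> by blast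
  then show ?thesis using z unfolding G_def by blast
qed

text \<open>A local isometry does not increase length along a segment, and on the segment the
  hyperbolic length is at most the Euclidean length divided by m. \<open>Bolzano\<close> glues the
  local estimates.\<close>

lemma dev_lipschitz:
  assumes D: "convex D" and m: "0 < m" "\<And>z. z \<in> D \<Longrightarrow> m \<le> Im z"
    and dev: "\<And>z. z \<in> D \<Longrightarrow> dev_at \<pi> z" and zw: "z \<in> D" "w \<in> D"
  shows "dist (\<pi> z) (\<pi> w) \<le> dist z w / m"
proof -
  define \<gamma> where "\<gamma> t = (1 - t) *\<^sub>R z + t *\<^sub>R w" for t :: real
  have \<gamma>D: "\<gamma> t \<in> D" if "0 \<le> t" "t \<le> 1" for t
    unfolding \<gamma>_def using convexD_alt[OF D zw that] .
  define P where "P a b \<longleftrightarrow> (0 \<le> a \<longrightarrow> b \<le> 1 \<longrightarrow> dist (\<pi> (\<gamma> a)) (\<pi> (\<gamma> b)) \<le> (b - a) * (dist z w / m))" for a b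
  have "P 0 1"
  proof (rule Bolzano)
    fix a b c assume P: "P a b" "P b c" and ab: "a \<le> b" "b \<le> c"
    show "P a c" unfolding P_def
    proof (intro impI)
      assume ac: "0 \<le> a" "c \<le> 1"
      have "dist (\<pi> (\<gamma> a)) (\<pi> (\<gamma> c)) \<le> dist (\<pi> (\<gamma> a)) (\<pi> (\<gamma> b)) + dist (\<pi> (\<gamma> b)) (\<pi> (\<gamma> c))"
        by (rule dist_triangle)
      also have "\<dots> \<le> (b - a) * (dist z w / m) + (c - b) * (dist z w / m)"
        using P ab ac unfolding P_def by (intro add_mono) auto
      also have "\<dots> = (c - a) * (dist z w / m)" by (simp only: distrib_right[symmetric]) simp
      finally show "dist (\<pi> (\<gamma> a)) (\<pi> (\<gamma> c)) \<le> (c - a) * (dist z w / m)" .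
    qed
  next
    fix x :: real assume x: "0 \<le> x" "x \<le> 1"
    obtain N where N: "open N" "\<gamma> x \<in> N" "\<And>u v. u \<in> N \<Longrightarrow> v \<in> N \<Longrightarrow> dist (\<pi> u) (\<pi> v) = hyp_dist u v"
      using dev_at_dist[OF dev[OF \<gamma>D[OF x]]] by blast
    have "isCont \<gamma> x" unfolding \<gamma>_def by (intro continuous_intros)
    then have "\<forall>\<^sub>F t in nhds x. \<gamma> t \<in> N"
      using N(1,2) by (intro isCont_eventually_mem)
    then obtain \<delta> where \<delta>: "0 < \<delta>" "\<And>t. dist t x < \<delta> \<Longrightarrow> \<gamma> t \<in> N"
      unfolding eventually_nhds_metric by blast
    have "P a b" if ab: "a \<le> x" "x \<le> b" "b - a < \<delta>" for a b
      unfolding P_def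
    proof (intro impI)
      assume 01: "0 \<le> a" "b \<le> 1"
      have "dist (\<pi> (\<gamma> a)) (\<pi> (\<gamma> b)) = hyp_dist (\<gamma> a) (\<gamma> b)"
        using ab by (intro N(3) \<delta>(2)) (auto simp: dist_real_def)
      also have "\<dots> \<le> cmod (\<gamma> a - \<gamma> b) / m"
        using \<gamma>D[of a] \<gamma>D[of b] 01 ab by (intro hyp_dist_le m) auto
      also have "\<gamma> a - \<gamma> b = (b - a) *\<^sub>R (z - w)" unfolding \<gamma>_def by (simp add: algebra_simps)
      finally show "dist (\<pi> (\<gamma> a)) (\<pi> (\<gamma> b)) \<le> (b - a) * (dist z w / m)"
        using ab by (simp add: dist_norm)
    qed
    then show "\<exists>d>0. \<forall>a b. a \<le> x \<and> x \<le> b \<and> b - a < d \<longrightarrow> P a b" using \<delta>(1) by blast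
  qed simp
  then show ?thesis unfolding P_def \<gamma>_def by simp
qed

end

section \<open>The developing map\<close>

text \<open>The open ball with centre \<open>\<i>\<close> and radius \<open>arcosh c\<close> in the hyperbolic metric.\<close>

definition hball :: "real \<Rightarrow> complex set" where "hball c = {z. (cmod z)\<^sup>2 + 1 < 2 * c * Im z}"

text \<open>Completing the square shows that hyperbolic balls about \<i> are Euclidean ones with a
  shifted centre, so the extension argument can use ordinary balls and spheres.\<close>

lemma hball_eq_ball: "1 < c \<Longrightarrow> hball c = ball (\<i> * of_real c) (sqrt (c\<^sup>2 - 1))"
  and hcball_eq_cball: "1 < c \<Longrightarrow> {z. (cmod z)\<^sup>2 + 1 \<le> 2 * c * Im z} = cball (\<i> * of_real c) (sqrt (c\<^sup>2 - 1))"
proof -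
  assume c: "1 < c"
  then have c2: "0 \<le> c\<^sup>2 - 1" by simp
  have n: "(dist (\<i> * of_real c) z)\<^sup>2 = (cmod z)\<^sup>2 - 2 * c * Im z + c\<^sup>2" for z
    unfolding dist_norm cmod_power2 by (simp add: power2_eq_square algebra_simps)
  have "dist (\<i> * of_real c) z < sqrt (c\<^sup>2 - 1) \<longleftrightarrow> (dist (\<i> * of_real c) z)\<^sup>2 < c\<^sup>2 - 1" for z
    using c2 by (metis real_less_rsqrt real_sqrt_less_iff real_sqrt_unique zero_le_dist)
  then show "hball c = ball (\<i> * of_real c) (sqrt (c\<^sup>2 - 1))"
    unfolding hball_def using n by (auto simp: algebra_simps)
  have "dist (\<i> * of_real c) z \<le> sqrt (c\<^sup>2 - 1) \<longleftrightarrow> (dist (\<i> * of_real c) z)\<^sup>2 \<le> c\<^sup>2 - 1" for z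
    using c2 by (metis real_le_rsqrt real_sqrt_le_iff real_sqrt_unique zero_le_dist)
  then show "{z. (cmod z)\<^sup>2 + 1 \<le> 2 * c * Im z} = cball (\<i> * of_real c) (sqrt (c\<^sup>2 - 1))"
    using n by (auto simp: algebra_simps)
qed

lemma hcball_upper: "1 < c \<Longrightarrow> {z. (cmod z)\<^sup>2 + 1 \<le> 2 * c * Im z} \<subseteq> upper_half_plane"
  unfolding upper_half_plane_def
proof clarify
  fix z assume "1 < c" "(cmod z)\<^sup>2 + 1 \<le> 2 * c * Im z"
  then have "0 < 2 * c * Im z" using zero_le_power2[of "cmod z"] by linarith
  then show "0 < Im z" using \<open>1 < c\<close> by (simp add: zero_less_mult_iff)
qed

lemma hball_mono: "1 < c \<Longrightarrow> c \<le> c' \<Longrightarrow> hball c \<subseteq> hball c'"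
proof
  fix z assume c: "1 < c" "c \<le> c'" and z: "z \<in> hball c"
  then have "0 < Im z" using hcball_upper[of c] unfolding hball_def upper_half_plane_def by force
  then have "2 * c * Im z \<le> 2 * c' * Im z" using c by simp
  then show "z \<in> hball c'" using z unfolding hball_def by simp
qed

lemma hball_props:
  assumes "1 < c"
  shows "open (hball c)" "connected (hball c)" "hball c \<subseteq> upper_half_plane" "\<i> \<in> hball c"
proof -
  show "open (hball c)" "connected (hball c)" unfolding hball_eq_ball[OF assms] by auto
  show "hball c \<subseteq> upper_half_plane" using hcball_upper[OF assms] unfolding hball_def by force
  show "\<i> \<in> hball c" using assms unfolding hball_def by simp
qed

lemma upper_half_plane_hball: "0 < Im z \<Longrightarrow> \<exists>c>1. z \<in> hball c"
proof -
  assume z: "0 < Im z"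
  define c where "c = ((cmod z)\<^sup>2 + 1) / (2 * Im z) + 1 + 1"
  have "0 \<le> ((cmod z)\<^sup>2 + 1) / (2 * Im z)" using z by simp
  then have "1 < c" unfolding c_def by linarith
  moreover have "2 * c * Im z = (cmod z)\<^sup>2 + 1 + 4 * Im z" using z unfolding c_def by (simp add: field_simps)
  ultimately show ?thesis using z unfolding hball_def by (intro exI[of _ c]) simp
qed

text \<open>The function \<open>h\<close> is cosh of the distance from \<i>. On the compact part of
  a larger ball outside \<Omega> it attains its minimum, which exceeds c and leaves room for a
  bigger radius.\<close>

lemma hball_in_open:
  assumes c: "1 < c" and \<Omega>: "open \<Omega>" "{z. (cmod z)\<^sup>2 + 1 \<le> 2 * c * Im z} \<subseteq> \<Omega>"
  shows "\<exists>c'>c. hball c' \<subseteq> \<Omega>"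
proof -
  define K where "K = {z. (cmod z)\<^sup>2 + 1 \<le> 2 * (c + 1) * Im z} - \<Omega>"
  define h where "h z = ((cmod z)\<^sup>2 + 1) / (2 * Im z)" for z
  have c1: "1 < c + 1" using c by simp
  have K: "compact K" unfolding K_def hcball_eq_cball[OF c1] using \<Omega>(1) by (intro compact_diff) auto
  have up: "0 < Im z" if "z \<in> K" for z using hcball_upper[OF c1] that unfolding K_def upper_half_plane_def by blast
  have cont: "continuous_on K h" unfolding h_def using up by (intro continuous_intros) force+
  have gt: "c < h z" if "z \<in> K" for z
  proof -
    have "\<not> (cmod z)\<^sup>2 + 1 \<le> 2 * c * Im z" using \<Omega>(2) that unfolding K_def by blast
    then show ?thesis using up[OF that] unfolding h_def by (simp add: pos_less_divide_eq mult.assoc mult.left_commute)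
  qed
  obtain c' where c': "c < c'" "c' \<le> c + 1" "\<And>z. z \<in> K \<Longrightarrow> c' \<le> h z"
  proof (cases "K = {}")
    case True
    then show ?thesis using that[of "c + 1"] by simp
  next
    case False
    then obtain z0 where "z0 \<in> K" "\<And>z. z \<in> K \<Longrightarrow> h z0 \<le> h z" using continuous_attains_inf[OF K False cont] by blast
    then show ?thesis using that[of "min (c + 1) (h z0)"] gt[of z0] by (simp add: min.coboundedI2)
  qed
  have "hball c' \<subseteq> \<Omega>"
  proof
    fix z assume z: "z \<in> hball c'"
    have "1 < c'" using c c' by simp
    then have Imz: "0 < Im z" using hball_props(3) z unfolding upper_half_plane_def by blast
    have "h z < c'" using z Imz unfolding hball_def h_def by (simp add: pos_divide_less_eq mult.assoc mult.left_commute)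
    then have "z \<notin> K" using c'(3) by fastforce
    moreover have "z \<in> hball (c + 1)" using hball_mono[of c' "c + 1"] c' \<open>1 < c'\<close> z by blast
    ultimately show "z \<in> \<Omega>" unfolding K_def hball_def by auto
  qed
  then show ?thesis using c'(1) by blast
qed

locale complete_hyperbolic_atlas = hyperbolic_atlas +
  assumes complete_surface: "complete (UNIV :: 'a set)"
begin

text \<open>The only use of completeness: the Lipschitz map sends a radial sequence to a Cauchy
  sequence, whose limit lies in some chart. In that chart the map is already a single Moebius map
  near z, and this formula continues across the sphere.\<close>

lemma dev_extend_boundary:
  assumes R: "0 < R" "cball c R \<subseteq> upper_half_plane" and dev: "\<And>w. w \<in> ball c R \<Longrightarrow> dev_at \<pi> w"
    and z: "z \<in> sphere c R"
  shows "\<exists>\<delta>>0. \<exists>u. ball z \<delta> \<subseteq> upper_half_plane \<and> (\<forall>w\<in>ball z \<delta>. dev_at u w) \<and>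
    (\<forall>w\<in>ball z \<delta> \<inter> ball c R. u w = \<pi> w)"
proof -
  obtain z1 where z1: "z1 \<in> cball c R" "\<And>w. w \<in> cball c R \<Longrightarrow> Im z1 \<le> Im w"
    using continuous_attains_inf[of "cball c R" Im] R(1) continuous_on_Im[OF continuous_on_id, of "cball c R"]
    by (auto simp: id_def)
  define m where "m = Im z1"
  have m: "0 < m" using z1(1) R(2) unfolding m_def upper_half_plane_def by auto
  have lip: "dist (\<pi> w) (\<pi> w') \<le> dist w w' / m" if "w \<in> ball c R" "w' \<in> ball c R" for w w'
  proof (rule dev_lipschitz[OF convex_ball m _ dev that])
    fix v assume "v \<in> ball c R"
    then show "m \<le> Im v" using z1(2)[of v] unfolding m_def by auto
  qed
  define r where "r n = inverse (real (Suc n)) / 2" for n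
  have r: "0 < r n" "r n < 1" for n unfolding r_def by (auto simp: field_simps)
  define s where "s n = z + r n *\<^sub>R (c - z)" for n
  have s_lim: "s \<longlonglongrightarrow> z"
  proof -
    have "(\<lambda>n. inverse (real (Suc n)) / 2) \<longlonglongrightarrow> 0 / 2" by (intro tendsto_intros LIMSEQ_inverse_real_of_nat) auto
    then have "r \<longlonglongrightarrow> 0" unfolding r_def by simp
    then have "s \<longlonglongrightarrow> z + 0 *\<^sub>R (c - z)" unfolding s_def by (intro tendsto_intros)
    then show ?thesis by simp
  qed
  have s_ball: "s n \<in> ball c R" for n
  proof -
    have "c - s n = (1 - r n) *\<^sub>R (c - z)" unfolding s_def by (simp add: algebra_simps)
    then have "dist c (s n) = \<bar>1 - r n\<bar> * R" using z by (simp add: dist_norm)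
    also have "\<dots> < 1 * R" using R(1) r[of n] by (intro mult_strict_right_mono) auto
    finally show ?thesis by simp
  qed
  have "Cauchy (\<lambda>n. \<pi> (s n))"
  proof (rule metric_CauchyI)
    fix e :: real assume e: "0 < e"
    have "Cauchy s" using s_lim LIMSEQ_imp_Cauchy by blast
    then obtain M where M: "\<And>k n. k \<ge> M \<Longrightarrow> n \<ge> M \<Longrightarrow> dist (s k) (s n) < e * m"
      using metric_CauchyD[of s "e * m"] e m by auto
    have "dist (\<pi> (s k)) (\<pi> (s n)) < e" if "k \<ge> M" "n \<ge> M" for k n
      using lip[OF s_ball s_ball, of k n] M[OF that] m by (smt (verit) pos_divide_less_eq)
    then show "\<exists>M. \<forall>k\<ge>M. \<forall>n\<ge>M. dist (\<pi> (s k)) (\<pi> (s n)) < e" by blast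
  qed
  then obtain y where y: "(\<lambda>n. \<pi> (s n)) \<longlonglongrightarrow> y"
    using complete_surface unfolding complete_def by blast
  \<comment> \<open>Controls all interior points near z, not just the radial sequence, so that a
    whole piece of the ball is mapped into the chart.\<close>
  have near: "dist (\<pi> w) y \<le> dist w z / m" if w: "w \<in> ball c R" for w
  proof (rule LIMSEQ_le)
    show "(\<lambda>n. dist (\<pi> w) (\<pi> (s n))) \<longlonglongrightarrow> dist (\<pi> w) y" by (intro tendsto_intros y)
    show "(\<lambda>n. dist w (s n) / m) \<longlonglongrightarrow> dist w z / m" using m by (intro tendsto_intros s_lim) auto
  qed (use lip[OF w s_ball] in blast)
  obtain V \<psi> where V: "(V, \<psi>) \<in> \<A>" "y \<in> V" using chart_exists by blast
  obtain \<epsilon> where \<epsilon>: "0 < \<epsilon>" "ball y \<epsilon> \<subseteq> V" using chart_open[OF V(1)] V(2) openE by blast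
  define E where "E = ball z (\<epsilon> * m) \<inter> ball c R"
  have E_V: "\<pi> w \<in> V" if "w \<in> E" for w
  proof -
    have "dist (\<pi> w) y \<le> dist w z / m" using near that unfolding E_def by blast
    also have "\<dots> < \<epsilon>" using that m unfolding E_def by (simp add: pos_divide_less_eq dist_commute)
    finally show ?thesis using \<epsilon>(2) by (auto simp: dist_commute)
  qed
  have s_E: "\<forall>\<^sub>F n in sequentially. s n \<in> E"
  proof -
    have "\<forall>\<^sub>F n in sequentially. dist (s n) z < \<epsilon> * m" using s_lim \<epsilon>(1) m by (simp add: tendsto_iff)
    then show ?thesis unfolding E_def by eventually_elim (use s_ball in \<open>auto simp: dist_commute\<close>)
  qed
  then have "E \<noteq> {}" using eventually_happens'[OF sequentially_bot] by blast
  moreover have "open E" "connected E" unfolding E_def by (auto intro: convex_connected convex_Int)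
  ultimately obtain B where B: "mdet B = 1" "\<And>w. w \<in> E \<Longrightarrow> \<psi> (\<pi> w) = moebius B w"
    using dev_chart_moebius[of E \<pi> V \<psi>] dev V(1) E_V unfolding E_def by blast
  have zu: "z \<in> upper_half_plane" using R(2) z by auto
  have "(\<lambda>n. \<psi> (\<pi> (s n))) \<longlonglongrightarrow> \<psi> y"
    using chart_continuous[OF V(1)] V(2) unfolding continuous_on_eq_continuous_at[OF chart_open[OF V(1)]]
    by (intro isCont_tendsto_compose[OF _ y]) blast
  moreover have "\<forall>\<^sub>F n in sequentially. \<psi> (\<pi> (s n)) = moebius B (s n)"
    using s_E by eventually_elim (rule B(2))
  ultimately have "(\<lambda>n. moebius B (s n)) \<longlonglongrightarrow> \<psi> y" by (rule Lim_transform_eventually)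
  moreover have "(\<lambda>n. moebius B (s n)) \<longlonglongrightarrow> moebius B z"
    using continuous_on_moebius[OF B(1)] zu unfolding continuous_on_eq_continuous_at[OF open_upper_half_plane]
    by (intro isCont_tendsto_compose[OF _ s_lim]) blast
  \<comment> \<open>Both limits along the radius coincide, so z itself lies in the open domain of
    the inverse chart composed with \<open>B\<close>.\<close>
  ultimately have "moebius B z = \<psi> y" using LIMSEQ_unique by blast
  then have Bz: "moebius B z \<in> \<psi> ` V" using V(2) by auto
  obtain N where N: "open N" "N = {w \<in> upper_half_plane. moebius B w \<in> \<psi> ` V}"
    "\<And>w. w \<in> N \<Longrightarrow> dev_at (\<lambda>w. inv_into V \<psi> (moebius B w)) w"
    using dev_at_inverse_chart[OF V(1) B(1)] by blast
  have "z \<in> N" using N(2) zu Bz by blast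
  then obtain \<delta> where \<delta>: "0 < \<delta>" "ball z \<delta> \<subseteq> N" using N(1) openE by blast
  let ?\<delta> = "min \<delta> (\<epsilon> * m)"
  show ?thesis
  proof (intro exI[of _ ?\<delta>] conjI exI[of _ "\<lambda>w. inv_into V \<psi> (moebius B w)"] ballI)
    show "0 < ?\<delta>" using \<delta>(1) \<epsilon>(1) m by simp
    show "ball z ?\<delta> \<subseteq> upper_half_plane" using \<delta>(2) N(2) by auto
    show "dev_at (\<lambda>w. inv_into V \<psi> (moebius B w)) w" if "w \<in> ball z ?\<delta>" for w
      using N(3) \<delta>(2) that by auto
    show "inv_into V \<psi> (moebius B w) = \<pi> w" if w: "w \<in> ball z ?\<delta> \<inter> ball c R" for w
    proof -
      have "w \<in> E" using w unfolding E_def by auto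
      then show ?thesis using B(2)[of w] E_V[of w] inv_into_f_f[OF chart_inj[OF V(1)]] by metis
    qed
  qed
qed

text \<open>The local extensions are consistent: overlapping discs centred on the sphere also meet
  inside the ball, where each extension equals \<open>\<pi>\<close>, and their overlap is
  connected.\<close>

lemma dev_extend_cball:
  assumes R: "0 < R" "cball c R \<subseteq> upper_half_plane" and dev: "\<And>w. w \<in> ball c R \<Longrightarrow> dev_at \<pi> w"
  shows "\<exists>\<Omega> \<pi>'. open \<Omega> \<and> cball c R \<subseteq> \<Omega> \<and> (\<forall>w\<in>\<Omega>. dev_at \<pi>' w) \<and> (\<forall>w\<in>ball c R. \<pi>' w = \<pi> w)"
proof -
  have "\<exists>\<delta> u. 0 < \<delta> \<and> ball z \<delta> \<subseteq> upper_half_plane \<and> (\<forall>w\<in>ball z \<delta>. dev_at u w) \<and>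
    (\<forall>w\<in>ball z \<delta> \<inter> ball c R. u w = \<pi> w)" if "z \<in> sphere c R" for z
    using dev_extend_boundary[OF R dev that] by blast
  then obtain \<delta> u where \<delta>: "\<And>z. z \<in> sphere c R \<Longrightarrow> 0 < \<delta> z"
    and u: "\<And>z w. z \<in> sphere c R \<Longrightarrow> w \<in> ball z (\<delta> z) \<Longrightarrow> dev_at (u z) w"
      "\<And>z w. z \<in> sphere c R \<Longrightarrow> w \<in> ball z (\<delta> z) \<Longrightarrow> w \<in> ball c R \<Longrightarrow> u z w = \<pi> w"
    by (metis Int_iff)
  have agree: "u z w = u z' w" if z: "z \<in> sphere c R" "z' \<in> sphere c R" and w: "w \<in> ball z (\<delta> z)" "w \<in> ball z' (\<delta> z')" for z z' w
  proof (cases "z = z'")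
    case False
    let ?D = "ball z (\<delta> z) \<inter> ball z' (\<delta> z')"
    \<comment> \<open>Divides the segment between the centres in the ratio of the radii, so the
      point lies in both discs; strict convexity puts it inside the ball.\<close>
    define a where "a = \<delta> z / (\<delta> z + \<delta> z')"
    define p where "p = (1 - a) *\<^sub>R z + a *\<^sub>R z'"
    have d: "0 < \<delta> z" "0 < \<delta> z'" using \<delta> z by auto
    then have a: "0 < a" "a < 1" unfolding a_def by auto
    have dzz: "dist z z' < \<delta> z + \<delta> z'" using w dist_triangle_less_add[of z w "\<delta> z" z' "\<delta> z'"] by (auto simp: dist_commute)
    have "z - p = a *\<^sub>R (z - z')" "z' - p = (1 - a) *\<^sub>R (z' - z)" unfolding p_def by (simp_all add: algebra_simps)
    then have "dist z p = a * dist z z'" "dist z' p = (1 - a) * dist z z'"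
      using a by (simp_all add: dist_norm norm_minus_commute)
    moreover have "a * dist z z' < \<delta> z" "(1 - a) * dist z z' < \<delta> z'"
    proof -
      have "a * dist z z' < a * (\<delta> z + \<delta> z')" "(1 - a) * dist z z' < (1 - a) * (\<delta> z + \<delta> z')"
        using a dzz by auto
      moreover have "a * (\<delta> z + \<delta> z') = \<delta> z" unfolding a_def using d by simp
      moreover have "(1 - a) * (\<delta> z + \<delta> z') = \<delta> z'" using \<open>a * (\<delta> z + \<delta> z') = \<delta> z\<close> by (simp add: algebra_simps)
      ultimately show "a * dist z z' < \<delta> z" "(1 - a) * dist z z' < \<delta> z'" by simp_all
    qed
    moreover have "p \<in> open_segment z z'" unfolding p_def in_segment using False a by blast
    then have "dist c p < dist c z \<or> dist c p < dist c z'" by (rule dist_decreases_open_segment)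
    then have "p \<in> ball c R" using z by auto
    ultimately have p: "p \<in> ?D \<inter> ball c R" by simp
    show ?thesis
    proof (rule dev_unique[of ?D _ _ "?D \<inter> ball c R"])
      show "connected ?D" by (intro convex_connected convex_Int convex_ball)
      show "?D \<inter> ball c R \<noteq> {}" using p by blast
      show "u z v = u z' v" if "v \<in> ?D \<inter> ball c R" for v using u(2)[OF z(1)] u(2)[OF z(2)] that by auto
    qed (use u(1) z w in auto)
  qed simp
  define \<Omega> where "\<Omega> = ball c R \<union> (\<Union>z\<in>sphere c R. ball z (\<delta> z))"
  define \<pi>' where "\<pi>' w = (if w \<in> ball c R then \<pi> w else u (SOME z. z \<in> sphere c R \<and> w \<in> ball z (\<delta> z)) w)" for w
  have \<pi>'_eq: "\<pi>' w = u z w" if zw: "z \<in> sphere c R" "w \<in> ball z (\<delta> z)" for z w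
  proof (cases "w \<in> ball c R")
    case True
    then show ?thesis unfolding \<pi>'_def using u(2)[OF zw] by simp
  next
    case False
    let ?z = "SOME z. z \<in> sphere c R \<and> w \<in> ball z (\<delta> z)"
    have "?z \<in> sphere c R \<and> w \<in> ball ?z (\<delta> ?z)" by (rule someI[of _ z]) (use zw in blast)
    then show ?thesis unfolding \<pi>'_def using False agree[of ?z z w] zw by auto
  qed
  show ?thesis
  proof (intro exI[of _ \<Omega>] exI[of _ \<pi>'] conjI ballI)
    show "open \<Omega>" unfolding \<Omega>_def by auto
    show "cball c R \<subseteq> \<Omega>"
    proof
      fix w assume w: "w \<in> cball c R"
      show "w \<in> \<Omega>"
      proof (cases "w \<in> ball c R")
        case False
        then have "w \<in> sphere c R" using w by auto
        then have "w \<in> ball w (\<delta> w)" "w \<in> sphere c R" using \<delta> by auto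
        then show ?thesis unfolding \<Omega>_def by blast
      qed (simp add: \<Omega>_def)
    qed
    show "\<pi>' w = \<pi> w" if "w \<in> ball c R" for w using that unfolding \<pi>'_def by simp
    show "dev_at \<pi>' w" if "w \<in> \<Omega>" for w
    proof (cases "w \<in> ball c R")
      case True
      then show ?thesis
        by (intro dev_at_cong[OF dev open_ball]) (auto simp: \<pi>'_def)
    next
      case False
      then obtain z where "z \<in> sphere c R" "w \<in> ball z (\<delta> z)" using \<open>w \<in> \<Omega>\<close> unfolding \<Omega>_def by blast
      then show ?thesis by (intro dev_at_cong[OF u(1) open_ball]) (auto simp: \<pi>'_eq)
    qed
  qed
qed

text \<open>Continuation over growing balls about \<i>: if the admissible radii were bounded, the
  maps would glue to one on the ball of supremal radius, which \<open>dev_extend_cball\<close> and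
  \<open>hball_in_open\<close> then enlarge.\<close>

theorem dev_exists:
  assumes u: "open M" "\<i> \<in> M" "\<And>w. w \<in> M \<Longrightarrow> dev_at u w"
  shows "\<exists>\<pi>. (\<forall>z. 0 < Im z \<longrightarrow> dev_at \<pi> z) \<and> (\<forall>\<^sub>F w in nhds \<i>. \<pi> w = u w)"
proof -
  \<comment> \<open>The prescribed germ at \<i> makes any two admissible maps agree on the smaller
    of their balls, so arbitrary choices glue.\<close>
  define good where "good c \<pi> \<longleftrightarrow> 1 < c \<and> (\<forall>w\<in>hball c. dev_at \<pi> w) \<and> (\<forall>\<^sub>F w in nhds \<i>. \<pi> w = u w)" for c \<pi>
  define S where "S = {c. \<exists>\<pi>. good c \<pi>}"
  have agree: "\<pi> w = \<pi>' w" if g: "good c \<pi>" "good c' \<pi>'" and le: "c \<le> c'" and w: "w \<in> hball c" for c c' \<pi> \<pi>' w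
  proof -
    have c: "1 < c" using g unfolding good_def by blast
    have "\<forall>\<^sub>F w in nhds \<i>. \<pi> w = u w" "\<forall>\<^sub>F w in nhds \<i>. \<pi>' w = u w" using g unfolding good_def by auto
    then have "\<forall>\<^sub>F w in nhds \<i>. \<pi> w = \<pi>' w" by eventually_elim simp
    then obtain N where N: "open N" "\<i> \<in> N" "\<forall>w\<in>N. \<pi> w = \<pi>' w" unfolding eventually_nhds by blast
    show ?thesis
    proof (rule dev_unique[of "hball c" _ _ "N \<inter> hball c"])
      show "dev_at \<pi>' z" if "z \<in> hball c" for z using hball_mono[OF c le] that g(2) unfolding good_def by blast
    qed (use hball_props[OF c] N g(1) w in \<open>auto simp: good_def\<close>)
  qed
  have agree': "\<pi> w = \<pi>' w" if "good c \<pi>" "good c' \<pi>'" "w \<in> hball c" "w \<in> hball c'" for c c' \<pi> \<pi>' w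
    using agree[of c \<pi> c' \<pi>' w] agree[of c' \<pi>' c \<pi> w] that by (cases "c \<le> c'") auto
  define \<Phi> where "\<Phi> c = (SOME \<pi>. good c \<pi>)" for c
  have \<Phi>: "good c (\<Phi> c)" if "c \<in> S" for c
  proof -
    have "\<exists>\<pi>. good c \<pi>" using that unfolding S_def by simp
    then show ?thesis unfolding \<Phi>_def by (rule someI_ex)
  qed
  define \<pi> where "\<pi> w = \<Phi> (SOME c. c \<in> S \<and> w \<in> hball c) w" for w
  have \<pi>_eq: "\<pi> w = \<Phi> c w" if "c \<in> S" "w \<in> hball c" for c w
  proof -
    let ?c = "SOME c. c \<in> S \<and> w \<in> hball c"
    have "?c \<in> S \<and> w \<in> hball ?c" by (rule someI[of _ c]) (use that in blast)
    then show ?thesis unfolding \<pi>_def using agree'[OF \<Phi> \<Phi>, of ?c c w] that by auto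
  qed
  have \<pi>_dev: "dev_at \<pi> w" if "c \<in> S" "w \<in> hball c" for c w
  proof (rule dev_at_cong[of "\<Phi> c" _ "hball c"])
    show "dev_at (\<Phi> c) w" "open (hball c)" using \<Phi>[OF that(1)] that(2) hball_props unfolding good_def by auto
  qed (use that \<pi>_eq in auto)
  have \<pi>_germ: "\<forall>\<^sub>F w in nhds \<i>. \<pi> w = u w" if c: "c \<in> S" for c
  proof -
    have c1: "1 < c" "\<forall>\<^sub>F w in nhds \<i>. \<Phi> c w = u w" using \<Phi>[OF c] unfolding good_def by auto
    have "\<forall>\<^sub>F w in nhds \<i>. w \<in> hball c" using hball_props[OF c1(1)] by (auto simp: eventually_nhds)
    then show ?thesis using c1(2) by eventually_elim (use \<pi>_eq[OF c] in auto)
  qed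
  obtain c0 where c0: "c0 \<in> S"
  proof -
    have "{z. (cmod z)\<^sup>2 + 1 \<le> 2 * 1 * Im z} \<subseteq> M"
    proof clarify
      fix z assume "(cmod z)\<^sup>2 + 1 \<le> 2 * 1 * Im z"
      then have "(Re z)\<^sup>2 + (Im z - 1)\<^sup>2 \<le> 0" unfolding cmod_power2 by (simp add: power2_eq_square algebra_simps)
      then have "Re z = 0" "Im z = 1" by (auto simp: sum_power2_le_zero_iff)
      then have "z = \<i>" by (simp add: complex_eq_iff)
      then show "z \<in> M" using u(2) by simp
    qed
    obtain e where e: "0 < e" "ball \<i> e \<subseteq> M" using u(1,2) openE by blast
    \<comment> \<open>In the ball the squared distance from \<i> is below 2 (c - 1) Im z. Having c
      \<le> 2 gives Im z < 4, and e^2/16 then makes the bound at most e^2.\<close>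
    define c where "c = 1 + min 1 (e\<^sup>2 / 16)"
    have c: "1 < c" "c \<le> 2" "2 * (c - 1) \<le> e\<^sup>2 / 8" using e(1) unfolding c_def by (auto simp: min_def)
    have "hball c \<subseteq> M"
    proof
      fix z assume z: "z \<in> hball c"
      have "(Im z)\<^sup>2 + 1 \<le> (cmod z)\<^sup>2 + 1" unfolding cmod_power2 by simp
      also have "\<dots> < 2 * c * Im z" using z unfolding hball_def by simp
      finally have le: "(Im z)\<^sup>2 + 1 < 2 * c * Im z" .
      have Imz: "0 < Im z" using z hball_props(3)[OF c(1)] unfolding upper_half_plane_def by blast
      have "Im z * Im z < 2 * c * Im z" using le by (simp add: power2_eq_square)
      then have "Im z < 2 * c" using Imz by simp
      then have Im4: "Im z < 4" using c by simp
      have "(dist \<i> z)\<^sup>2 = (cmod z)\<^sup>2 + 1 - 2 * Im z" unfolding dist_norm cmod_power2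
        by (simp add: power2_eq_square algebra_simps)
      also have "\<dots> < 2 * (c - 1) * Im z" using z unfolding hball_def by (simp add: algebra_simps)
      also have "\<dots> \<le> (e\<^sup>2 / 8) * 4" using Im4 Imz c e(1) by (intro mult_mono) auto
      also have "\<dots> \<le> e\<^sup>2" by simp
      finally have "dist \<i> z < e" using e(1) by (meson less_eq_real_def power2_less_imp_less)
      then show "z \<in> M" using e(2) by auto
    qed
    then have "good c u" unfolding good_def using u(3) c(1) by auto
    then show ?thesis using that unfolding S_def by blast
  qed
  have "\<exists>c\<in>S. z \<in> hball c" if z: "0 < Im z" for z
  proof (rule ccontr)
    assume not: "\<not> (\<exists>c\<in>S. z \<in> hball c)"
    obtain c1 where c1: "1 < c1" "z \<in> hball c1" using upper_half_plane_hball[OF z] by blast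
    have bdd: "c \<le> c1" if "c \<in> S" for c
      using hball_mono[OF c1(1), of c] not c1(2) that by (meson linear subsetD)
    define R where "R = Sup S"
    have le_R: "c \<le> R" if "c \<in> S" for c unfolding R_def using that bdd by (intro cSup_upper bdd_aboveI) auto
    have S1: "1 < c" if "c \<in> S" for c using \<Phi>[OF that] unfolding good_def by blast
    have R1: "1 < R" using le_R[OF c0] S1[OF c0] by linarith
    have "dev_at \<pi> w" if w: "w \<in> hball R" for w
    proof -
      have Imw: "0 < Im w" using w hball_props(3)[OF R1] unfolding upper_half_plane_def by blast
      then have "((cmod w)\<^sup>2 + 1) / (2 * Im w) < R"
        using w unfolding hball_def by (simp add: pos_divide_less_eq mult.assoc mult.left_commute)
      then obtain c where c: "c \<in> S" "((cmod w)\<^sup>2 + 1) / (2 * Im w) < c"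
        using less_cSupD[of S] c0 unfolding R_def by blast
      then have "w \<in> hball c" using Imw unfolding hball_def by (simp add: pos_divide_less_eq mult.assoc mult.left_commute)
      then show ?thesis using \<pi>_dev c(1) by blast
    qed
    then have dev: "dev_at \<pi> w" if "w \<in> ball (\<i> * of_real R) (sqrt (R\<^sup>2 - 1))" for w
      using that hball_eq_ball[OF R1] by blast
    have "0 < sqrt (R\<^sup>2 - 1)" "cball (\<i> * of_real R) (sqrt (R\<^sup>2 - 1)) \<subseteq> upper_half_plane"
      using R1 hcball_upper[OF R1] unfolding hcball_eq_cball[OF R1] by auto
    from dev_extend_cball[OF this dev]
    obtain \<Omega> \<pi>' where \<Omega>: "open \<Omega>" "cball (\<i> * of_real R) (sqrt (R\<^sup>2 - 1)) \<subseteq> \<Omega>" "\<And>w. w \<in> \<Omega> \<Longrightarrow> dev_at \<pi>' w"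
      "\<And>w. w \<in> hball R \<Longrightarrow> \<pi>' w = \<pi> w"
      unfolding hball_eq_ball[OF R1] by blast
    obtain c' where c': "R < c'" "hball c' \<subseteq> \<Omega>"
      using hball_in_open[OF R1 \<Omega>(1)] \<Omega>(2) unfolding hcball_eq_cball[OF R1] by blast
    have "\<forall>\<^sub>F w in nhds \<i>. w \<in> hball R" using hball_props[OF R1] by (auto simp: eventually_nhds)
    then have "\<forall>\<^sub>F w in nhds \<i>. \<pi>' w = u w" using \<pi>_germ[OF c0] by eventually_elim (use \<Omega>(4) in auto)
    then have "good c' \<pi>'" unfolding good_def using c' \<Omega>(3) R1 by auto
    then have "c' \<in> S" unfolding S_def by blast
    then show False using le_R c'(1) by fastforce
  qed
  then show ?thesis using \<pi>_dev \<pi>_germ[OF c0] by blast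
qed

end

section \<open>Deck transformations\<close>

lemma exp_half_mult_self: "exp (x / 2) * exp (x / 2) = exp (x :: real)"
  by (simp flip: exp_add)

definition translation :: "real \<Rightarrow> mat2" where
  "translation c = Mat2 (exp (c / 2)) 0 0 (exp (- (c / 2)))"

lemma mdet_translation [simp]: "mdet (translation c) = 1"
  by (simp add: translation_def exp_minus)

lemma moebius_translation [simp]: "moebius (translation c) z = of_real (exp c) * z"
proof -
  have "moebius (translation c) z = of_real (exp (c / 2)) * z / of_real (exp (- (c / 2)))"
    by (simp add: translation_def)
  also have "\<dots> = of_real (exp (c / 2) * exp (c / 2)) * z" by (simp add: exp_minus field_simps)
  finally show ?thesis unfolding exp_half_mult_self .
qed

lemma mdisp_translation [simp]: "mdisp (translation c) = (sinh (c / 2))\<^sup>2"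
  unfolding translation_def by (simp add: sinh_def power_divide)

text \<open>The geodesic is in normal position: its arc-length parameter t corresponds to the point
  \<i> exp t, so one period is the shift along the imaginary axis by L.\<close>

locale developed_geodesic = hyperbolic_atlas +
  fixes \<pi> :: "complex \<Rightarrow> 'a" and f :: "real \<Rightarrow> 'a" and L :: real
  assumes dev: "0 < Im z \<Longrightarrow> dev_at \<pi> z"
    and f_eq: "f t = \<pi> (\<i> * of_real (exp t))"
    and L_pos: "0 < L"
    and periodic: "f (t + L) = f t"
    and primitive: "primitive_period f L"
begin

text \<open>The preimage in SL(2,R) of the deck group; it therefore contains -1.\<close>

definition deck :: "mat2 set" where
  "deck = {B. mdet B = 1 \<and> (\<forall>z. 0 < Im z \<longrightarrow> \<pi> (moebius B z) = \<pi> z)}"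

lemma local_inj:
  assumes "0 < Im z"
  shows "\<exists>N. open N \<and> z \<in> N \<and> (\<forall>w\<in>N. \<forall>w'\<in>N. \<pi> w = \<pi> w' \<longrightarrow> w = w')"
proof -
  obtain N where N: "open N" "z \<in> N" "N \<subseteq> upper_half_plane" "\<forall>w\<in>N. \<forall>w'\<in>N. dist (\<pi> w) (\<pi> w') = hyp_dist w w'"
    using dev_at_dist[OF dev[OF assms]] by blast
  have "w = w'" if "w \<in> N" "w' \<in> N" "\<pi> w = \<pi> w'" for w w'
    using N(3,4) that hyp_dist_eq_0_iff[of w w'] unfolding upper_half_plane_def by (metis dist_self mem_Collect_eq subsetD)
  then show ?thesis using N by blast
qed

lemma isCont_moebius: "mdet B = 1 \<Longrightarrow> 0 < Im z \<Longrightarrow> isCont (moebius B) z"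
  using continuous_on_moebius[of B] unfolding continuous_on_eq_continuous_at[OF open_upper_half_plane]
  by (simp add: upper_half_plane_def)

text \<open>In one chart around the common image both lifts are Moebius maps; the quotient of these
  carries one local lift to the other, and uniqueness of continuation makes it a symmetry of
  \<open>\<pi>\<close> everywhere.\<close>

lemma deck_transitive:
  assumes z: "0 < Im z" and w: "0 < Im w" and eq: "\<pi> z = \<pi> w"
  shows "\<exists>B\<in>deck. moebius B z = w"
proof -
  obtain V \<psi> where V: "(V, \<psi>) \<in> \<A>" "\<pi> z \<in> V" using chart_exists by blast
  obtain C N where C: "mdet C = 1" "open N" "z \<in> N" "N \<subseteq> upper_half_plane" "\<And>v. v \<in> N \<Longrightarrow> \<pi> v \<in> V \<and> \<psi> (\<pi> v) = moebius C v"
    using dev_at_chart[OF dev[OF z] V] by blast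
  obtain C' N' where C': "mdet C' = 1" "open N'" "w \<in> N'" "\<And>v. v \<in> N' \<Longrightarrow> \<pi> v \<in> V \<and> \<psi> (\<pi> v) = moebius C' v"
    using dev_at_chart[OF dev[OF w] V(1)] V(2) eq by auto
  define B where "B = madj C' * C"
  have B: "mdet B = 1" unfolding B_def using C C' by simp
  have CB: "moebius C' (moebius B v) = moebius C v" if "0 < Im v" for v
    unfolding B_def using moebius_mult[of "madj C'" C v] moebius_madj(1)[of C' "moebius C v"] Im_moebius_pos[of C v] that C(1) C'(1) by simp
  have Bz: "moebius B z = w"
  proof (rule moebius_inj[OF C'(1)])
    show "moebius C' (moebius B z) = moebius C' w"
      using CB[OF z] C(5)[OF C(3)] C'(4)[OF C'(3)] eq by simp
  qed (use Im_moebius_pos B z w in auto)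
  have "\<forall>\<^sub>F v in nhds z. moebius B v \<in> N'"
    using isCont_moebius[OF B z] C'(2,3) Bz by (intro isCont_eventually_mem) auto
  then obtain M where M: "open M" "z \<in> M" "\<And>v. v \<in> M \<Longrightarrow> moebius B v \<in> N'" unfolding eventually_nhds by blast
  have "\<pi> (moebius B v) = \<pi> v" if v: "0 < Im v" for v
  proof (rule dev_unique[of upper_half_plane "\<lambda>v. \<pi> (moebius B v)" \<pi> "M \<inter> N"])
    show "connected upper_half_plane" using convex_upper_half_plane by (rule convex_connected)
    show "dev_at (\<lambda>v. \<pi> (moebius B v)) u" if "u \<in> upper_half_plane" for u
      using that dev Im_moebius_pos[OF B] by (intro dev_at_moebius B) (auto simp: upper_half_plane_def)
    show "dev_at \<pi> u" if "u \<in> upper_half_plane" for u using dev that by (simp add: upper_half_plane_def)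
    show "\<pi> (moebius B u) = \<pi> u" if u: "u \<in> M \<inter> N" for u
    proof -
      have "\<psi> (\<pi> (moebius B u)) = \<psi> (\<pi> u)"
        using C'(4)[OF M(3)[of u]] C(5)[of u] CB[of u] u C(4) unfolding upper_half_plane_def by auto
      then show ?thesis using inj_onD[OF chart_inj[OF V(1)]] C'(4)[OF M(3)[of u]] C(5)[of u] u by auto
    qed
  qed (use M C v open_upper_half_plane in \<open>auto simp: upper_half_plane_def\<close>)
  then show ?thesis using B Bz unfolding deck_def by blast
qed

text \<open>Points near a fixed point are sent to nearby points with the same image, so local
  injectivity forces the identity on an open set.\<close>

lemma deck_free:
  assumes B: "B \<in> deck" and z: "0 < Im z" "moebius B z = z"
  shows "B = 1 \<or> B = - 1"
proof -
  have B1: "mdet B = 1" "\<And>z. 0 < Im z \<Longrightarrow> \<pi> (moebius B z) = \<pi> z" using B unfolding deck_def by auto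
  obtain N where N: "open N" "z \<in> N" "\<And>w w'. w \<in> N \<Longrightarrow> w' \<in> N \<Longrightarrow> \<pi> w = \<pi> w' \<Longrightarrow> w = w'"
    using local_inj[OF z(1)] by blast
  have "\<forall>\<^sub>F v in nhds z. moebius B v \<in> N"
    using isCont_moebius[OF B1(1) z(1)] N z(2) by (intro isCont_eventually_mem) auto
  then obtain M where M: "open M" "z \<in> M" "\<And>v. v \<in> M \<Longrightarrow> moebius B v \<in> N" unfolding eventually_nhds by blast
  have "moebius B = moebius 1"
  proof (rule moebius_eq_on_open[of _ _ "M \<inter> N \<inter> upper_half_plane"])
    show "moebius B v = moebius 1 v" if "v \<in> M \<inter> N \<inter> upper_half_plane" for v
      using N(3)[of "moebius B v" v] M(3)[of v] B1(2)[of v] that by (auto simp: upper_half_plane_def)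
  qed (use B1 N M z open_upper_half_plane in \<open>auto simp: upper_half_plane_def\<close>)
  then show ?thesis using moebius_fixed_two[OF B1(1), of \<i> "2 * \<i>"] by simp
qed

sublocale torsion_free_group deck
proof
  show "A \<in> deck \<Longrightarrow> mdet A = 1" for A unfolding deck_def by blast
  show "1 \<in> deck" unfolding deck_def by simp
  show "A * B \<in> deck" if "A \<in> deck" "B \<in> deck" for A B
    using that Im_moebius_pos[of B] unfolding deck_def by (auto simp: moebius_mult)
  show "madj A \<in> deck" if "A \<in> deck" for A
  proof -
    have A: "mdet A = 1" "\<And>z. 0 < Im z \<Longrightarrow> \<pi> (moebius A z) = \<pi> z" using that unfolding deck_def by auto
    have "\<pi> (moebius (madj A) z) = \<pi> z" if z: "0 < Im z" for z
      using A(2)[of "moebius (madj A) z"] Im_moebius_pos[of "madj A" z] moebius_madj(1)[OF A(1) z] A(1) z by simp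
    then show ?thesis using A unfolding deck_def by simp
  qed
  show "- A \<in> deck" if "A \<in> deck" for A using that unfolding deck_def by simp
  show "2 \<le> \<bar>mtr A\<bar>" if A: "A \<in> deck" for A
  proof (rule ccontr)
    assume tr: "\<not> 2 \<le> \<bar>mtr A\<bar>"
    have "mdet A = 1" using A unfolding deck_def by blast
    then obtain z where "0 < Im z" "moebius A z = z" using moebius_elliptic_fixpoint[of A] tr by auto
    then have "A = 1 \<or> A = - 1" using deck_free[OF A] by blast
    then show False using tr by auto
  qed
  \<comment> \<open>A small displacement keeps the image of \<i> in a neighbourhood on which
    \<open>\<pi>\<close> is injective, so \<i> is fixed and freeness applies.\<close>
  show "\<exists>r>0. \<forall>A\<in>deck. mdisp A < r \<longrightarrow> A = 1 \<or> A = - 1"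
  proof -
    obtain N where N: "open N" "\<i> \<in> N" "\<And>w w'. w \<in> N \<Longrightarrow> w' \<in> N \<Longrightarrow> \<pi> w = \<pi> w' \<Longrightarrow> w = w'"
      using local_inj[of \<i>] by auto
    obtain e where e: "0 < e" "ball \<i> e \<subseteq> N" using N openE by blast
    obtain \<delta> where \<delta>: "0 < \<delta>" "\<And>w. 0 < Im w \<Longrightarrow> hyp_dist \<i> w < \<delta> \<Longrightarrow> cmod (\<i> - w) < e"
      using hyp_dist_small[of \<i> e] e(1) by auto
    have "A = 1 \<or> A = - 1" if A: "A \<in> deck" "mdisp A < (sinh (\<delta> / 2))\<^sup>2" for A
    proof -
      have A1: "mdet A = 1" "\<pi> (moebius A \<i>) = \<pi> \<i>" using A unfolding deck_def by auto
      have im: "0 < Im (moebius A \<i>)" using Im_moebius_pos A1 by simp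
      have "(sinh (hyp_dist \<i> (moebius A \<i>) / 2))\<^sup>2 < (sinh (\<delta> / 2))\<^sup>2"
        using A(2) unfolding mdisp_eq_sinh[OF A1(1)] .
      moreover have "0 \<le> sinh (\<delta> / 2)" using \<delta>(1) by simp
      ultimately have "sinh (hyp_dist \<i> (moebius A \<i>) / 2) < sinh (\<delta> / 2)" by (rule power2_less_imp_less)
      then have "hyp_dist \<i> (moebius A \<i>) < \<delta>" by simp
      then have "moebius A \<i> \<in> N" using \<delta>(2)[OF im] e(2) by (auto simp: dist_norm)
      then show ?thesis using N(2,3) A1(2) deck_free[OF A(1), of \<i>] by auto
    qed
    then show ?thesis using \<delta>(1) by (intro exI[of _ "(sinh (\<delta> / 2))\<^sup>2"]) auto
  qed
qed

text \<open>Some deck transformation takes \<i> to \<i> exp L. By local injectivity it follows the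
  periodic curve for small t, and two points of the axis determine it up to sign.\<close>

lemma translation_mem_deck: "translation L \<in> deck"
proof -
  have Im_exp: "0 < Im (\<i> * of_real (exp t))" for t by simp
  have "\<pi> (\<i> * of_real (exp 0)) = \<pi> (\<i> * of_real (exp L))" using periodic[of 0] f_eq by simp
  then obtain B where B: "B \<in> deck" "moebius B (\<i> * of_real (exp 0)) = \<i> * of_real (exp L)"
    using deck_transitive[OF Im_exp[of 0] Im_exp[of L]] by blast
  have B1: "mdet B = 1" "\<And>z. 0 < Im z \<Longrightarrow> \<pi> (moebius B z) = \<pi> z" using B unfolding deck_def by auto
  obtain N where N: "open N" "\<i> * of_real (exp L) \<in> N" "\<And>w w'. w \<in> N \<Longrightarrow> w' \<in> N \<Longrightarrow> \<pi> w = \<pi> w' \<Longrightarrow> w = w'"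
    using local_inj[OF Im_exp[of L]] by blast
  have "isCont (\<lambda>t. moebius B (\<i> * of_real (exp t))) 0"
    by (rule isCont_o2[where f = "\<lambda>t. \<i> * of_real (exp t)" and a = 0, OF _ isCont_moebius[OF B1(1) Im_exp[of 0]]]) (intro continuous_intros)
  then have "\<forall>\<^sub>F t in nhds 0. moebius B (\<i> * of_real (exp t)) \<in> N"
    using N B(2) by (intro isCont_eventually_mem) auto
  moreover have "isCont (\<lambda>t. \<i> * of_real (exp (t + L))) 0" by (intro continuous_intros)
  then have "\<forall>\<^sub>F t in nhds 0. \<i> * of_real (exp (t + L)) \<in> N"
    using N by (intro isCont_eventually_mem) auto
  ultimately have "\<forall>\<^sub>F t in nhds 0. moebius B (\<i> * of_real (exp t)) = \<i> * of_real (exp (t + L))"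
  proof eventually_elim
    case (elim t)
    have "\<pi> (moebius B (\<i> * of_real (exp t))) = \<pi> (\<i> * of_real (exp (t + L)))"
      using B1(2)[OF Im_exp] periodic[of t] f_eq by simp
    then show ?case using N(3) elim by blast
  qed
  then obtain d where d: "0 < d" "\<And>t. dist t 0 < d \<Longrightarrow> moebius B (\<i> * of_real (exp t)) = \<i> * of_real (exp (t + L))"
    unfolding eventually_nhds_metric by blast
  have eq: "moebius B (\<i> * of_real (exp t)) = moebius (translation L) (\<i> * of_real (exp t))" if "dist t 0 < d" for t
    using d(2)[OF that] by (simp add: exp_add)
  have ne: "\<i> * complex_of_real (exp 0) \<noteq> \<i> * of_real (exp (d / 2))" using d(1) by (simp add: complex_eq_iff)
  have "B = translation L \<or> B = - translation L"
    by (rule moebius_eq_two_points[OF B1(1) mdet_translation Im_exp[of 0] Im_exp[of "d / 2"] ne])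
      (rule eq, use d(1) in simp)+
  then show ?thesis using B(1) neg[OF B(1)] by auto
qed

text \<open>This is where primitivity enters: a deck translation along the axis is a period of
  \<open>f\<close>.\<close>

lemma diagonal_deck:
  assumes "translation c \<in> deck"
  shows "c = 0 \<or> L \<le> \<bar>c\<bar>"
proof -
  have "f (t + c) = f t" for t
  proof -
    have "\<pi> (moebius (translation c) (\<i> * of_real (exp t))) = \<pi> (\<i> * of_real (exp t))"
      using assms unfolding deck_def by simp
    then show ?thesis unfolding f_eq by (simp add: exp_add mult.commute mult.left_commute)
  qed
  then have "f (t + \<bar>c\<bar>) = f t" for t
    by (cases "0 \<le> c") (auto, metis add.commute add_diff_cancel_left' diff_conv_add_uminus)
  then show ?thesis using primitive unfolding primitive_period_def by (metis not_less zero_less_abs_iff)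
qed

lemma commute_translation:
  assumes B: "B \<in> deck" and comm: "B * translation L = translation L * B"
  shows "\<exists>c. translation c \<in> deck \<and> (B = translation c \<or> B = - translation c)"
proof (cases B)
  case (Mat2 a b c d)
  have "b * (exp (L / 2) - exp (- (L / 2))) = 0" "c * (exp (L / 2) - exp (- (L / 2))) = 0"
    using comm unfolding Mat2 translation_def by (auto simp: algebra_simps)
  moreover have "exp (L / 2) - exp (- (L / 2)) \<noteq> 0" using L_pos by simp
  ultimately have bc: "b = 0" "c = 0" by auto
  have ad: "a * d = 1" using det[OF B] unfolding Mat2 bc by simp
  have a0: "a \<noteq> 0" using ad by auto
  define c' where "c' = 2 * ln \<bar>a\<bar>"
  have "exp (c' / 2) = \<bar>a\<bar>" "exp (- (c' / 2)) = \<bar>d\<bar>"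
    using a0 ad unfolding c'_def by (auto simp: exp_minus field_simps abs_mult[symmetric])
  moreover have "0 < a \<and> 0 < d \<or> a < 0 \<and> d < 0" using ad by (metis zero_less_mult_iff zero_less_one)
  ultimately have "B = translation c' \<or> B = - translation c'"
    unfolding translation_def Mat2 bc by auto
  then show ?thesis using B neg[OF B] by auto
qed

text \<open>An element not commuting with \<open>translation L\<close> is bounded by the Margulis
  inequality. A commuting one translates the axis by at least L, and the assumption on sinh makes
  that displacement the larger of the two bounds.\<close>

lemma mdisp_lower_bound:
  assumes B: "B \<in> deck" "B \<noteq> 1" "B \<noteq> - 1" and sL: "1 \<le> sinh (L / 2)"
  shows "(1 / sinh (L / 2))\<^sup>2 \<le> mdisp B"
proof (cases "B * translation L = translation L * B")
  case False
  then have "1 \<le> mdisp B * (sinh (L / 2))\<^sup>2"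
    using mdisp_mult_ge_1[OF B(1) translation_mem_deck] by simp
  moreover have "0 < (sinh (L / 2))\<^sup>2" using L_pos by simp
  ultimately show ?thesis by (simp add: power_divide pos_divide_le_eq)
next
  case True
  then obtain c where c: "translation c \<in> deck" "B = translation c \<or> B = - translation c"
    using commute_translation[OF B(1)] by blast
  have "translation 0 = 1" by (simp add: translation_def one_mat2_def)
  then have "c \<noteq> 0" using c(2) B by auto
  then have "L / 2 \<le> \<bar>c\<bar> / 2" using diagonal_deck[OF c(1)] by simp
  then have "sinh (L / 2) \<le> sinh (\<bar>c\<bar> / 2)" by simp
  then have "(sinh (L / 2))\<^sup>2 \<le> (sinh (\<bar>c\<bar> / 2))\<^sup>2" using L_pos by (intro power_mono) auto
  also have "(sinh (\<bar>c\<bar> / 2))\<^sup>2 = mdisp B" using c(2) by (auto simp: abs_if)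
  finally have "(sinh (L / 2))\<^sup>2 \<le> mdisp B" .
  moreover have "(1 / sinh (L / 2))\<^sup>2 \<le> 1\<^sup>2"
    using sL L_pos by (intro power_mono) (auto simp: divide_le_eq)
  moreover have "1\<^sup>2 \<le> (sinh (L / 2))\<^sup>2" using sL by (intro power_mono) auto
  ultimately show ?thesis by linarith
qed

section \<open>Self-intersections as deck transformations\<close>

lemma self_intersection_deck:
  assumes "f s = f t" "s \<noteq> t" "\<bar>s - t\<bar> < L"
  shows "\<exists>B\<in>deck. 2 \<le> mtr B \<and> moebius B (\<i> * of_real (exp s)) = \<i> * of_real (exp t)"
proof -
  have "\<pi> (\<i> * of_real (exp s)) = \<pi> (\<i> * of_real (exp t))" using assms(1) f_eq by simp
  then obtain B where B: "B \<in> deck" "moebius B (\<i> * of_real (exp s)) = \<i> * of_real (exp t)"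
    using deck_transitive[of "\<i> * of_real (exp s)" "\<i> * of_real (exp t)"] by auto
  then show ?thesis using trace[OF B(1)] neg[OF B(1)]
    by (cases "0 \<le> mtr B") (auto intro: bexI[of _ B] bexI[of _ "- B"])
qed

lemma not_translation:
  assumes B: "B \<in> deck" "moebius B (\<i> * of_real (exp s)) = \<i> * of_real (exp t)" and st: "s \<noteq> t" "\<bar>s - t\<bar> < L"
  shows "B \<noteq> translation c" "B \<noteq> - translation c"
proof -
  have "\<not> (B = translation c \<or> B = - translation c)"
  proof
    assume c: "B = translation c \<or> B = - translation c"
    then have "translation c \<in> deck" using B(1) neg[OF B(1)] by auto
    moreover have "of_real (exp c) * (\<i> * of_real (exp s)) = \<i> * of_real (exp t)" using B(2) c by auto
    then have "exp (c + s) = exp t" by (simp add: complex_eq_iff exp_add)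
    then have "c = t - s" by simp
    ultimately show False using diagonal_deck st by fastforce
  qed
  then show "B \<noteq> translation c" "B \<noteq> - translation c" by auto
qed

text \<open>The transformation belonging to the intersection moves \<i> by less than L, and so both
  factors in the Margulis inequality are at most sinh^2 (L/2).\<close>

lemma self_intersection_long:
  assumes "f 0 = f t" "t \<noteq> 0" "\<bar>t\<bar> < L"
  shows "1 \<le> sinh (L / 2)"
proof -
  obtain B where B: "B \<in> deck" "moebius B (\<i> * of_real (exp 0)) = \<i> * of_real (exp t)"
    using self_intersection_deck[of 0 t] assms by auto
  have "B * translation L \<noteq> translation L * B"
    using commute_translation[OF B(1)] not_translation[OF B] assms by auto
  then have "1 \<le> mdisp B * (sinh (L / 2))\<^sup>2"
    using mdisp_mult_ge_1[OF B(1) translation_mem_deck] by simp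
  moreover have "mdisp B = (sinh (\<bar>t\<bar> / 2))\<^sup>2"
    using mdisp_eq_sinh[OF det[OF B(1)]] B(2) hyp_dist_imag_axis[of 0 t] by simp
  moreover have "(sinh (\<bar>t\<bar> / 2))\<^sup>2 \<le> (sinh (L / 2))\<^sup>2"
    using assms(3) by (intro power_mono) auto
  then have "(sinh (\<bar>t\<bar> / 2))\<^sup>2 * (sinh (L / 2))\<^sup>2 \<le> (sinh (L / 2))\<^sup>2 * (sinh (L / 2))\<^sup>2"
    by (intro mult_right_mono) auto
  ultimately have "1 \<le> ((sinh (L / 2))\<^sup>2)\<^sup>2" by (simp add: power2_eq_square)
  then have "1 \<le> (sinh (L / 2))\<^sup>2" using power2_le_imp_le[of 1 "(sinh (L / 2))\<^sup>2"] by simp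
  then show ?thesis using L_pos power2_le_imp_le[of 1 "sinh (L / 2)"] by simp
qed

text \<open>The half turns exchanging two points of the axis have trace 0, so they are no deck transformations.\<close>

lemma intersection_determined:
  assumes B: "B \<in> deck"
    and 1: "moebius B (\<i> * of_real (exp s)) = \<i> * of_real (exp t)" "s \<noteq> t" "\<bar>s - t\<bar> < L"
    and 2: "moebius B (\<i> * of_real (exp s')) = \<i> * of_real (exp t')"
  shows "s = s' \<and> t = t'"
proof (cases "s = s'")
  case True
  then have "exp t = exp t'" using 1 2 by (simp add: complex_eq_iff)
  then show ?thesis using True by simp
next
  case False
  let ?z = "\<i> * complex_of_real (exp s)" and ?w = "\<i> * complex_of_real (exp s')"
  have zw: "0 < Im ?z" "0 < Im ?w" "?z \<noteq> ?w" using False by (auto simp: complex_eq_iff)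
  have "\<bar>t - t'\<bar> = \<bar>s - s'\<bar>"
    using hyp_dist_moebius[OF det[OF B] zw(1,2)] unfolding 1 2 hyp_dist_imag_axis .
  \<comment> \<open>An isometry matching two pairs of points of the axis acts on it as a translation
    or as a reflection of the parameter.\<close>
  then consider "t' - s' = t - s" | "t + s = t' + s'" by linarith
  then show ?thesis
  proof cases
    case 1
    have tr: "moebius (translation (v - u)) (\<i> * of_real (exp u)) = \<i> * of_real (exp v)" for u v
      by (simp add: exp_diff)
    have "moebius B ?z = moebius (translation (t - s)) ?z" "moebius B ?w = moebius (translation (t - s)) ?w"
      using tr[where u = s and v = t] tr[where u = s' and v = t'] assms(2) 2 \<open>t' - s' = t - s\<close> by simp_all
    then have "B = translation (t - s) \<or> B = - translation (t - s)"
      using moebius_eq_two_points[OF det[OF B] mdet_translation zw] by blast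
    then show ?thesis using not_translation[OF B assms(2-4)] by blast
  next
    case 2
    \<comment> \<open>The half turn about the midpoint \<i> exp ((s + t)/2); on the axis it acts by
      u -> s + t - u.\<close>
    let ?R = "Mat2 0 (- exp ((s + t) / 2)) (exp (- ((s + t) / 2))) 0"
    have R: "mdet ?R = 1" by (simp add: exp_minus)
    have "moebius ?R (\<i> * of_real (exp u)) = \<i> * of_real (exp (s + t - u))" for u
    proof -
      have "exp ((s + t) / 2) = exp (s + t - u) * (exp (- ((s + t) / 2)) * exp u)"
      proof -
        have "(s + t) / 2 = s + t - u + (- ((s + t) / 2) + u)" by (simp add: field_simps)
        then show ?thesis by (simp only: exp_add[symmetric])
      qed
      then have e: "complex_of_real (exp ((s + t) / 2)) = of_real (exp (s + t - u)) * (of_real (exp (- ((s + t) / 2))) * of_real (exp u))"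
        by (simp flip: of_real_mult)
      show ?thesis unfolding moebius.simps by (simp add: divide_eq_eq) (use e in \<open>simp add: field_simps\<close>)
    qed
    then have "moebius B ?z = moebius ?R ?z" "moebius B ?w = moebius ?R ?w"
      unfolding assms(2,5) using 2 by (simp_all add: algebra_simps)
    then have "B = ?R \<or> B = - ?R" using moebius_eq_two_points[OF det[OF B] R zw] by blast
    then have "mtr B = 0" by auto
    then show ?thesis using trace[OF B] by simp
  qed
qed

text \<open>Every transformation from the block sends \<i> within \<epsilon> of \<i> exp b.
  Quotients by a fixed one of them move \<i> by at most 2 \<epsilon>, so they commute pairwise and
  \<open>card_commuting_le\<close> counts them with R = sinh \<epsilon> and \<rho> = 1 / sinh
  (L/2).\<close>

lemma block_count:
  fixes b \<epsilon> :: real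
  assumes \<epsilon>: "0 \<le> \<epsilon>" "sinh \<epsilon> < 1" and sL: "1 \<le> sinh (L / 2)"
  defines "P \<equiv> {(s, t). \<bar>s\<bar> \<le> \<epsilon> / 2 \<and> \<bar>t - b\<bar> \<le> \<epsilon> / 2 \<and> s \<noteq> t \<and> \<bar>s - t\<bar> < L \<and> f s = f t}"
  shows "finite P \<and> real (card P) \<le> 1 + 2 * sinh (L / 2)"
proof (cases "P = {}")
  case True
  then show ?thesis using sL by simp
next
  case False
  then obtain p0 where p0: "p0 \<in> P" by blast
  have "\<exists>B\<in>deck. 2 \<le> mtr B \<and> moebius B (\<i> * of_real (exp (fst p))) = \<i> * of_real (exp (snd p))" if "p \<in> P" for p
    using that self_intersection_deck unfolding P_def by auto
  then obtain g where g: "\<And>p. p \<in> P \<Longrightarrow> g p \<in> deck" "\<And>p. p \<in> P \<Longrightarrow> 2 \<le> mtr (g p)"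
    "\<And>p. p \<in> P \<Longrightarrow> moebius (g p) (\<i> * of_real (exp (fst p))) = \<i> * of_real (exp (snd p))" by metis
  have g_inj: "p = q" if "p \<in> P" "q \<in> P" "g p = g q" for p q
    using intersection_determined[OF g(1)[OF that(1)] g(3)[OF that(1)], of "fst q" "snd q"] g(3)[OF that(2)] that
    unfolding P_def by (auto simp: prod_eq_iff)
  define n where "n A = (if 0 \<le> mtr A then A else - A)" for A
  \<comment> \<open>Forming the quotient may spoil the trace normalisation, so the sign is chosen
    again. Injectivity survives because the \<open>g p\<close> themselves have trace at least
    2.\<close>
  define h where "h p = n (madj (g p0) * g p)" for p
  have n: "n A \<in> deck" "2 \<le> mtr (n A)" "mdisp (n A) = mdisp A" if "A \<in> deck" for A
    using that neg trace[OF that] unfolding n_def by auto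
  have mem: "madj (g p0) * g p \<in> deck" if "p \<in> P" for p using that p0 g(1) mult inv by blast
  have "inj_on h P"
  proof (rule inj_onI)
    fix p q assume pq: "p \<in> P" "q \<in> P" "h p = h q"
    have factor: "g p = g p0 * (madj (g p0) * g p)" for p
      using madj_right[OF det[OF g(1)[OF p0]]] by (simp add: mult.assoc[symmetric])
    have "madj (g p0) * g p = madj (g p0) * g q \<or> madj (g p0) * g p = - (madj (g p0) * g q)"
      using pq(3) unfolding h_def n_def by (metis uminus_uminus_mat2)
    then have "g p = g q \<or> g p = - g q" using factor mult_uminus_right by metis
    moreover have "g p \<noteq> - g q" using g(2)[OF pq(1)] g(2)[OF pq(2)] by auto
    ultimately show "p = q" using g_inj pq by blast
  qed
  moreover have disp: "mdisp (h p) \<le> (sinh \<epsilon>)\<^sup>2" if p: "p \<in> P" for p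
  proof -
    have near: "hyp_dist (moebius (g p) \<i>) (\<i> * of_real (exp b)) \<le> \<epsilon>" if p: "p \<in> P" for p
    proof -
      have im: "0 < Im (moebius (g p) \<i>)" using Im_moebius_pos[OF det[OF g(1)[OF p]], of \<i>] by simp
      have "hyp_dist (moebius (g p) \<i>) (\<i> * of_real (exp (snd p))) = hyp_dist \<i> (\<i> * of_real (exp (fst p)))"
        using hyp_dist_moebius[OF det[OF g(1)[OF p]], of \<i> "\<i> * of_real (exp (fst p))"] g(3)[OF p] by simp
      also have "\<dots> = \<bar>fst p\<bar>" using hyp_dist_imag_axis[of 0 "fst p"] by simp
      finally have 1: "hyp_dist (moebius (g p) \<i>) (\<i> * of_real (exp (snd p))) = \<bar>fst p\<bar>" .
      have "hyp_dist (moebius (g p) \<i>) (\<i> * of_real (exp b)) \<le> \<bar>fst p\<bar> + \<bar>snd p - b\<bar>"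
        using hyp_dist_triangle[of "moebius (g p) \<i>" "\<i> * of_real (exp (snd p))" "\<i> * of_real (exp b)"] im
        unfolding 1 hyp_dist_imag_axis by simp
      also have "\<dots> \<le> \<epsilon>" using p unfolding P_def by auto
      finally show ?thesis .
    qed
    let ?A = "madj (g p0) * g p"
    have d: "mdet (g p0) = 1" "mdet (g p) = 1" "mdet ?A = 1" using det g(1) p p0 by auto
    have im: "0 < Im (moebius (g p0) \<i>)" "0 < Im (moebius (g p) \<i>)" "0 < Im (moebius ?A \<i>)" using Im_moebius_pos d by auto
    have "moebius (g p0) (moebius ?A \<i>) = moebius (g p) \<i>"
      using moebius_mult[of "madj (g p0)" "g p" \<i>] moebius_madj(1)[OF d(1) im(2)] d by simp
    then have "hyp_dist \<i> (moebius ?A \<i>) = hyp_dist (moebius (g p0) \<i>) (moebius (g p) \<i>)"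
      using hyp_dist_moebius[OF d(1), of \<i> "moebius ?A \<i>"] im(3) by simp
    also have "\<dots> \<le> hyp_dist (moebius (g p0) \<i>) (\<i> * of_real (exp b)) + hyp_dist (\<i> * of_real (exp b)) (moebius (g p) \<i>)"
      using im by (intro hyp_dist_triangle) auto
    also have "\<dots> \<le> \<epsilon> + \<epsilon>" using near[OF p0] near[OF p] by (simp add: hyp_dist_commute)
    finally have "hyp_dist \<i> (moebius ?A \<i>) / 2 \<le> \<epsilon>" by simp
    then have "sinh (hyp_dist \<i> (moebius ?A \<i>) / 2) \<le> sinh \<epsilon>" by simp
    then have "mdisp ?A \<le> (sinh \<epsilon>)\<^sup>2"
      unfolding mdisp_eq_sinh[OF d(3)] using hyp_dist_nonneg[of \<i> "moebius ?A \<i>"] im(3) by (intro power_mono) auto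
    then show ?thesis unfolding h_def using n(3)[OF mem[OF p]] by simp
  qed
  have "finite (h ` P) \<and> real (card (h ` P)) \<le> 1 + 2 * (sinh \<epsilon> / (1 / sinh (L / 2)))"
  proof (rule card_commuting_le)
    show "h ` P \<subseteq> deck" using n(1) mem unfolding h_def by auto
    show "2 \<le> mtr A" if "A \<in> h ` P" for A using that n(2) mem unfolding h_def by auto
    show "A * B = B * A" if AB: "A \<in> h ` P" "B \<in> h ` P" for A B
    \<comment> \<open>Both displacements are at most sinh^2 \<epsilon> < 1, so a noncommuting pair
      would violate the Margulis inequality.\<close>
    proof (rule ccontr)
      assume "A * B \<noteq> B * A"
      then have "1 \<le> mdisp A * mdisp B" using AB n(1) mem unfolding h_def by (intro mdisp_mult_ge_1) auto
      also have "\<dots> \<le> (sinh \<epsilon>)\<^sup>2 * (sinh \<epsilon>)\<^sup>2"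
      proof (intro mult_mono)
        show "0 \<le> mdisp B" by (cases B) simp
      qed (use AB disp in auto)
      also have "\<dots> = (sinh \<epsilon>) ^ 4" by (simp flip: power_add)
      also have "\<dots> < 1" using \<epsilon> by (intro power_less_one_iff[THEN iffD2]) auto
      finally show False by simp
    qed
    show "0 < 1 / sinh (L / 2)" using L_pos by simp
    show "(1 / sinh (L / 2))\<^sup>2 \<le> mdisp A" if "A \<in> deck" "A \<noteq> 1" "A \<noteq> - 1" for A
      using mdisp_lower_bound[OF that sL] .
    show "0 \<le> sinh \<epsilon>" using \<epsilon> by simp
    show "mdisp A \<le> (sinh \<epsilon>)\<^sup>2" if "A \<in> h ` P" for A using that disp by auto
  qed
  moreover have "sinh \<epsilon> / (1 / sinh (L / 2)) \<le> sinh (L / 2)"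
  proof -
    have "sinh \<epsilon> * sinh (L / 2) \<le> 1 * sinh (L / 2)" using \<epsilon> L_pos by (intro mult_right_mono) auto
    then show ?thesis by simp
  qed
  ultimately show ?thesis using finite_imageD[of h P] card_image[of h P] by auto
qed

end

section \<open>Lifting the geodesic and counting\<close>

lemma open_eventually_nhds: "open {t. \<forall>\<^sub>F s in nhds t. P s}"
proof (subst open_subopen, intro ballI)
  fix t assume "t \<in> {t. \<forall>\<^sub>F s in nhds t. P s}"
  then obtain S where S: "open S" "t \<in> S" "\<forall>s\<in>S. P s" unfolding eventually_nhds by blast
  have "S \<subseteq> {t. \<forall>\<^sub>F s in nhds t. P s}" using S(1,3) unfolding eventually_nhds by blast
  then show "\<exists>T. open T \<and> t \<in> T \<and> T \<subseteq> {t. \<forall>\<^sub>F s in nhds t. P s}" using S(1,2) by blast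
qed

context complete_hyperbolic_atlas
begin

text \<open>The shift by t0 is absorbed into \<open>C\<close>, so every local piece is expressed in
  the one global parameter and can be compared with the developing map.\<close>

lemma chart_geodesic:
  assumes loc: "\<forall>t. \<exists>e>0. \<forall>r s. \<bar>r - t\<bar> < e \<longrightarrow> \<bar>s - t\<bar> < e \<longrightarrow> dist (f r) (f s) = \<bar>r - s\<bar>"
    and V: "(V, \<psi>) \<in> \<A>" "f t0 \<in> V"
  shows "\<exists>C e. mdet C = 1 \<and> 0 < e \<and> (\<forall>t. \<bar>t - t0\<bar> < e \<longrightarrow> f t \<in> V \<and> \<psi> (f t) = moebius C (\<i> * of_real (exp t)))"
proof -
  obtain e0 where e0: "0 < e0" "\<And>r s. \<bar>r - t0\<bar> < e0 \<Longrightarrow> \<bar>s - t0\<bar> < e0 \<Longrightarrow> dist (f r) (f s) = \<bar>r - s\<bar>"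
    using loc by blast
  obtain \<rho> where \<rho>: "0 < \<rho>" "ball (f t0) \<rho> \<subseteq> V" using chart_open[OF V(1)] V(2) openE by blast
  define e where "e = min e0 \<rho>"
  have e: "0 < e" "e \<le> e0" "e \<le> \<rho>" unfolding e_def using e0 \<rho> by auto
  have fV: "f t \<in> V" if "\<bar>t - t0\<bar> < e" for t
  proof -
    have "dist (f t0) (f t) = \<bar>t0 - t\<bar>" using e0(2)[of t0 t] that e e0(1) by simp
    then show ?thesis using that e \<rho>(2) by auto
  qed
  have "\<exists>A. mdet A = 1 \<and> (\<forall>t. \<bar>t\<bar> < e \<longrightarrow> moebius A (\<psi> (f (t0 + t))) = \<i> * of_real (exp t))"
  proof (rule geodesic_segment_to_imag_axis)
    show "0 < Im (\<psi> (f (t0 + t)))" if "\<bar>t\<bar> < e" for t using chart_Im[OF V(1) fV] that by simp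
    show "hyp_dist (\<psi> (f (t0 + s))) (\<psi> (f (t0 + t))) = \<bar>s - t\<bar>" if "\<bar>s\<bar> < e" "\<bar>t\<bar> < e" for s t
      using chart_dist[OF V(1) fV fV, of "t0 + s" "t0 + t"] e0(2)[of "t0 + s" "t0 + t"] that e by simp
  qed (rule e)
  then obtain A where A: "mdet A = 1" "\<And>t. \<bar>t\<bar> < e \<Longrightarrow> moebius A (\<psi> (f (t0 + t))) = \<i> * of_real (exp t)"
    by blast
  have "\<psi> (f t) = moebius (madj A * translation (- t0)) (\<i> * of_real (exp t))" if t: "\<bar>t - t0\<bar> < e" for t
  proof -
    have im: "0 < Im (\<psi> (f t))" using chart_Im[OF V(1) fV[OF t]] .
    have "moebius (madj A * translation (- t0)) (\<i> * of_real (exp t)) = moebius (madj A) (moebius (translation (- t0)) (\<i> * of_real (exp t)))"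
      using A(1) by (intro moebius_mult) auto
    also have "moebius (translation (- t0)) (\<i> * of_real (exp t)) = \<i> * of_real (exp (t - t0))"
      by (simp add: exp_diff exp_minus field_simps)
    also have "\<dots> = moebius A (\<psi> (f t))" using A(2)[of "t - t0"] t by simp
    finally show ?thesis using moebius_madj(2)[OF A(1) im] by simp
  qed
  moreover have "mdet (madj A * translation (- t0)) = 1" using A(1) by simp
  ultimately show ?thesis using e(1) fV by blast
qed

lemma local_geodesic_continuous:
  assumes loc: "\<forall>t. \<exists>e>0. \<forall>r s. \<bar>r - t\<bar> < e \<longrightarrow> \<bar>s - t\<bar> < e \<longrightarrow> dist (f r) (f s) = \<bar>r - s\<bar>"
  shows "isCont (f :: real \<Rightarrow> 'a) t"
  unfolding continuous_at_eps_delta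
proof (intro allI impI)
  fix \<epsilon> :: real assume \<epsilon>: "0 < \<epsilon>"
  obtain e0 where e0: "0 < e0" "\<And>r s. \<bar>r - t\<bar> < e0 \<Longrightarrow> \<bar>s - t\<bar> < e0 \<Longrightarrow> dist (f r) (f s) = \<bar>r - s\<bar>"
    using loc by blast
  show "\<exists>d>0. \<forall>x'. dist x' t < d \<longrightarrow> dist (f x') (f t) < \<epsilon>"
    using e0(1) e0(2)[of _ t] \<epsilon> by (intro exI[of _ "min e0 \<epsilon>"]) (auto simp: dist_real_def)
qed

theorem develop_geodesic:
  assumes loc: "\<forall>t. \<exists>e>0. \<forall>r s. \<bar>r - t\<bar> < e \<longrightarrow> \<bar>s - t\<bar> < e \<longrightarrow> dist (f r) (f s) = \<bar>r - s\<bar>"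
  shows "\<exists>\<pi>. (\<forall>z. 0 < Im z \<longrightarrow> dev_at \<pi> z) \<and> (\<forall>t. f t = \<pi> (\<i> * of_real (exp t)))"
proof -
  let ?c = "\<lambda>t::real. \<i> * complex_of_real (exp t)"
  have cont_c: "isCont ?c t" for t by (intro continuous_intros)
  obtain V \<psi> where V: "(V, \<psi>) \<in> \<A>" "f 0 \<in> V" using chart_exists by blast
  obtain C e where C: "mdet C = 1" "0 < e" "\<And>t. \<bar>t - 0\<bar> < e \<Longrightarrow> f t \<in> V \<and> \<psi> (f t) = moebius C (?c t)"
    using chart_geodesic[OF loc V] by blast
  let ?u = "\<lambda>w. inv_into V \<psi> (moebius C w)"
  obtain N where N: "open N" "N = {w \<in> upper_half_plane. moebius C w \<in> \<psi> ` V}" "\<And>w. w \<in> N \<Longrightarrow> dev_at ?u w"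
    using dev_at_inverse_chart[OF V(1) C(1)] by blast
  have "moebius C \<i> = \<psi> (f 0)" using C(2) C(3)[of 0] by simp
  then have "\<i> \<in> N" unfolding N(2) upper_half_plane_def using V(2) by auto
  then obtain \<pi> where \<pi>: "\<And>z. 0 < Im z \<Longrightarrow> dev_at \<pi> z" "\<forall>\<^sub>F w in nhds \<i>. \<pi> w = ?u w"
    using dev_exists[OF N(1) _ N(3)] by blast
  have cont: "isCont (\<lambda>t. \<pi> (?c t)) t" for t
    by (rule isCont_o2[where f = ?c, OF cont_c]) (rule dev_at_continuous[OF \<pi>(1)], simp)
  \<comment> \<open>Agreement on a neighbourhood is an open condition. It passes to limit points
    because in a chart both curves are Moebius images of the axis and two common points already fix
    the matrix up to sign.\<close>
  define G where "G = {t. \<forall>\<^sub>F s in nhds t. f s = \<pi> (?c s)}"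
  define H where "H = {t. \<forall>\<^sub>F s in nhds t. s \<notin> G}"
  have "open G" "open H" unfolding G_def H_def by (rule open_eventually_nhds)+
  have "0 \<in> G"
  proof -
    obtain M where M: "open M" "\<i> \<in> M" "\<And>w. w \<in> M \<Longrightarrow> \<pi> w = ?u w" using \<pi>(2) unfolding eventually_nhds by blast
    have "\<forall>\<^sub>F t in nhds 0. ?c t \<in> M" using M by (intro isCont_eventually_mem cont_c) auto
    moreover have "\<forall>\<^sub>F t in nhds 0. dist t 0 < e" using C(2) unfolding eventually_nhds_metric by blast
    ultimately have "\<forall>\<^sub>F t in nhds 0. f t = \<pi> (?c t)"
    proof eventually_elim
      case (elim t)
      then have "f t \<in> V" "\<psi> (f t) = moebius C (?c t)" using C(3)[of t] by (auto simp: dist_real_def)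
      then show ?case using M(3)[OF elim(1)] inv_into_f_f[OF chart_inj[OF V(1)]] by metis
    qed
    then show ?thesis unfolding G_def by blast
  qed
  have "t \<in> G \<union> H" for t
  proof (cases "f t = \<pi> (?c t)")
    case False
    have "((\<lambda>s. dist (f s) (\<pi> (?c s))) \<longlongrightarrow> dist (f t) (\<pi> (?c t))) (at t)"
      using local_geodesic_continuous[OF loc] cont unfolding isCont_def by (intro tendsto_dist)
    then have "\<forall>\<^sub>F s in at t. 0 < dist (f s) (\<pi> (?c s))" using False by (intro order_tendstoD(1)) auto
    then have "\<forall>\<^sub>F s in nhds t. f s \<noteq> \<pi> (?c s)"
      unfolding eventually_at_filter using False by (auto elim!: eventually_mono)
    then have "\<forall>\<^sub>F s in nhds t. s \<notin> G"
      by eventually_elim (use eventually_nhds_x_imp_x in \<open>auto simp: G_def\<close>)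
    then show ?thesis unfolding H_def by blast
  next
    case True
    obtain V \<psi> where V: "(V, \<psi>) \<in> \<A>" "f t \<in> V" using chart_exists by blast
    obtain C e where C: "mdet C = 1" "0 < e" "\<And>s. \<bar>s - t\<bar> < e \<Longrightarrow> f s \<in> V \<and> \<psi> (f s) = moebius C (?c s)"
      using chart_geodesic[OF loc V] by blast
    have "0 < Im (?c t)" by simp
    then obtain D N where D: "mdet D = 1" "open N" "?c t \<in> N" "\<And>w. w \<in> N \<Longrightarrow> \<pi> w \<in> V \<and> \<psi> (\<pi> w) = moebius D w"
      using dev_at_chart[OF \<pi>(1) V(1)] V(2) True by metis
    have "\<forall>\<^sub>F s in nhds t. ?c s \<in> N" using D by (intro isCont_eventually_mem cont_c) auto
    moreover have "\<forall>\<^sub>F s in nhds t. dist s t < e" using C(2) unfolding eventually_nhds_metric by blast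
    ultimately have "\<forall>\<^sub>F s in nhds t. ?c s \<in> N \<and> dist s t < e" by eventually_elim simp
    then obtain K where K: "open K" "t \<in> K" "\<And>s. s \<in> K \<Longrightarrow> ?c s \<in> N \<and> dist s t < e"
      unfolding eventually_nhds by blast
    have KC: "f s \<in> V \<and> \<psi> (f s) = moebius C (?c s) \<and> \<pi> (?c s) \<in> V \<and> \<psi> (\<pi> (?c s)) = moebius D (?c s)" if "s \<in> K" for s
      using C(3)[of s] D(4)[of "?c s"] K(3)[OF that] by (simp add: dist_real_def)
    show ?thesis
    proof (cases "K \<inter> G = {}")
      case True
      then have "t \<in> H" unfolding H_def eventually_nhds using K by blast
      then show ?thesis by blast
    next
      case False
      then obtain s0 where s0: "s0 \<in> K" "s0 \<in> G" by blast
      obtain M where M: "open M" "s0 \<in> M" "\<And>s. s \<in> M \<Longrightarrow> f s = \<pi> (?c s)"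
        using s0(2) unfolding G_def eventually_nhds by blast
      have "open (M \<inter> K)" "s0 \<in> M \<inter> K" using M K s0 by auto
      then obtain d where d: "0 < d" "ball s0 d \<subseteq> M \<inter> K" using openE by blast
      define s1 where "s1 = s0 + d / 2"
      have s1: "s1 \<in> M \<inter> K" "s1 \<noteq> s0" using d unfolding s1_def by (auto simp: dist_real_def)
      have eq: "moebius C (?c s) = moebius D (?c s)" if "s \<in> M \<inter> K" for s
        using KC[of s] M(3)[of s] that by auto
      have "C = D \<or> C = - D"
        using s1 \<open>s0 \<in> M \<inter> K\<close>
        by (intro moebius_eq_two_points[OF C(1) D(1), of "?c s0" "?c s1"] eq) auto
      then have "f s = \<pi> (?c s)" if "s \<in> K" for s
        using KC[OF that] inj_onD[OF chart_inj[OF V(1)], of "f s" "\<pi> (?c s)"] by auto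
      then have "t \<in> G" unfolding G_def eventually_nhds using K by blast
      then show ?thesis by blast
    qed
  qed
  moreover have "G \<inter> H = {}"
    unfolding H_def using eventually_nhds_x_imp_x by fastforce
  ultimately have "G = UNIV"
    using connectedD[OF connected_UNIV \<open>open G\<close> \<open>open H\<close>] \<open>0 \<in> G\<close> by blast
  then have "f t = \<pi> (?c t)" for t
    using eventually_nhds_x_imp_x[of "\<lambda>s. f s = \<pi> (?c s)" t] unfolding G_def by blast
  then show ?thesis using \<pi>(1) by blast
qed

end

section \<open>From pairs of arcs to the self-intersection number\<close>

lemma sinh_less_1: "\<epsilon> \<le> 1 / 2 \<Longrightarrow> sinh (\<epsilon> :: real) < 1"
proof -
  assume "\<epsilon> \<le> 1 / 2"
  then have "sinh \<epsilon> \<le> sinh (1 / 2)" by simp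
  also have "sinh (1 / 2 :: real) < 1"
  proof -
    have "(exp (1 / 2 :: real))\<^sup>2 = exp 1" by (simp flip: exp_double)
    then have "(exp (1 / 2 :: real))\<^sup>2 < 2\<^sup>2" using exp_le by simp
    then have "exp (1 / 2 :: real) < 2" by (rule power2_less_imp_less) simp
    moreover have "0 < exp (- (1 / 2) :: real)" by (rule exp_gt_zero)
    ultimately have "exp (1 / 2) - exp (- (1 / 2)) < (2 :: real)" by linarith
    then show ?thesis unfolding sinh_def by simp
  qed
  finally show ?thesis .
qed

lemma card_offdiagonal:
  assumes "finite F"
  shows "card {(s, t). s \<in> F \<and> t \<in> F \<and> s \<noteq> t} = 2 * (card F choose 2)"
proof -
  have "{(s, t). s \<in> F \<and> t \<in> F \<and> s \<noteq> t} = (SIGMA s:F. F - {s})" by auto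
  then have "card {(s, t). s \<in> F \<and> t \<in> F \<and> s \<noteq> t} = card F * (card F - 1)"
    using assms by (simp add: card_Diff_singleton)
  moreover have "even (card F * (card F - 1))" by (cases "card F") auto
  ultimately show ?thesis unfolding choose_two by simp
qed

text \<open>Ordered pairs, so that the set is covered by products of arcs; each unordered
  intersection appears twice.\<close>

definition self_intersections :: "(real \<Rightarrow> 'a) \<Rightarrow> real \<Rightarrow> (real \<times> real) set" where
  "self_intersections f L = {(s, t). s \<in> {0..<L} \<and> t \<in> {0..<L} \<and> s \<noteq> t \<and> f s = f t}"

lemma self_intersection_number_eq:
  assumes "finite (self_intersections f L)"
  shows "\<exists>k. self_intersection_number f L = of_nat k \<and> card (self_intersections f L) = 2 * k"
proof -
  let ?Q = "self_intersections f L" and ?D = "self_intersection_points f L"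
  let ?F = "\<lambda>x. {t \<in> {0..<L}. f t = x}"
  have D: "?D = (\<lambda>p. f (fst p)) ` ?Q"
    unfolding self_intersection_points_def self_intersections_def by force
  then have finD: "finite ?D" using assms by simp
  have finF: "finite (?F x)" if "x \<in> ?D" for x
  proof -
    obtain s t where st: "s \<in> {0..<L}" "t \<in> {0..<L}" "s \<noteq> t" "f s = x" "f t = x"
      using \<open>x \<in> ?D\<close> unfolding self_intersection_points_def by blast
    \<comment> \<open>A parameter over x differs from at least one of s and t and so occurs in an
      ordered pair; thus the fibre is finite.\<close>
    have "?F x \<subseteq> fst ` ?Q"
    proof
      fix r assume r: "r \<in> ?F x"
      then have "(r, s) \<in> ?Q \<or> (r, t) \<in> ?Q" using st unfolding self_intersections_def by auto
      then show "r \<in> fst ` ?Q" by force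
    qed
    then show ?thesis using assms by (simp add: finite_subset)
  qed
  let ?P = "\<lambda>x. {(s, t). s \<in> ?F x \<and> t \<in> ?F x \<and> s \<noteq> t}"
  have Q: "?Q = (\<Union>x\<in>?D. ?P x)"
    unfolding D by (auto simp: self_intersections_def)
  have finP: "finite (?P x)" if "x \<in> ?D" for x
    by (rule finite_subset[of _ "?F x \<times> ?F x"]) (use finF[OF that] in auto)
  have "card ?Q = (\<Sum>x\<in>?D. card (?P x))"
    unfolding Q by (rule card_UN_disjoint) (use finD finP in auto)
  also have "\<dots> = (\<Sum>x\<in>?D. 2 * (card (?F x) choose 2))"
    by (intro sum.cong refl card_offdiagonal finF)
  finally have "card ?Q = 2 * (\<Sum>x\<in>?D. card (?F x) choose 2)" by (simp add: sum_distrib_left)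
  moreover have "self_intersection_number f L = of_nat (\<Sum>x\<in>?D. card (?F x) choose 2)"
    unfolding self_intersection_number_def using finD by simp
  ultimately show ?thesis by blast
qed

text \<open>Displacements are measured at \<i> only, so each block of arcs is developed afresh with
  its own base point on the geodesic.\<close>

lemma developed_geodesic_shift:
  assumes "oriented_hyperbolic_atlas (A :: ('a::metric_space set \<times> ('a \<Rightarrow> complex)) set)" "complete (UNIV :: 'a set)"
    and f: "closed_geodesic f L" "primitive_period f L"
  shows "\<exists>\<pi>. developed_geodesic A \<pi> (\<lambda>t. f (a + t)) L"
proof -
  interpret complete_hyperbolic_atlas A by unfold_locales (use assms in auto)
  have per: "f (t + L) = f t" for t using f unfolding closed_geodesic_def by blast
  have "\<forall>t. \<exists>e>0. \<forall>r s. \<bar>r - t\<bar> < e \<longrightarrow> \<bar>s - t\<bar> < e \<longrightarrow> dist (f (a + r)) (f (a + s)) = \<bar>r - s\<bar>"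
  proof
    fix t
    obtain e where e: "0 < e" "\<And>r s. \<bar>r - (a + t)\<bar> < e \<Longrightarrow> \<bar>s - (a + t)\<bar> < e \<Longrightarrow> dist (f r) (f s) = \<bar>r - s\<bar>"
      using f unfolding closed_geodesic_def by blast
    have "dist (f (a + r)) (f (a + s)) = \<bar>r - s\<bar>" if "\<bar>r - t\<bar> < e" "\<bar>s - t\<bar> < e" for r s
      using e(2)[of "a + r" "a + s"] that by simp
    then show "\<exists>e>0. \<forall>r s. \<bar>r - t\<bar> < e \<longrightarrow> \<bar>s - t\<bar> < e \<longrightarrow> dist (f (a + r)) (f (a + s)) = \<bar>r - s\<bar>"
      using e(1) by blast
  qed
  then obtain \<pi> where \<pi>: "\<And>z. 0 < Im z \<Longrightarrow> dev_at \<pi> z" "\<And>t. f (a + t) = \<pi> (\<i> * of_real (exp t))"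
    using develop_geodesic[of "\<lambda>t. f (a + t)"] by blast
  have "developed_geodesic A \<pi> (\<lambda>t. f (a + t)) L"
  proof unfold_locales
    show "f (a + (t + L)) = f (a + t)" for t using per[of "a + t"] by (simp add: add.assoc)
    show "0 < L" using f unfolding closed_geodesic_def by blast
    show "primitive_period (\<lambda>t. f (a + t)) L"
      unfolding primitive_period_def
    proof (intro allI impI)
      fix p assume "0 < p \<and> p < L"
      then obtain t where t: "f (t + p) \<noteq> f t" using f(2) unfolding primitive_period_def by blast
      then have "f (a + ((t - a) + p)) \<noteq> f (a + (t - a))" by (simp add: algebra_simps)
      then show "\<exists>t. f (a + (t + p)) \<noteq> f (a + t)" by blast
    qed
  qed (use \<pi> in auto)
  then show ?thesis by blast
qed

theorem theorem1p3:
  fixes A :: "('a::metric_space set \<times> ('a \<Rightarrow> complex)) set"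
    and f :: "real \<Rightarrow> 'a" and L :: real
  assumes "oriented_hyperbolic_surface A"
    and "complete (UNIV :: 'a set)"
    and "finite_volume A"
    and "closed_geodesic f L"
    and "primitive_period f L"
  shows "self_intersection_number f L < ennreal (9 * L\<^sup>2 * exp (L / 2))"
proof -
  let ?Q = "self_intersections f L"
  have L: "0 < L" using assms(4) unfolding closed_geodesic_def by blast
  have dev: "\<exists>\<pi>. developed_geodesic A \<pi> (\<lambda>t. f (a + t)) L" for a
    using assms by (intro developed_geodesic_shift) (auto simp: oriented_hyperbolic_surface_def)
  have "finite ?Q \<and> real (card ?Q) < 18 * L\<^sup>2 * exp (L / 2)"
  proof (cases "?Q = {}")
    case True
    then show ?thesis using L by simp
  next
    case False
    then obtain s t where st: "s \<in> {0..<L}" "t \<in> {0..<L}" "s \<noteq> t" "f s = f t"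
      unfolding self_intersections_def by blast
    obtain \<pi> where "developed_geodesic A \<pi> (\<lambda>r. f (s + r)) L" using dev by blast
    then interpret d: developed_geodesic A \<pi> "\<lambda>r. f (s + r)" L .
    have sL: "1 \<le> sinh (L / 2)"
      using d.self_intersection_long[of "t - s"] st by auto
    have L1: "1 \<le> L"
    proof (rule ccontr)
      assume "\<not> 1 \<le> L"
      then have "sinh (L / 2) < 1" by (intro sinh_less_1) simp
      then show False using sL by simp
    qed
    \<comment> \<open>Enough arcs to have length at most 1/2; rounding up costs at most 1, which L
      \<ge> 1 absorbs into 3 L.\<close>
    define m where "m = nat \<lceil>2 * L\<rceil>"
    have m: "2 * L \<le> m" "m \<le> 3 * L" "0 < m" using L1 unfolding m_def by linarith+
    define \<epsilon> where "\<epsilon> = L / m"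
    have \<epsilon>: "0 < \<epsilon>" "\<epsilon> \<le> 1 / 2" "m * \<epsilon> = L" using m L unfolding \<epsilon>_def by (auto simp: divide_le_eq)
    \<comment> \<open>Midpoints of the arcs, so that an arc is the set of parameters within
      \<epsilon>/2 of its centre, as in \<open>block_count\<close>.\<close>
    define c where "c j = (real j + 1 / 2) * \<epsilon>" for j :: nat
    define P where "P j k = {(s, t). \<bar>s - c j\<bar> \<le> \<epsilon> / 2 \<and> \<bar>t - c k\<bar> \<le> \<epsilon> / 2 \<and> s \<noteq> t \<and> \<bar>s - t\<bar> < L \<and> f s = f t}" for j k
    have cover: "\<exists>j<m. \<bar>s - c j\<bar> \<le> \<epsilon> / 2" if s: "s \<in> {0..<L}" for s
    proof (intro exI[of _ "nat \<lfloor>s / \<epsilon>\<rfloor>"] conjI)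
      let ?j = "nat \<lfloor>s / \<epsilon>\<rfloor>"
      have j: "real ?j \<le> s / \<epsilon>" "s / \<epsilon> < real ?j + 1" using s \<epsilon>(1) by (simp_all add: of_nat_floor)
      have "s / \<epsilon> < m" using s \<epsilon> by (simp add: pos_divide_less_eq)
      then show "?j < m" using j(1) by linarith
      show "\<bar>s - c ?j\<bar> \<le> \<epsilon> / 2" using j \<epsilon>(1) unfolding c_def by (auto simp: field_simps abs_le_iff)
    qed
    have sub: "?Q \<subseteq> (\<Union>p\<in>{..<m} \<times> {..<m}. P (fst p) (snd p))"
    proof
      fix p assume p: "p \<in> ?Q"
      obtain s t where st: "p = (s, t)" by (cases p)
      have *: "s \<in> {0..<L}" "t \<in> {0..<L}" "s \<noteq> t" "f s = f t" using p unfolding st self_intersections_def by auto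
      obtain j k where jk: "j < m" "\<bar>s - c j\<bar> \<le> \<epsilon> / 2" "k < m" "\<bar>t - c k\<bar> \<le> \<epsilon> / 2" using cover *(1,2) by blast
      have "p \<in> P j k" unfolding st P_def using * jk by auto
      then show "p \<in> (\<Union>p\<in>{..<m} \<times> {..<m}. P (fst p) (snd p))" using jk by force
    qed
    have blk: "finite (P j k) \<and> real (card (P j k)) \<le> 1 + 2 * sinh (L / 2)" for j k
    proof -
      obtain \<pi> where "developed_geodesic A \<pi> (\<lambda>r. f (c j + r)) L" using dev by blast
      then interpret e: developed_geodesic A \<pi> "\<lambda>r. f (c j + r)" L .
      let ?P = "{(s, t). \<bar>s\<bar> \<le> \<epsilon> / 2 \<and> \<bar>t - (c k - c j)\<bar> \<le> \<epsilon> / 2 \<and> s \<noteq> t \<and> \<bar>s - t\<bar> < L \<and> f (c j + s) = f (c j + t)}"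
      have "P j k = (\<lambda>p. (c j + fst p, c j + snd p)) ` ?P"
      proof (intro equalityI subsetI)
        fix p assume p: "p \<in> P j k"
        then show "p \<in> (\<lambda>p. (c j + fst p, c j + snd p)) ` ?P"
          by (intro image_eqI[of _ _ "(fst p - c j, snd p - c j)"]) (auto simp: P_def)
      qed (auto simp: P_def algebra_simps)
      moreover have "inj_on (\<lambda>p. (c j + fst p, c j + snd p)) ?P" by (auto intro!: inj_onI)
      ultimately show ?thesis
        using e.block_count[of \<epsilon> "c k - c j"] \<epsilon> sL sinh_less_1 by (simp add: card_image)
    qed
    have fin: "finite (\<Union>p\<in>{..<m} \<times> {..<m}. P (fst p) (snd p))" using blk by auto
    have "real (card ?Q) \<le> real (card (\<Union>p\<in>{..<m} \<times> {..<m}. P (fst p) (snd p)))"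
      using card_mono[OF fin sub] by simp
    also have "\<dots> \<le> (\<Sum>p\<in>{..<m} \<times> {..<m}. real (card (P (fst p) (snd p))))"
      using card_UN_le[of "{..<m} \<times> {..<m}" "\<lambda>p. P (fst p) (snd p)"] by (simp flip: of_nat_sum)
    also have "\<dots> \<le> (\<Sum>p\<in>{..<m} \<times> {..<m}. 1 + 2 * sinh (L / 2))" using blk by (intro sum_mono) auto
    also have "\<dots> = (real m)\<^sup>2 * (1 + 2 * sinh (L / 2))" by (simp add: power2_eq_square)
    also have "\<dots> \<le> (3 * L)\<^sup>2 * (1 + 2 * sinh (L / 2))"
      using m sL by (intro mult_right_mono power_mono) auto
    also have "\<dots> < (3 * L)\<^sup>2 * (2 * exp (L / 2))"
    proof (rule mult_strict_left_mono)
      \<comment> \<open>Dropping the positive term exp (-L/2) is what makes the final inequality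
        strict.\<close>
      have "1 + 2 * sinh (L / 2) < 1 + exp (L / 2)" unfolding sinh_def by simp
      also have "\<dots> \<le> 2 * exp (L / 2)" using L by simp
      finally show "1 + 2 * sinh (L / 2) < 2 * exp (L / 2)" .
    qed (use L in simp)
    also have "\<dots> = 18 * L\<^sup>2 * exp (L / 2)" by (simp add: power_mult_distrib)
    finally show ?thesis using finite_subset[OF sub fin] by blast
  qed
  then obtain k where k: "self_intersection_number f L = of_nat k" "real (card ?Q) = 2 * real k" "real (card ?Q) < 18 * L\<^sup>2 * exp (L / 2)"
    using self_intersection_number_eq[of f L] by auto
  then have "real k < 9 * L\<^sup>2 * exp (L / 2)" by simp
  then show ?thesis unfolding k(1) ennreal_of_nat_eq_real_of_nat by (intro ennreal_lessI) (use L in auto)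
qed

end
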